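(* There is a deterministic parallel algorithm which, given an integer $k>0$, an accuracy $\epsilon>0$, and evaluation-oracle access to a submodular function $f:2^V\to\mathbb{R}$ (with $|V|=n$) that has a $k$-sparse minimizer, outputs an $\epsilon$-approximate minimizer of $f$, using parallel depth $\widetilde{O}(k^7\cdot\log(|f|/\epsilon))$ and runtime $\widetilde{O}(n^2\cdot k^7\log(|f|/\epsilon)\cdot\mathsf{EO}+\mathsf{poly}(n)\cdot\log(|f|/\epsilon))$.
   Context: $V$ is a finite ground set with $n=|V|$. A function $f:2^V\to\mathbb{R}$ is submodular if $f(S\cup\{i\})-f(S)\ge f(T\cup\{i\})-f(T)$ for all $S\subseteq T\subseteq V$, $i\notin T$; throughout $f(\emptyset)=0$. $f$ is accessed only through an evaluation oracle which returns $f(S)$ for a queried $S$ in time $\mathsf{EO}$. $|f|:=\max_{S\subseteq V}|f(S)|$, $f^*:=\min_{S\subseteq V}f(S)$. A set $S$ is an $\epsilon$-approximate minimizer if $f(S)\le f^*+\epsilon$. A $k$-sparse minimizer is a minimizer $S$ of $f$ with $|S|\le k$. In the parallel model, the algorithm may submit up to $\mathsf{poly}(n,\log(|f|/\epsilon))$ oracle queries per round; the parallel depth is the number of rounds. $\widetilde{O}(\cdot)$ hides $\mathsf{poly}(\log n)$ factors. *)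

theory Defs
  imports Complex_Main "HOL-Computational_Algebra.Polynomial"
begin

section \<open>Submodular functions\<close>

text \<open>Only the values of \<open>f\<close> on subsets of the ground set \<open>V\<close> are relevant below.\<close>

definition submodular_on :: "'a set \<Rightarrow> ('a set \<Rightarrow> real) \<Rightarrow> bool" where
  "submodular_on V f \<longleftrightarrow>
     (\<forall>S T. \<forall>i\<in>V. S \<subseteq> T \<and> T \<subseteq> V \<and> i \<notin> T \<longrightarrow> f (S \<union> {i}) - f S \<ge> f (T \<union> {i}) - f T)"

definition max_abs :: "'a set \<Rightarrow> ('a set \<Rightarrow> real) \<Rightarrow> real" where
  "max_abs V f = Max ((\<lambda>S. \<bar>f S\<bar>) ` Pow V)"

definition min_value :: "'a set \<Rightarrow> ('a set \<Rightarrow> real) \<Rightarrow> real" where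
  "min_value V f = Min (f ` Pow V)"

definition approx_minimizer :: "'a set \<Rightarrow> ('a set \<Rightarrow> real) \<Rightarrow> real \<Rightarrow> 'a set \<Rightarrow> bool" where
  "approx_minimizer V f \<epsilon> S \<longleftrightarrow> S \<subseteq> V \<and> f S \<le> min_value V f + \<epsilon>"

definition sparse_minimizer :: "'a set \<Rightarrow> ('a set \<Rightarrow> real) \<Rightarrow> nat \<Rightarrow> 'a set \<Rightarrow> bool" where
  "sparse_minimizer V f k S \<longleftrightarrow> S \<subseteq> V \<and> f S = min_value V f \<and> card S \<le> k"


section \<open>Deterministic parallel algorithms with an evaluation oracle\<close>

text \<open>
  Algorithms are programs of a real RAM. There are finitely many named arrays of natural numbers
  and of real numbers, every cell is initially 0, and array indices are computed at run time.
  A scalar variable is cell 0 of an array. The exact arithmetic operations and comparisons have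
  unit cost. Natural numbers have no division and reals have no rounding, and the only real
  constants are the natural numbers, so a program is a finite object that can hide neither
  advice nor bit-level parallelism in its numbers.
\<close>

type_synonym vname = string

record state =
  nats  :: "vname \<Rightarrow> nat \<Rightarrow> nat"
  reals :: "vname \<Rightarrow> nat \<Rightarrow> real"

datatype nexp =
    NConst nat
  | NCell vname nexp
  | NAdd nexp nexp
  | NSub nexp nexp
  | NMul nexp nexp

datatype rexp =
    ROfNat nexp
  | RCell vname nexp
  | RAdd rexp rexp
  | RSub rexp rexp
  | RMul rexp rexp
  | RDiv rexp rexp

datatype bexp =
    NLess nexp nexp
  | RLess rexp rexp
  | BNot bexp
  | BAnd bexp bexp

primrec nval :: "nexp \<Rightarrow> state \<Rightarrow> nat" where
  "nval (NConst c) s = c"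
| "nval (NCell x i) s = nats s x (nval i s)"
| "nval (NAdd a b) s = nval a s + nval b s"
| "nval (NSub a b) s = nval a s - nval b s"
| "nval (NMul a b) s = nval a s * nval b s"

primrec rval :: "rexp \<Rightarrow> state \<Rightarrow> real" where
  "rval (ROfNat a) s = real (nval a s)"
| "rval (RCell x i) s = reals s x (nval i s)"
| "rval (RAdd a b) s = rval a s + rval b s"
| "rval (RSub a b) s = rval a s - rval b s"
| "rval (RMul a b) s = rval a s * rval b s"
| "rval (RDiv a b) s = rval a s / rval b s"

primrec bval :: "bexp \<Rightarrow> state \<Rightarrow> bool" where
  "bval (NLess a b) s \<longleftrightarrow> nval a s < nval b s"
| "bval (RLess a b) s \<longleftrightarrow> rval a s < rval b s"
| "bval (BNot b) s \<longleftrightarrow> \<not> bval b s"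
| "bval (BAnd a b) s \<longleftrightarrow> bval a s \<and> bval b s"

datatype com =
    Skip
  | NAssign vname nexp nexp
  | RAssign vname nexp rexp
  | Seq com com
  | Cond bexp com com
  | While bexp com
  | QueryRound vname nexp vname

definition set_nat :: "vname \<Rightarrow> nat \<Rightarrow> nat \<Rightarrow> state \<Rightarrow> state" where
  "set_nat x i v s = s\<lparr>nats := (nats s)(x := (nats s x)(i := v))\<rparr>"

definition set_real :: "vname \<Rightarrow> nat \<Rightarrow> real \<Rightarrow> state \<Rightarrow> state" where
  "set_real x i v s = s\<lparr>reals := (reals s)(x := (reals s x)(i := v))\<rparr>"

text \<open>
  \<open>set_at n x p s\<close> is the subset of \<open>{..<n}\<close> whose characteristic vector occupies
  the cells \<open>p, \<dots>, p + n - 1\<close> of the array \<open>x\<close>.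
\<close>

definition set_at :: "nat \<Rightarrow> vname \<Rightarrow> nat \<Rightarrow> state \<Rightarrow> nat set" where
  "set_at n x p s = {i. i < n \<and> nats s x (p + i) \<noteq> 0}"

text \<open>
  \<open>QueryRound x a y\<close> is one parallel round. It submits \<open>m = nval a s\<close> sets, written one after
  the other in \<open>x\<close>, and receives their values in the cells \<open>0, \<dots>, m - 1\<close> of \<open>y\<close>. All \<open>m\<close> sets
  are fixed before any of the answers is known. No other command depends on \<open>f\<close>.

  In \<open>exec n f c s t k qs\<close>, the number \<open>k\<close> counts the executed operations apart from the
  evaluation of \<open>f\<close>, and \<open>qs\<close> lists the number of queries of each round. An assignment or a
  test counts as one operation, since the size of its expressions is bounded by a constant
  that depends only on the program.
\<close>

definition answer_round ::
  "nat \<Rightarrow> (nat set \<Rightarrow> real) \<Rightarrow> vname \<Rightarrow> nat \<Rightarrow> vname \<Rightarrow> state \<Rightarrow> state" where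
  "answer_round n f x m y s =
     s\<lparr>reals := (reals s)(y := (\<lambda>j. if j < m then f (set_at n x (j * n) s) else reals s y j))\<rparr>"

inductive exec ::
  "nat \<Rightarrow> (nat set \<Rightarrow> real) \<Rightarrow> com \<Rightarrow> state \<Rightarrow> state \<Rightarrow> nat \<Rightarrow> nat list \<Rightarrow> bool"
  for n :: nat and f :: "nat set \<Rightarrow> real" where
  Skip: "exec n f Skip s s 1 []"
| NAssign: "exec n f (NAssign x i a) s (set_nat x (nval i s) (nval a s) s) 1 []"
| RAssign: "exec n f (RAssign x i a) s (set_real x (nval i s) (rval a s) s) 1 []"
| Seq: "exec n f c s s' k qs \<Longrightarrow> exec n f d s' s'' k' qs' \<Longrightarrow>
    exec n f (Seq c d) s s'' (k + k') (qs @ qs')"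
| CondTrue: "bval b s \<Longrightarrow> exec n f c s s' k qs \<Longrightarrow> exec n f (Cond b c d) s s' (Suc k) qs"
| CondFalse: "\<not> bval b s \<Longrightarrow> exec n f d s s' k qs \<Longrightarrow> exec n f (Cond b c d) s s' (Suc k) qs"
| WhileFalse: "\<not> bval b s \<Longrightarrow> exec n f (While b c) s s 1 []"
| WhileTrue: "bval b s \<Longrightarrow> exec n f c s s' k qs \<Longrightarrow> exec n f (While b c) s' s'' k' qs' \<Longrightarrow>
    exec n f (While b c) s s'' (Suc (k + k')) (qs @ qs')"
| QueryRound: "m = nval a s \<Longrightarrow>
    exec n f (QueryRound x a y) s (answer_round n f x m y s) (Suc m) [m]"

inductive_cases SkipE: "exec n f Skip s t k qs"
inductive_cases NAssignE: "exec n f (NAssign x i a) s t k qs"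
inductive_cases RAssignE: "exec n f (RAssign x i a) s t k qs"
inductive_cases SeqE: "exec n f (Seq c d) s t k qs"
inductive_cases CondE: "exec n f (Cond b c d) s t k qs"
inductive_cases WhileE: "exec n f (While b c) s t k qs"
inductive_cases QueryRoundE: "exec n f (QueryRound x a y) s t k qs"

lemma exec_deterministic:
  assumes "exec n f c s t k qs" "exec n f c s t' k' qs'"
  shows "t' = t \<and> k' = k \<and> qs' = qs"
  using assms
proof (induction arbitrary: t' k' qs' rule: exec.induct)
  case (Seq c s s1 k1 qs1 d s2 k2 qs2)
  from Seq.prems show ?case by (rule SeqE) (use Seq.IH in blast)
next
  case (CondTrue b s c s1 k1 qs1 d)
  from CondTrue.prems show ?case by (rule CondE) (use CondTrue.IH CondTrue.hyps in blast)+
next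
  case (CondFalse b s d s1 k1 qs1 c)
  from CondFalse.prems show ?case by (rule CondE) (use CondFalse.IH CondFalse.hyps in blast)+
next
  case (WhileTrue b s c s1 k1 qs1 s2 k2 qs2)
  from WhileTrue.prems show ?case by (rule WhileE) (use WhileTrue.IH WhileTrue.hyps in blast)+
qed (auto elim: SkipE NAssignE RAssignE WhileE QueryRoundE)

text \<open>The input is \<open>n\<close>, \<open>k\<close> and \<open>\<epsilon>\<close>. In particular \<open>|f|\<close> is not given to the program.\<close>

definition initial_state :: "nat \<Rightarrow> nat \<Rightarrow> real \<Rightarrow> state" where
  "initial_state n k \<epsilon> =
     set_nat ''n'' 0 n (set_nat ''k'' 0 k (set_real ''eps'' 0 \<epsilon>
       \<lparr>nats = (\<lambda>_ _. 0), reals = (\<lambda>_ _. 0)\<rparr>))"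

definition output_set :: "nat \<Rightarrow> state \<Rightarrow> nat set" where
  "output_set n s = set_at n ''out'' 0 s"

definition parallel_depth :: "nat list \<Rightarrow> nat" where
  "parallel_depth qs = length qs"

text \<open>The runtime is the total (sequential) work if one evaluation of \<open>f\<close> takes time \<open>EO\<close>.\<close>

definition runtime :: "real \<Rightarrow> nat \<Rightarrow> nat list \<Rightarrow> real" where
  "runtime EO steps qs = real steps + EO * real (sum_list qs)"


section \<open>Asymptotic bounds\<close>

text \<open>
  \<open>log_ratio V f \<epsilon>\<close> is the quantity \<open>log (|f| / \<epsilon>)\<close> of the bounds. The literal logarithm is not
  positive if \<open>|f| \<le> \<epsilon>\<close>, and undefined if \<open>f\<close> vanishes, so it is cut off below at 1.
\<close>

definition log_ratio :: "'a set \<Rightarrow> ('a set \<Rightarrow> real) \<Rightarrow> real \<Rightarrow> real" where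
  "log_ratio V f \<epsilon> = max 1 (log 2 (max_abs V f / \<epsilon>))"

text \<open>
  A quantity is soft-O of \<open>X\<close>, with hidden factors \<open>poly (log n)\<close>, if it is at most
  \<open>soft_O C c n X\<close> for some constants \<open>C\<close> and \<open>c\<close>. The shift in \<open>n + 2\<close> makes
  the logarithm at least 1, so that the bound is meaningful for every \<open>n\<close>.
\<close>

definition soft_O :: "real \<Rightarrow> nat \<Rightarrow> nat \<Rightarrow> real \<Rightarrow> real" where
  "soft_O C c n X = C * log 2 (real n + 2) ^ c * X"

end

theory Submission
  imports Defs
begin

text \<open>
  Fix a sparse minimizer \<open>S\<close> with at most \<open>k\<close> elements. The algorithm maintains a preorder \<open>R\<close> of
  implications ``\<open>p \<in> S\<close> forces \<open>q \<in> S\<close>'', with a root that stands for a true premise, and a scale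
  \<open>M\<close> that bounds the gap between the set \<open>W\<close> of forced elements and the optimum, as well as the increments
  \<open>f (R p) - f W\<close> of all rows that are small enough to lie in \<open>S\<close>.

  For every row \<open>A = R p\<close> in parallel, a multiplicative weights process runs on the Lovasz extension of
  \<open>f\<close> contracted by \<open>A\<close>. The weights are capped at 1, and the mass that is cut off is recorded per element.
  If \<open>D\<close> is the gap of \<open>A\<close>, the linear update makes the total of weights and cut-off mass grow
  by at most \<open>\<eta> D\<close> per step, whereas, if \<open>A \<subseteq> S\<close>, the logarithms of the weights in \<open>S\<close> grow
  by almost \<open>\<eta> D\<close> per step and convert to cut-off mass at the cap. Hence almost all cut-off mass lies in \<open>S\<close>:
  an element with a lot of it is forced by \<open>p\<close>, and if there is none, then \<open>D \<le> M / 2\<close> or \<open>p \<notin> S\<close>.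
  Each of these outcomes enlarges a row, so \<open>k + 1\<close> rounds of arc insertion suffice to halve \<open>M\<close>.
\<close>

section \<open>Submodular functions\<close>

text \<open>Two relations are kept apart during a phase. Increments are known to be small only for
  the rows of the relation \<open>R0\<close> at the start of the phase, so the closed sets and
  marginals of the multiplicative weights use \<open>R0\<close>, while the growing relation
  \<open>R\<close> supplies only the base \<open>A\<close>. The outcome for \<open>p\<close> then
  depends on \<open>R\<close> through the row of \<open>p\<close> and the row of the root alone,
  which is what makes the rounds of a phase countable. The other obstacle is that losses are bounded
  above by multiples of \<open>k * M\<close> but not below: at a prefix, \<open>f\<close> may exceed
  its minimum by far more than \<open>M\<close>. No step uses a lower bound on a single loss; see
  \<open>sum_ln_growth\<close>. Large gains push weights beyond 1, and recording the cut-off mass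
  instead of rescaling keeps the linear count exact. A phase costs \<open>k + 1\<close> times about
  \<open>k^5 * log n\<close> query rounds, so the depth per halving is of order \<open>k^6\<close>,
  within the claimed exponent 7.\<close>

definition ev :: "nat \<Rightarrow> (nat set \<Rightarrow> real) \<Rightarrow> nat set \<Rightarrow> real" where
  "ev n f X = f (X \<inter> {..<n})"

text \<open>Adding the elements of \<open>Z\<close> one at a time reduces this to the definition. An
  element of \<open>Z\<close> that lies in \<open>Y\<close> has marginal 0 there but possibly a
  negative one at \<open>X\<close>, which is why it must already belong to \<open>X\<close>.\<close>

lemma submodular_on_marginal:
  assumes sub: "submodular_on V f" and "finite Z" "X \<subseteq> Y" "Y \<subseteq> V" "Z \<subseteq> V" "Z \<inter> Y \<subseteq> X"
  shows "f (Y \<union> Z) - f Y \<le> f (X \<union> Z) - f X"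
  using assms(2,5,6)
proof (induction Z rule: finite_induct)
  case empty
  then show ?case by simp
next
  case (insert z Z)
  have IH: "f (Y \<union> Z) - f Y \<le> f (X \<union> Z) - f X" using insert by blast
  show ?case
  proof (cases "z \<in> Y \<union> Z")
    case True
    then have "z \<in> X \<union> Z" using insert by auto
    then have "X \<union> insert z Z = X \<union> Z" "Y \<union> insert z Z = Y \<union> Z" using True by auto
    then show ?thesis using IH by simp
  next
    case False
    have "z \<in> V" "X \<union> Z \<subseteq> Y \<union> Z" "Y \<union> Z \<subseteq> V"
      using insert.prems assms(3,4) by auto
    then have "f ((X \<union> Z) \<union> {z}) - f (X \<union> Z) \<ge> f ((Y \<union> Z) \<union> {z}) - f (Y \<union> Z)"
      using sub[unfolded submodular_on_def, rule_format, of z "X \<union> Z" "Y \<union> Z"] False by simp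
    then show ?thesis using IH by (simp add: Un_assoc)
  qed
qed

text \<open>Rows of a relation also contain the indices \<open>n\<close> and \<open>n + 1\<close>.
  Since \<open>ev\<close> discards them, the inequality holds for arbitrary sets of indices, without
  side conditions on the ground set.\<close>

lemma ev_marginal:
  assumes "submodular_on {..<n} f" "X \<subseteq> Y" "Z \<inter> Y \<subseteq> X"
  shows "ev n f (Y \<union> Z) - ev n f Y \<le> ev n f (X \<union> Z) - ev n f X"
proof -
  have "f ((Y \<inter> {..<n}) \<union> (Z \<inter> {..<n})) - f (Y \<inter> {..<n})
      \<le> f ((X \<inter> {..<n}) \<union> (Z \<inter> {..<n})) - f (X \<inter> {..<n})"
    by (rule submodular_on_marginal[OF assms(1)]) (use assms in auto)
  then show ?thesis by (simp add: ev_def Int_Un_distrib2)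
qed

lemma ev_cong: "X \<inter> {..<n} = Y \<inter> {..<n} \<Longrightarrow> ev n f X = ev n f Y"
  by (simp add: ev_def)

lemma ev_Un_le:
  assumes "submodular_on {..<n} f"
  shows "ev n f (X \<union> Y) + ev n f (X \<inter> Y) \<le> ev n f X + ev n f Y"
proof -
  have "X \<inter> Y \<union> Y = Y" by blast
  then show ?thesis using ev_marginal[OF assms, of "X \<inter> Y" X Y] by (simp add: inf_commute)
qed

text \<open>The excess over a lower bound \<open>m\<close> is subadditive, because the value at an
  intersection is itself at least \<open>m\<close>. For the empty union the right-hand side would be
  0, hence \<open>I \<noteq> {}\<close>.\<close>

lemma ev_UN_le:
  assumes sub: "submodular_on {..<n} f" and low: "\<And>X. m \<le> ev n f X"
    and "finite I" "I \<noteq> {}" "\<And>i. i \<in> I \<Longrightarrow> ev n f (C i) - m \<le> B"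
  shows "ev n f (\<Union>i\<in>I. C i) - m \<le> real (card I) * B"
  using assms(3-5)
proof (induction I rule: finite_ne_induct)
  case (singleton x)
  then show ?case by simp
next
  case (insert x I)
  have "ev n f (\<Union>i\<in>I. C i) - m \<le> real (card I) * B" using insert by simp
  moreover have "ev n f (C x) - m \<le> B" using insert by simp
  moreover have "ev n f (C x \<union> (\<Union>i\<in>I. C i)) + ev n f (C x \<inter> (\<Union>i\<in>I. C i))
     \<le> ev n f (C x) + ev n f (\<Union>i\<in>I. C i)" by (rule ev_Un_le[OF sub])
  moreover have "m \<le> ev n f (C x \<inter> (\<Union>i\<in>I. C i))" by (rule low)
  ultimately have "ev n f (C x \<union> (\<Union>i\<in>I. C i)) - m \<le> B + real (card I) * B" by linarith
  then show ?case using insert.hyps by (simp add: distrib_right add.commute)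
qed

section \<open>Greedy marginals along an order of closed sets\<close>

locale strict_order_on =
  fixes U :: "nat set" and lt :: "nat \<Rightarrow> nat \<Rightarrow> bool"
  assumes fin: "finite U"
    and irr: "\<And>a. a \<in> U \<Longrightarrow> \<not> lt a a"
    and tra: "\<And>a b c. a \<in> U \<Longrightarrow> b \<in> U \<Longrightarrow> c \<in> U \<Longrightarrow> lt a b \<Longrightarrow> lt b c \<Longrightarrow> lt a c"
    and tot: "\<And>a b. a \<in> U \<Longrightarrow> b \<in> U \<Longrightarrow> a \<noteq> b \<Longrightarrow> lt a b \<or> lt b a"
begin

text \<open>The induction runs over all down-closed subsets of \<open>U\<close>. Removing the
  element of largest rank from such a set leaves exactly the predecessors of that element.\<close>

lemma induct_down:
  assumes base: "P {}" and step: "\<And>x. x \<in> U \<Longrightarrow> P {e \<in> U. lt e x} \<Longrightarrow> P (insert x {e \<in> U. lt e x})"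
  shows "P U"
proof -
  define rk where "rk a = card {e \<in> U. lt e a}" for a
  have mono: "rk a < rk b" if "a \<in> U" "b \<in> U" "lt a b" for a b
    unfolding rk_def
  proof (rule psubset_card_mono)
    show "finite {e \<in> U. lt e b}" using fin by simp
    show "{e \<in> U. lt e a} \<subset> {e \<in> U. lt e b}" using that tra irr by blast
  qed
  have "E \<subseteq> U \<Longrightarrow> (\<And>a b. a \<in> E \<Longrightarrow> b \<in> U \<Longrightarrow> lt b a \<Longrightarrow> b \<in> E) \<Longrightarrow> P E" for E
  proof (induction "card E" arbitrary: E)
    case 0
    then show ?case using base fin finite_subset by fastforce
  next
    case (Suc m)
    have finE: "finite E" using fin Suc.prems finite_subset by blast
    have "E \<noteq> {}" using Suc.hyps by auto
    then have "Max (rk ` E) \<in> rk ` E" using finE by simp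
    then obtain x where x: "x \<in> E" "rk x = Max (rk ` E)" by auto
    have mx: "rk a \<le> rk x" if "a \<in> E" for a using that finE x by simp
    have eq: "E - {x} = {e \<in> U. lt e x}"
    proof
      show "E - {x} \<subseteq> {e \<in> U. lt e x}"
      proof
        fix a assume a: "a \<in> E - {x}"
        then have "\<not> lt x a" using mono[of x a] mx[of a] x Suc.prems(1) by force
        then show "a \<in> {e \<in> U. lt e x}" using tot[of a x] a x Suc.prems(1) by auto
      qed
      show "{e \<in> U. lt e x} \<subseteq> E - {x}" using Suc.prems x irr by auto
    qed
    have "P (E - {x})"
    proof (rule Suc.hyps(1))
      show "m = card (E - {x})" using Suc.hyps(2) x finE by simp
      show "E - {x} \<subseteq> U" using Suc.prems(1) by blast
      show "b \<in> E - {x}" if "a \<in> E - {x}" "b \<in> U" "lt b a" for a b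
      proof -
        have "a \<in> U" "lt a x" using that(1) eq by auto
        then have "b \<noteq> x" using that(3) tra[of a x a] irr[of a] \<open>b \<in> U\<close> by auto
        moreover have "b \<in> E" using Suc.prems(2)[of a b] that by blast
        ultimately show ?thesis by blast
      qed
    qed
    moreover have "x \<in> U" using x Suc.prems(1) by blast
    ultimately have "P (insert x {e \<in> U. lt e x})" using step by (simp only: eq)
    moreover have "insert x {e \<in> U. lt e x} = E" using x eq by blast
    ultimately show ?case by simp
  qed
  then show ?thesis by blast
qed

definition before_union :: "nat set \<Rightarrow> (nat \<Rightarrow> nat set) \<Rightarrow> nat \<Rightarrow> nat set" where
  "before_union A C d = A \<union> (\<Union>e\<in>{e \<in> U. lt e d}. C e)"

definition greedy :: "(nat set \<Rightarrow> real) \<Rightarrow> nat set \<Rightarrow> (nat \<Rightarrow> nat set) \<Rightarrow> nat \<Rightarrow> real" where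
  "greedy F A C d = F (before_union A C d \<union> C d) - F (before_union A C d)"

lemma sum_down_insert:
  fixes h :: "nat \<Rightarrow> real"
  shows "x \<in> U \<Longrightarrow> sum h (insert x {e \<in> U. lt e x}) = h x + sum h {e \<in> U. lt e x}"
  using fin irr by simp

text \<open>For weights that decrease along the order, the sum is a Lovasz extension at
  \<open>xt\<close> minus \<open>F A\<close>, that is, an average of values of \<open>F\<close> on
  prefixes. Abel summation is carried out by a slack term \<open>c * (F ... - m)\<close>, in which
  \<open>c\<close> is any number below the weights seen so far; the next weight is substituted for
  it.\<close>

lemma greedy_Lovasz_lower:
  fixes xt :: "nat \<Rightarrow> real"
  assumes low: "\<And>X. m \<le> F X" and xt: "\<And>d. d \<in> U \<Longrightarrow> 0 \<le> xt d \<and> xt d \<le> 1"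
    and ord: "\<And>e d. e \<in> U \<Longrightarrow> d \<in> U \<Longrightarrow> lt e d \<Longrightarrow> xt d \<le> xt e"
  shows "(\<Sum>d\<in>U. xt d * greedy F A C d) \<ge> m - F A"
proof -
  have "\<forall>c. 0 \<le> c \<and> c \<le> 1 \<and> (\<forall>e\<in>U. c \<le> xt e) \<longrightarrow>
     (\<Sum>d\<in>U. xt d * greedy F A C d) \<ge> m - F A + c * (F (A \<union> (\<Union>e\<in>U. C e)) - m)"
  proof (rule induct_down[where P = "\<lambda>E. \<forall>c. 0 \<le> c \<and> c \<le> 1 \<and> (\<forall>e\<in>E. c \<le> xt e) \<longrightarrow>
     (\<Sum>d\<in>E. xt d * greedy F A C d) \<ge> m - F A + c * (F (A \<union> (\<Union>e\<in>E. C e)) - m)"], goal_cases)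
    case 1
    then show ?case
    proof (intro allI impI)
      fix c :: real assume c: "0 \<le> c \<and> c \<le> 1 \<and> (\<forall>e\<in>{}. c \<le> xt e)"
      have "c * (F A - m) \<le> 1 * (F A - m)" using c low by (intro mult_right_mono) auto
      then show "(\<Sum>d\<in>{}. xt d * greedy F A C d) \<ge> m - F A + c * (F (A \<union> (\<Union>e\<in>{}. C e)) - m)" by simp
    qed
  next
    case (2 x)
    let ?E = "{e \<in> U. lt e x}"
    show ?case
    proof (intro allI impI)
      fix c :: real assume c: "0 \<le> c \<and> c \<le> 1 \<and> (\<forall>e\<in>insert x ?E. c \<le> xt e)"
      have "\<forall>e\<in>?E. xt x \<le> xt e" using ord 2(1) by blast
      then have "(\<Sum>d\<in>?E. xt d * greedy F A C d) \<ge> m - F A + xt x * (F (A \<union> (\<Union>e\<in>?E. C e)) - m)"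
        using 2(2) xt[OF 2(1)] by blast
      moreover have "greedy F A C x = F (A \<union> (\<Union>e\<in>insert x ?E. C e)) - F (A \<union> (\<Union>e\<in>?E. C e))"
        unfolding greedy_def before_union_def by (simp add: Un_ac)
      moreover have "c * (F (A \<union> (\<Union>e\<in>insert x ?E. C e)) - m) \<le> xt x * (F (A \<union> (\<Union>e\<in>insert x ?E. C e)) - m)"
        using c low by (intro mult_right_mono) auto
      ultimately show "(\<Sum>d\<in>insert x ?E. xt d * greedy F A C d)
          \<ge> m - F A + c * (F (A \<union> (\<Union>e\<in>insert x ?E. C e)) - m)"
        unfolding sum_down_insert[OF 2(1)] by (simp only: right_diff_distrib)
    qed
  qed
  from this[rule_format, of 0] show ?thesis using xt by simp
qed

text \<open>By submodularity, intersecting each prefix with \<open>T\<close> only raises the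
  marginals of elements of \<open>T\<close>. The raised marginals telescope, because an element
  outside \<open>T\<close> contributes nothing inside \<open>T\<close> that its prefix
  lacks.\<close>

lemma greedy_closed_le:
  assumes sub: "\<And>X Y Z. X \<subseteq> Y \<Longrightarrow> Z \<inter> Y \<subseteq> X \<Longrightarrow> F (Y \<union> Z) - F Y \<le> F (X \<union> Z) - F X"
    and A: "A \<subseteq> T" and C: "\<And>d. d \<in> U \<Longrightarrow> d \<in> T \<Longrightarrow> C d \<subseteq> T"
    and new: "\<And>d e. d \<in> U \<Longrightarrow> d \<notin> T \<Longrightarrow> e \<in> C d \<Longrightarrow> e \<in> T \<Longrightarrow> e \<in> before_union A C d"
  shows "(\<Sum>d\<in>U \<inter> T. greedy F A C d) \<le> F ((A \<union> (\<Union>e\<in>U. C e)) \<inter> T) - F A"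
proof -
  let ?h = "\<lambda>d. if d \<in> T then greedy F A C d else 0"
  have "(\<Sum>d\<in>U. ?h d) \<le> F ((A \<union> (\<Union>e\<in>U. C e)) \<inter> T) - F A"
  proof (rule induct_down[where P = "\<lambda>E. (\<Sum>d\<in>E. ?h d) \<le> F ((A \<union> (\<Union>e\<in>E. C e)) \<inter> T) - F A"], goal_cases)
    case 1
    then show ?case using A by (simp add: Int_absorb2)
  next
    case (2 x)
    let ?E = "{e \<in> U. lt e x}"
    let ?Q = "A \<union> (\<Union>e\<in>?E. C e)"
    have Q: "before_union A C x = ?Q" by (simp add: before_union_def)
    show ?case
    proof (cases "x \<in> T")
      case True
      have "greedy F A C x = F (?Q \<union> C x) - F ?Q" by (simp add: greedy_def Q)
      also have "\<dots> \<le> F ((?Q \<inter> T) \<union> C x) - F (?Q \<inter> T)"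
        by (rule sub) (use C[OF 2(1) True] in auto)
      also have "(?Q \<inter> T) \<union> C x = (A \<union> (\<Union>e\<in>insert x ?E. C e)) \<inter> T"
        using C[OF 2(1) True] by auto
      finally show ?thesis using 2(2) True unfolding sum_down_insert[OF 2(1)] by simp
    next
      case False
      have "(A \<union> (\<Union>e\<in>insert x ?E. C e)) \<inter> T = ?Q \<inter> T"
        using new[OF 2(1) False] unfolding Q by auto
      then show ?thesis using 2(2) False unfolding sum_down_insert[OF 2(1)] by simp
    qed
  qed
  then show ?thesis using fin by (simp add: sum.If_cases)
qed

end

section \<open>Implications between elements of a sparse minimizer\<close>

text \<open>
  The index \<open>n\<close> is the root. The index \<open>n + 1\<close> is falsity: an arc from \<open>a\<close> to \<open>n + 1\<close> records that \<open>a \<notin> S\<close>.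
\<close>

definition arc_rel :: "nat \<Rightarrow> nat set \<Rightarrow> (nat \<Rightarrow> nat \<Rightarrow> bool) \<Rightarrow> bool" where
  "arc_rel n S R \<longleftrightarrow> (\<forall>a b. R a b \<longrightarrow> a < n + 2 \<and> b < n + 2) \<and> (\<forall>a<n+2. R a a) \<and>
     (\<forall>a b c. R a b \<longrightarrow> R b c \<longrightarrow> R a c) \<and> (\<forall>a<n+2. R a n) \<and>
     (\<forall>a b. R a b \<longrightarrow> a \<in> insert n S \<longrightarrow> b \<in> insert n S)"

definition row_size :: "nat \<Rightarrow> (nat \<Rightarrow> nat \<Rightarrow> bool) \<Rightarrow> nat \<Rightarrow> nat" where
  "row_size n R a = card {b. b \<le> n \<and> R a b}"

text \<open>The \<open>+ 1\<close> is the root: a premise that holds for \<open>S\<close> has its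
  whole row inside \<open>insert n S\<close>, so rows that are not live cannot belong to elements of
  \<open>S\<close>.\<close>

definition live :: "nat \<Rightarrow> nat \<Rightarrow> (nat \<Rightarrow> nat \<Rightarrow> bool) \<Rightarrow> nat \<Rightarrow> bool" where
  "live n kn R a \<longleftrightarrow> row_size n R a \<le> kn + 1 \<and> \<not> R a (n + 1)"

primrec leader_upto :: "(nat \<Rightarrow> nat \<Rightarrow> bool) \<Rightarrow> (nat \<Rightarrow> real) \<Rightarrow> nat \<Rightarrow> nat \<Rightarrow> nat" where
  "leader_upto R x q 0 = q"
| "leader_upto R x q (Suc p) =
     (if R p q \<and> x (leader_upto R x q p) < x p then p else leader_upto R x q p)"

definition leader :: "nat \<Rightarrow> (nat \<Rightarrow> nat \<Rightarrow> bool) \<Rightarrow> (nat \<Rightarrow> real) \<Rightarrow> nat \<Rightarrow> nat" where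
  "leader n R x q = leader_upto R x q n"

text \<open>
  Every element is weighted like its leader, its heaviest predecessor, which makes the level sets closed
  under \<open>R\<close>. Among equal weights the smaller row comes first, so that an element of \<open>S\<close>
  precedes every \<open>d \<notin> S\<close> with an arc to it.
\<close>

definition prec :: "nat \<Rightarrow> (nat \<Rightarrow> nat \<Rightarrow> bool) \<Rightarrow> (nat \<Rightarrow> real) \<Rightarrow> nat \<Rightarrow> nat \<Rightarrow> bool" where
  "prec n R x e d \<longleftrightarrow> x (leader n R x d) < x (leader n R x e) \<or>
     \<not> x (leader n R x e) < x (leader n R x d) \<and> row_size n R e * n + e < row_size n R d * n + d"

definition prefix_set ::
  "nat \<Rightarrow> (nat \<Rightarrow> nat \<Rightarrow> bool) \<Rightarrow> nat set \<Rightarrow> (nat \<Rightarrow> real) \<Rightarrow> nat \<Rightarrow> nat set" where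
  "prefix_set n R A x d = A \<union> (\<Union>e\<in>{e \<in> {..<n}. prec n R x e d}. Collect (R e))"

definition marg ::
  "nat \<Rightarrow> (nat set \<Rightarrow> real) \<Rightarrow> (nat \<Rightarrow> nat \<Rightarrow> bool) \<Rightarrow> nat set \<Rightarrow> (nat \<Rightarrow> real) \<Rightarrow> nat \<Rightarrow> real" where
  "marg n f R A x d = ev n f (prefix_set n R A x d \<union> Collect (R d)) - ev n f (prefix_set n R A x d)"

text \<open>
  Positive marginals are charged to the leader. Hence the loss at the weights \<open>x\<close> is at least the value of the
  Lovasz extension at the closed weights, and the loss of \<open>S\<close> does not increase, since
  a leader in \<open>S\<close> only leads elements of \<open>S\<close>.
\<close>

definition charge :: "nat \<Rightarrow> (nat \<Rightarrow> nat \<Rightarrow> bool) \<Rightarrow> (nat \<Rightarrow> real) \<Rightarrow> (nat \<Rightarrow> real) \<Rightarrow> nat \<Rightarrow> real" where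
  "charge n R x g p = min (g p) 0 + (\<Sum>q<n. if leader n R x q = p \<and> 0 < g q then g q else 0)"

text \<open>The second component is the recorded cut-off mass. Entries at \<open>p \<ge> n\<close>
  are set to 0 so that the pair equals, as functions, what \<open>row_fun\<close> reads from
  memory.\<close>

definition mw_step ::
  "nat \<Rightarrow> (nat set \<Rightarrow> real) \<Rightarrow> (nat \<Rightarrow> nat \<Rightarrow> bool) \<Rightarrow> real \<Rightarrow> nat set \<Rightarrow>
    (nat \<Rightarrow> real) \<times> (nat \<Rightarrow> real) \<Rightarrow> (nat \<Rightarrow> real) \<times> (nat \<Rightarrow> real)" where
  "mw_step n f R \<eta> A z =
    (let x = fst z; v = (\<lambda>p. x p * (1 - \<eta> * charge n R x (marg n f R A x) p))
     in (\<lambda>p. if p < n then min 1 (v p) else 0, \<lambda>p. if p < n then snd z p + max 0 (v p - 1) else 0))"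

text \<open>Elements that are not live cannot lie in \<open>S\<close>, and the value of their rows
  is not controlled. They start at weight 0, where a multiplicative update keeps them.\<close>

definition mw_init :: "nat \<Rightarrow> nat \<Rightarrow> (nat \<Rightarrow> nat \<Rightarrow> bool) \<Rightarrow> (nat \<Rightarrow> real) \<times> (nat \<Rightarrow> real)" where
  "mw_init n kn R = (\<lambda>p. if p < n \<and> live n kn R p then 1 / real n else 0, \<lambda>p. 0)"

lemma leader_upto_rel: "R q q \<Longrightarrow> R (leader_upto R x q m) q"
  by (induction m) auto

lemma leader_upto_ge: "x q \<le> x (leader_upto R x q m)"
  by (induction m) auto

lemma leader_upto_max: "p < m \<Longrightarrow> R p q \<Longrightarrow> x p \<le> x (leader_upto R x q m)"
  by (induction m) (auto simp: less_Suc_eq)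

lemma leader_upto_less: "q < n \<Longrightarrow> m \<le> n \<Longrightarrow> leader_upto R x q m < n"
  by (induction m) auto

text \<open>Since \<open>c\<close> is not bounded below, the negative parts cannot be expanded one
  by one. They are merged first, by \<open>ln (1 + a + b) \<le> ln (1 + a) + ln (1 + b)\<close> for
  nonnegative \<open>a\<close> and \<open>b\<close>. Their total is at least
  \<open>\<eta> * (D + P')\<close>, and by monotonicity of \<open>ln\<close> it may be lowered to
  that value, which is at most 1 and can be expanded. The positive parts are small and are expanded
  separately.\<close>

lemma sum_ln_growth:
  fixes c :: "'a \<Rightarrow> real"
  assumes fin: "finite S" and \<eta>: "0 < \<eta>" and D: "0 \<le> D" and sum: "sum c S \<le> - D"
    and P: "(\<Sum>p\<in>S. max (c p) 0) \<le> P" and P1: "\<eta> * P \<le> 1/2" and P2: "\<eta> * (D + P) \<le> 1"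
  shows "(\<Sum>p\<in>S. ln (1 - \<eta> * c p)) \<ge> \<eta> * D - 2 * (\<eta> * P)\<^sup>2 - (\<eta> * (D + P))\<^sup>2"
proof -
  define P' where "P' = (\<Sum>p\<in>S. max (c p) 0)"
  have P'0: "0 \<le> P'" unfolding P'_def by (intro sum_nonneg) auto
  have P'P: "\<eta> * P' \<le> \<eta> * P" using P \<eta> by (simp add: P'_def)
  have a_le: "max (c p) 0 \<le> P'" if "p \<in> S" for p
    unfolding P'_def by (rule member_le_sum) (use that fin in auto)
  have half: "\<eta> * max (c p) 0 \<le> 1/2" if "p \<in> S" for p
    using mult_left_mono[OF a_le[OF that], of \<eta>] \<eta> P'P P1 by linarith
  have split: "ln (1 - \<eta> * c p) = ln (1 - \<eta> * max (c p) 0) + ln (1 + \<eta> * max (- c p) 0)"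
    if "p \<in> S" for p by (cases "c p \<ge> 0") (auto simp: max_def)
  have "- (\<eta> * P') - 2 * (\<eta> * P')\<^sup>2 \<le> (\<Sum>p\<in>S. - (\<eta> * max (c p) 0) - 2 * \<eta>\<^sup>2 * (P' * max (c p) 0))"
    unfolding P'_def sum_subtractf sum_negf sum_distrib_left[symmetric]
    by (simp add: power_mult_distrib power2_eq_square)
  also have "\<dots> \<le> (\<Sum>p\<in>S. ln (1 - \<eta> * max (c p) 0))"
  proof (rule sum_mono)
    fix p assume p: "p \<in> S"
    have "(max (c p) 0)\<^sup>2 \<le> P' * max (c p) 0"
      unfolding power2_eq_square by (rule mult_right_mono) (use a_le[OF p] in auto)
    then have "2 * \<eta>\<^sup>2 * (max (c p) 0)\<^sup>2 \<le> 2 * \<eta>\<^sup>2 * (P' * max (c p) 0)"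
      by (intro mult_left_mono) auto
    moreover have "- (\<eta> * max (c p) 0) - 2 * (\<eta> * max (c p) 0)\<^sup>2 \<le> ln (1 - \<eta> * max (c p) 0)"
      by (rule ln_one_minus_pos_lower_bound) (use half[OF p] \<eta> in auto)
    ultimately show "- (\<eta> * max (c p) 0) - 2 * \<eta>\<^sup>2 * (P' * max (c p) 0) \<le> ln (1 - \<eta> * max (c p) 0)"
      by (simp add: power_mult_distrib)
  qed
  finally have neg: "- (\<eta> * P') - 2 * (\<eta> * P')\<^sup>2 \<le> (\<Sum>p\<in>S. ln (1 - \<eta> * max (c p) 0))" .
  have sub: "ln (1 + sum b F) \<le> (\<Sum>p\<in>F. ln (1 + b p))" if "finite F" "\<And>p. 0 \<le> b p" for b :: "'a \<Rightarrow> real" and F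
    using that(1)
  proof (induction F rule: finite_induct)
    case (insert x F)
    have s: "0 \<le> sum b F" using that(2) by (simp add: sum_nonneg)
    have "ln (1 + (b x + sum b F)) \<le> ln ((1 + b x) * (1 + sum b F))"
      using s that(2)[of x] by (subst ln_le_cancel_iff) (auto simp: algebra_simps add_pos_nonneg)
    also have "\<dots> = ln (1 + b x) + ln (1 + sum b F)"
      using s that(2)[of x] by (intro ln_mult_pos) auto
    finally show ?case using insert by simp
  qed simp
  have "D + P' \<le> (\<Sum>p\<in>S. max (- c p) 0)"
  proof -
    have "(\<Sum>p\<in>S. max (- c p) 0) = P' - sum c S"
      unfolding P'_def sum_subtractf[symmetric] by (rule sum.cong) (auto simp: max_def)
    then show ?thesis using sum by simp
  qed
  then have "\<eta> * (D + P') \<le> \<eta> * (\<Sum>p\<in>S. max (- c p) 0)" using \<eta> by simp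
  moreover have "0 \<le> \<eta> * (D + P')" using \<eta> D P'0 by simp
  ultimately have "ln (1 + \<eta> * (D + P')) \<le> ln (1 + \<eta> * (\<Sum>p\<in>S. max (- c p) 0))" by simp
  also have "\<dots> \<le> (\<Sum>p\<in>S. ln (1 + \<eta> * max (- c p) 0))"
    using sub[OF fin, of "\<lambda>p. \<eta> * max (- c p) 0"] \<eta> by (simp add: sum_distrib_left)
  finally have "ln (1 + \<eta> * (D + P')) \<le> (\<Sum>p\<in>S. ln (1 + \<eta> * max (- c p) 0))" .
  moreover have DP: "\<eta> * (D + P') \<le> \<eta> * (D + P)" using P'P by (simp add: distrib_left)
  have "\<eta> * (D + P') - (\<eta> * (D + P'))\<^sup>2 \<le> ln (1 + \<eta> * (D + P'))"
    by (rule ln_one_plus_pos_lower_bound) (use \<eta> D P'0 in simp, use DP P2 in linarith)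
  moreover have "(\<Sum>p\<in>S. ln (1 - \<eta> * c p))
      = (\<Sum>p\<in>S. ln (1 - \<eta> * max (c p) 0)) + (\<Sum>p\<in>S. ln (1 + \<eta> * max (- c p) 0))"
    using split by (simp add: sum.distrib)
  moreover have "(\<eta> * P')\<^sup>2 \<le> (\<eta> * P)\<^sup>2" using P'P P'0 \<eta> by (intro power_mono) auto
  moreover have "(\<eta> * (D + P'))\<^sup>2 \<le> (\<eta> * (D + P))\<^sup>2" using DP P'0 D \<eta> by (intro power_mono) auto
  ultimately show ?thesis using neg by (simp add: distrib_left)
qed

locale sparse_submodular =
  fixes n kn :: nat and f :: "nat set \<Rightarrow> real" and S :: "nat set"
  assumes submod: "submodular_on {..<n} f" and S_sub: "S \<subseteq> {..<n}" and S_card: "card S \<le> kn"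
    and low: "\<And>X. f S \<le> ev n f X" and n_pos: "1 \<le> n" and kn_pos: "1 \<le> kn"
begin

abbreviation "F \<equiv> ev n f"

lemma finite_S: "finite S"
  using S_sub finite_subset by blast

lemma n_notin_S: "n \<notin> S" "Suc n \<notin> S"
proof -
  show "n \<notin> S" using S_sub by blast
  show "Suc n \<notin> S"
  proof
    assume "Suc n \<in> S"
    then have "Suc n < n" using S_sub by blast
    then show False by simp
  qed
qed

lemma S_live:
  assumes "arc_rel n S R" "a \<in> insert n S"
  shows "live n kn R a"
proof -
  have "{b. b \<le> n \<and> R a b} \<subseteq> insert n S" using assms unfolding arc_rel_def by blast
  then have "row_size n R a \<le> card (insert n S)"
    unfolding row_size_def using finite_S by (intro card_mono) auto
  also have "\<dots> \<le> kn + 1" using S_card finite_S n_notin_S by simp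
  finally have "row_size n R a \<le> kn + 1" .
  moreover have "\<not> R a (n + 1)"
  proof
    assume "R a (n + 1)"
    then have "n + 1 \<in> insert n S" using assms unfolding arc_rel_def by blast
    then show False using n_notin_S by simp
  qed
  ultimately show ?thesis by (simp add: live_def)
qed

end

lemma row_size_mono:
  assumes "\<And>c. R b c \<Longrightarrow> R' a c"
  shows "row_size n R b \<le> row_size n R' a"
  unfolding row_size_def
proof (rule card_mono)
  show "{c. c \<le> n \<and> R b c} \<subseteq> {c. c \<le> n \<and> R' a c}" using assms by blast
qed simp

lemma live_mono:
  assumes "\<And>c. R b c \<Longrightarrow> R' a c" "live n kn R' a"
  shows "live n kn R b"
proof -
  have "row_size n R b \<le> row_size n R' a" by (rule row_size_mono) (rule assms(1))
  then show ?thesis using assms(1)[of "n + 1"] assms(2) by (auto simp: live_def)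
qed

text \<open>Here \<open>R\<close> is the relation fixed at the start of a phase. The bound
  \<open>2 * M\<close> adds the gap of the root row and the increment over it, each at most
  \<open>M\<close> by \<open>scale_inv\<close>.\<close>

locale arc_search = sparse_submodular +
  fixes R :: "nat \<Rightarrow> nat \<Rightarrow> bool" and M :: real
  assumes R: "arc_rel n S R" and M_pos: "0 < M"
    and bound: "\<And>a. a \<le> n \<Longrightarrow> live n kn R a \<Longrightarrow> ev n f (Collect (R a)) - f S \<le> 2 * M"
begin

lemma R_refl: "a < n + 2 \<Longrightarrow> R a a" and R_trans: "R a b \<Longrightarrow> R b c \<Longrightarrow> R a c"
  and R_root: "a < n + 2 \<Longrightarrow> R a n" and R_S: "R a b \<Longrightarrow> a \<in> insert n S \<Longrightarrow> b \<in> insert n S"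
  using R[unfolded arc_rel_def] by blast+

lemma live_R: "R a b \<Longrightarrow> live n kn R a \<Longrightarrow> live n kn R b"
  using live_mono[of R b R a] R_trans by blast

lemma leader_props:
  assumes "q < n"
  shows "R (leader n R x q) q" "x q \<le> x (leader n R x q)" "leader n R x q < n"
    "p < n \<Longrightarrow> R p q \<Longrightarrow> x p \<le> x (leader n R x q)"
  unfolding leader_def
  using leader_upto_rel[of R q x n] R_refl[of q] leader_upto_ge[of x q R n] leader_upto_less[of q n n R x]
    leader_upto_max[of p n R q x] assms by auto

lemma leader_mono: "R d e \<Longrightarrow> d < n \<Longrightarrow> e < n \<Longrightarrow> x (leader n R x d) \<le> x (leader n R x e)"
  using leader_props(1,3)[of d x] leader_props(4)[of e "leader n R x d" x] R_trans by blast

sublocale order: strict_order_on "{..<n}" "prec n R x" for x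
proof
  fix a b c :: nat
  show "finite {..<n}" by simp
  show "\<not> prec n R x a a" by (simp add: prec_def)
  show "prec n R x a b \<Longrightarrow> prec n R x b c \<Longrightarrow> prec n R x a c" unfolding prec_def by linarith
  show "prec n R x a b \<or> prec n R x b a" if "a \<in> {..<n}" "b \<in> {..<n}" "a \<noteq> b"
  proof -
    have "row_size n R a * n + a \<noteq> row_size n R b * n + b"
    proof
      assume "row_size n R a * n + a = row_size n R b * n + b"
      then have "(row_size n R a * n + a) mod n = (row_size n R b * n + b) mod n" by simp
      then show False using that by simp
    qed
    then show ?thesis unfolding prec_def by linarith
  qed
qed

lemma marg_greedy: "marg n f R A x = order.greedy x F A (\<lambda>e. Collect (R e))"
  by (rule ext) (simp add: marg_def order.greedy_def order.before_union_def prefix_set_def)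

text \<open>Submodularity moves the marginal from the prefix to its intersection with the row of
  \<open>d\<close>, and the value there is at least \<open>f S\<close>.\<close>

lemma marg_le:
  assumes "d < n" "live n kn R d"
  shows "marg n f R A x d \<le> 2 * M"
proof -
  let ?Q = "prefix_set n R A x d"
  have "F (?Q \<union> Collect (R d)) + F (?Q \<inter> Collect (R d)) \<le> F ?Q + F (Collect (R d))"
    by (rule ev_Un_le[OF submod])
  then show ?thesis using low[of "?Q \<inter> Collect (R d)"] bound[of d] assms unfolding marg_def by simp
qed

lemma marg_lower:
  assumes "\<And>p. p < n \<Longrightarrow> 0 \<le> x p \<and> x p \<le> 1"
  shows "(\<Sum>d<n. x (leader n R x d) * marg n f R A x d) \<ge> f S - F A"
  unfolding marg_greedy
  by (rule order.greedy_Lovasz_lower) (use low assms leader_props(3) in \<open>auto simp: prec_def\<close>)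

lemma marg_S:
  assumes A: "A \<subseteq> insert n S" "n \<in> A"
  shows "(\<Sum>d\<in>S. marg n f R A x d) \<le> f S - F A"
proof -
  let ?A = A and ?T = "insert n S"
  have "(\<Sum>d\<in>{..<n} \<inter> ?T. order.greedy x F ?A (\<lambda>e. Collect (R e)) d)
      \<le> F ((?A \<union> (\<Union>e\<in>{..<n}. Collect (R e))) \<inter> ?T) - F ?A"
  proof (rule order.greedy_closed_le)
    show "\<And>X Y Z. X \<subseteq> Y \<Longrightarrow> Z \<inter> Y \<subseteq> X \<Longrightarrow> F (Y \<union> Z) - F Y \<le> F (X \<union> Z) - F X"
      by (rule ev_marginal[OF submod])
    show "?A \<subseteq> ?T" by (fact A(1))
    show "Collect (R d) \<subseteq> ?T" if "d \<in> ?T" for d using that R_S by blast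
    fix d e assume d: "d \<in> {..<n}" "d \<notin> ?T" and e: "e \<in> Collect (R d)" "e \<in> ?T"
    show "e \<in> order.before_union x ?A (\<lambda>e. Collect (R e)) d"
    proof (cases "e = n")
      case True
      then show ?thesis using A(2) by (simp add: order.before_union_def)
    next
      case False
      then have en: "e \<in> S" "e < n" using e S_sub by auto
      have de: "R d e" using e by simp
      \<comment> \<open>An arc from \<open>d\<close> to \<open>e\<close> that cannot be reversed
        makes the row of \<open>e\<close> strictly smaller, and the leader of \<open>e\<close> is at
        least as heavy. So the tie-breaking puts \<open>e\<close> before \<open>d\<close>, and
        \<open>e\<close> is already in the prefix of \<open>d\<close>.\<close>
      have "\<not> R e d" using R_S d en by blast
      then have "{b. b \<le> n \<and> R e b} \<subset> {b. b \<le> n \<and> R d b}"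
        using R_trans[OF de] R_refl[of d] d by auto
      then have "row_size n R e < row_size n R d"
        unfolding row_size_def by (intro psubset_card_mono) auto
      \<comment> \<open>Indices are below \<open>n\<close>, so a difference of one in the row size
        outweighs any difference of indices.\<close>
      then have "row_size n R e * n + n \<le> row_size n R d * n"
        by (metis Suc_leI add.commute mult_Suc mult_le_mono1)
      then have "row_size n R e * n + e < row_size n R d * n + d" using en by linarith
      moreover have "x (leader n R x d) \<le> x (leader n R x e)" using leader_mono[OF de] d en by simp
      ultimately have "prec n R x e d" by (auto simp: prec_def)
      then show ?thesis using en R_refl[of e] by (auto simp: order.before_union_def)
    qed
  qed
  moreover have "{..<n} \<inter> ?T = S" using S_sub by auto
  moreover have "F ((?A \<union> (\<Union>e\<in>{..<n}. Collect (R e))) \<inter> ?T) = f S"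
  proof -
    have "(?A \<union> (\<Union>e\<in>{..<n}. Collect (R e))) \<inter> ?T \<inter> {..<n} = S"
    proof (intro equalityI subsetI)
      show "b \<in> S" if "b \<in> (?A \<union> (\<Union>e\<in>{..<n}. Collect (R e))) \<inter> ?T \<inter> {..<n}" for b
        using that by auto
      show "b \<in> (?A \<union> (\<Union>e\<in>{..<n}. Collect (R e))) \<inter> ?T \<inter> {..<n}" if "b \<in> S" for b
      proof -
        have "b \<in> {..<n}" "b \<in> Collect (R b)" using that S_sub R_refl[of b] by auto
        then show ?thesis using that by blast
      qed
    qed
    then show ?thesis by (simp add: ev_def)
  qed
  ultimately show ?thesis by (simp add: marg_greedy)
qed

text \<open>Exchange of summation: every \<open>q\<close> has exactly one leader.\<close>

lemma sum_charge:
  fixes g y :: "nat \<Rightarrow> real" and P :: "nat set"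
  assumes "finite P"
  shows "(\<Sum>p\<in>P. y p * (\<Sum>q<n. if leader n R x q = p \<and> 0 < g q then g q else 0))
     = (\<Sum>q<n. if leader n R x q \<in> P \<and> 0 < g q then y (leader n R x q) * g q else 0)"
proof -
  have "(\<Sum>p\<in>P. y p * (\<Sum>q<n. if leader n R x q = p \<and> 0 < g q then g q else 0))
     = (\<Sum>q<n. \<Sum>p\<in>P. if leader n R x q = p then (if 0 < g q then y p * g q else 0) else 0)"
    unfolding sum_distrib_left by (subst sum.swap) (intro sum.cong refl, auto)
  also have "\<dots> = (\<Sum>q<n. if leader n R x q \<in> P \<and> 0 < g q then y (leader n R x q) * g q else 0)"
    using assms by (intro sum.cong refl) (auto simp: sum.delta')
  finally show ?thesis .
qed

abbreviation "loss A x \<equiv> charge n R x (marg n f R A x)"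

lemma charge_lower:
  assumes x: "\<And>p. p < n \<Longrightarrow> 0 \<le> x p \<and> x p \<le> 1"
  shows "(\<Sum>p<n. x p * loss A x p) \<ge> f S - F A"
proof -
  let ?g = "marg n f R A x"
  have "f S - F A \<le> (\<Sum>d<n. x (leader n R x d) * ?g d)" by (rule marg_lower[OF x])
  \<comment> \<open>Lowering the weight of a nonpositive marginal from that of the leader to
    \<open>x d\<close> can only raise the term; a positive marginal keeps the weight of its
    leader.\<close>
  also have "\<dots> \<le> (\<Sum>d<n. x d * min (?g d) 0 + (if 0 < ?g d then x (leader n R x d) * ?g d else 0))"
  proof (rule sum_mono)
    fix d assume "d \<in> {..<n}"
    then have "x d \<le> x (leader n R x d)" using leader_props by simp
    then show "x (leader n R x d) * ?g d \<le> x d * min (?g d) 0 + (if 0 < ?g d then x (leader n R x d) * ?g d else 0)"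
      by (auto simp: min_def intro: mult_right_mono_neg)
  qed
  also have "\<dots> = (\<Sum>p<n. x p * min (?g p) 0) + (\<Sum>p<n. x p * (\<Sum>q<n. if leader n R x q = p \<and> 0 < ?g q then ?g q else 0))"
    using leader_props(3) by (subst sum_charge) (auto simp: sum.distrib intro!: sum.cong)
  finally show ?thesis by (simp add: charge_def distrib_left sum.distrib)
qed

lemma sum_S_charge_pos:
  fixes g :: "nat \<Rightarrow> real"
  shows "(\<Sum>p\<in>S. \<Sum>q<n. if leader n R x q = p \<and> 0 < g q then g q else 0) \<le> (\<Sum>q\<in>S. max (g q) 0)"
proof -
  have "(\<Sum>p\<in>S. \<Sum>q<n. if leader n R x q = p \<and> 0 < g q then g q else 0)
      = (\<Sum>q<n. if leader n R x q \<in> S \<and> 0 < g q then g q else 0)"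
    using sum_charge[OF finite_S, of "\<lambda>_. 1" x g] by (simp only: mult_1)
  also have "\<dots> \<le> (\<Sum>q<n. if q \<in> S then max (g q) 0 else 0)"
  proof (rule sum_mono)
    fix q assume q: "q \<in> {..<n}"
    then have "leader n R x q \<in> S \<Longrightarrow> q \<in> S"
      using leader_props(1)[of q x] R_S[of "leader n R x q" q] by auto
    then show "(if leader n R x q \<in> S \<and> 0 < g q then g q else 0) \<le> (if q \<in> S then max (g q) 0 else 0)"
      by auto
  qed
  also have "\<dots> = (\<Sum>q\<in>S. max (g q) 0)"
    using S_sub by (simp add: sum.If_cases Int_absorb1)
  finally show ?thesis .
qed

lemma charge_S:
  assumes A: "A \<subseteq> insert n S" "n \<in> A"
  shows "(\<Sum>p\<in>S. loss A x p) \<le> f S - F A"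
proof -
  let ?g = "marg n f R A x"
  have "(\<Sum>p\<in>S. charge n R x ?g p) \<le> (\<Sum>p\<in>S. min (?g p) 0) + (\<Sum>p\<in>S. max (?g p) 0)"
    unfolding charge_def sum.distrib using sum_S_charge_pos[of x ?g] by simp
  also have "\<dots> = (\<Sum>p\<in>S. ?g p)" unfolding sum.distrib[symmetric] by (intro sum.cong) auto
  also have "\<dots> \<le> f S - F A" by (rule marg_S[OF A])
  finally show ?thesis .
qed

text \<open>Supplies the quantity \<open>P\<close> of \<open>sum_ln_growth\<close>: positive charges
  inside \<open>S\<close> come from marginals of at most \<open>kn\<close> elements of
  \<open>S\<close>, all of them live.\<close>

lemma charge_S_pos: "(\<Sum>p\<in>S. max (loss A x p) 0) \<le> 2 * real kn * M"
proof -
  let ?g = "marg n f R A x"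
  have "(\<Sum>p\<in>S. max (charge n R x ?g p) 0)
      \<le> (\<Sum>p\<in>S. \<Sum>q<n. if leader n R x q = p \<and> 0 < ?g q then ?g q else 0)"
    by (intro sum_mono) (auto simp: charge_def intro!: sum_nonneg)
  also have "\<dots> \<le> (\<Sum>q\<in>S. max (?g q) 0)" by (rule sum_S_charge_pos)
  also have "\<dots> \<le> (\<Sum>q\<in>S. 2 * M)"
  proof (rule sum_mono)
    fix q assume "q \<in> S"
    then show "max (?g q) 0 \<le> 2 * M" using marg_le[of q A x] S_live[OF R, of q] S_sub M_pos by auto
  qed
  also have "\<dots> = real (card S) * (2 * M)" by simp
  also have "\<dots> \<le> real kn * (2 * M)" using S_card M_pos by (intro mult_right_mono) auto
  finally show ?thesis by simp
qed

text \<open>An element is charged only for members of its own row, and a live row has at most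
  \<open>kn\<close> of them besides the root. This keeps the update factor above 1/2, so that the
  weights of live elements stay positive and have logarithms.\<close>

lemma charge_le:
  assumes p: "p < n" "live n kn R p"
  shows "loss A x p \<le> 2 * real kn * M"
proof -
  let ?g = "marg n f R A x"
  have "(\<Sum>q<n. if leader n R x q = p \<and> 0 < ?g q then ?g q else 0)
      \<le> (\<Sum>q<n. if R p q then 2 * M else 0)"
  proof (rule sum_mono)
    fix q assume "q \<in> {..<n}"
    then have "R (leader n R x q) q" "q < n" using leader_props by auto
    then show "(if leader n R x q = p \<and> 0 < ?g q then ?g q else 0) \<le> (if R p q then 2 * M else 0)"
      using marg_le[of q A x] live_R p M_pos by auto
  qed
  also have "\<dots> = real (card {q. q < n \<and> R p q}) * (2 * M)"
    by (simp add: sum.If_cases lessThan_def Collect_conj_eq)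
  also have "\<dots> \<le> real kn * (2 * M)"
  proof (rule mult_right_mono)
    have "{b. b \<le> n \<and> R p b} = insert n {q. q < n \<and> R p q}"
      using R_root[of p] p by auto
    then have "row_size n R p = Suc (card {q. q < n \<and> R p q})" by (simp add: row_size_def)
    then show "real (card {q. q < n \<and> R p q}) \<le> real kn" using p by (simp add: live_def)
  qed (use M_pos in auto)
  finally show ?thesis unfolding charge_def by (simp add: min_def)
qed

text \<open>Since \<open>A\<close> is closed, every row reached from \<open>p\<close> lies inside
  each prefix and has marginal 0. Weights inside \<open>A\<close> therefore never move, and an
  element with overflow always lies outside \<open>A\<close>, so the arc to it is new.\<close>

lemma charge_base:
  assumes A: "\<And>b c. b \<in> A \<Longrightarrow> R b c \<Longrightarrow> c \<in> A" and p: "p \<in> A" "p < n"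
  shows "loss A x p = 0"
proof -
  let ?g = "marg n f R A x"
  have zero: "?g q = 0" if "R p q" for q
  proof -
    have "Collect (R q) \<subseteq> prefix_set n R A x q"
      using A[OF A[OF p(1) that]] by (auto simp: prefix_set_def)
    then show ?thesis by (simp add: marg_def Un_absorb2)
  qed
  have "(if leader n R x q = p \<and> 0 < ?g q then ?g q else 0) = 0" if "q < n" for q
    using leader_props(1)[OF that, of x] zero[of q] by auto
  then have "(\<Sum>q<n. if leader n R x q = p \<and> 0 < ?g q then ?g q else 0) = 0" by simp
  then show ?thesis using zero[of p] R_refl[of p] p unfolding charge_def by simp
qed

end

section \<open>Multiplicative weights\<close>

text \<open>The second-order error of one step is at most \<open>50 * (\<eta> * kn * M)^2\<close>.
  The cube of \<open>kn\<close> is chosen so that over \<open>mw_rounds\<close> steps this adds up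
  to \<open>2 * kn * el\<close>, the same order as the initial deficit \<open>kn * ln n\<close> of
  the logarithms. The parameter \<open>el\<close> below is an integer upper bound for
  \<open>ln n\<close>.\<close>

definition mw_rate :: "nat \<Rightarrow> real \<Rightarrow> real" where
  "mw_rate kn M = 1 / (400 * real kn ^ 3 * M)"

text \<open>The product of rounds and rate is \<open>16 * kn^2 * el / M\<close>. A gap above
  \<open>M / 2\<close> then produces more than \<open>8 * kn^2 * el\<close> of growth, which neither
  the error terms nor \<open>kn\<close> elements at the threshold \<open>mw_thr\<close> can
  absorb.\<close>

definition mw_rounds :: "nat \<Rightarrow> nat \<Rightarrow> nat" where
  "mw_rounds kn el = 6400 * kn ^ 5 * el"

text \<open>With growth \<open>G\<close>, the total mass is at most \<open>1 + G\<close> and the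
  cut-off mass in \<open>S\<close> is at least \<open>G - 3 * kn * el\<close>. The difference is all
  that an element outside \<open>S\<close> can have accumulated.\<close>

definition mw_thr :: "nat \<Rightarrow> nat \<Rightarrow> nat" where
  "mw_thr kn el = 1 + 3 * kn * el"

definition mw_run ::
  "nat \<Rightarrow> nat \<Rightarrow> (nat set \<Rightarrow> real) \<Rightarrow> (nat \<Rightarrow> nat \<Rightarrow> bool) \<Rightarrow> real \<Rightarrow> nat set \<Rightarrow> nat \<Rightarrow>
    (nat \<Rightarrow> real) \<times> (nat \<Rightarrow> real)" where
  "mw_run n kn f R M A t =
     (mw_step n f R (mw_rate kn M) A ^^ t) (mw_init n kn R)"

locale base_search = arc_search +
  fixes A :: "nat set"
  assumes A_closed: "\<And>b c. b \<in> A \<Longrightarrow> R b c \<Longrightarrow> c \<in> A" and n_in_A: "n \<in> A"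
    and base_bound: "ev n f A - f S \<le> 4 * real kn * M"
begin

text \<open>The first sum measures mass over all elements, the second measures logarithms of weights
  and recorded mass over \<open>S\<close> only; the overflow is located by comparing the two. The
  term \<open>kn * ln n\<close> accounts for the initial weights \<open>1 / n\<close>.\<close>

definition mw_inv :: "nat \<Rightarrow> (nat \<Rightarrow> real) \<Rightarrow> (nat \<Rightarrow> real) \<Rightarrow> bool" where
  "mw_inv t x ov \<longleftrightarrow>
     (\<forall>p<n. 0 \<le> x p \<and> x p \<le> 1 \<and> (0 < x p \<longleftrightarrow> live n kn R p) \<and> 0 \<le> ov p \<and> (p \<in> A \<longrightarrow> ov p = 0)) \<and>
     (\<Sum>p<n. x p + ov p) \<le> 1 + real t * (mw_rate kn M * (ev n f A - f S)) \<and>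
     (A \<subseteq> insert n S \<longrightarrow> (\<Sum>p\<in>S. ln (x p) + ov p) \<ge>
        real t * (mw_rate kn M * (ev n f A - f S) - 50 * (mw_rate kn M * (real kn * M))\<^sup>2)
        - real kn * ln (real n))"

lemma rate_pos: "0 < mw_rate kn M"
  using M_pos kn_pos by (simp add: mw_rate_def)

lemma rate_knM: "mw_rate kn M * (real kn * M) \<le> 1 / 400"
proof -
  have "mw_rate kn M * (real kn * M) = 1 / (400 * (real kn)\<^sup>2)"
    using M_pos kn_pos by (simp add: mw_rate_def power2_eq_square power3_eq_cube field_simps)
  also have "\<dots> \<le> 1 / 400" using kn_pos by (simp add: divide_simps)
  finally show ?thesis .
qed

lemma mw_inv_init: "mw_inv 0 (fst (mw_init n kn R)) (snd (mw_init n kn R))"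
proof -
  let ?x = "\<lambda>p. if p < n \<and> live n kn R p then 1 / real n else 0"
  have "(\<Sum>p<n. ?x p) \<le> (\<Sum>p<n. 1 / real n)" by (rule sum_mono) auto
  also have "\<dots> = 1" using n_pos by simp
  finally have s: "(\<Sum>p<n. ?x p) \<le> 1" .
  have "(\<Sum>p\<in>S. ln (?x p)) = (\<Sum>p\<in>S. - ln (real n))"
  proof (rule sum.cong[OF refl])
    fix p assume "p \<in> S"
    then have "p < n" "live n kn R p" using S_sub S_live[OF R, of p] by auto
    then show "ln (?x p) = - ln (real n)" using n_pos by (simp add: ln_div)
  qed
  also have "\<dots> = - (real (card S) * ln (real n))" by simp
  also have "\<dots> \<ge> - (real kn * ln (real n))"
    using S_card n_pos by (simp add: mult_right_mono)
  finally have l: "(\<Sum>p\<in>S. ln (?x p)) \<ge> - (real kn * ln (real n))" .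
  show ?thesis using s l n_pos unfolding mw_inv_def mw_init_def by simp
qed

lemma mw_inv_step:
  assumes inv: "mw_inv t (fst z) (snd z)"
  defines "z' \<equiv> mw_step n f R (mw_rate kn M) A z"
  shows "mw_inv (Suc t) (fst z') (snd z')"
proof -
  define \<eta> x ov where defs: "\<eta> = mw_rate kn M" "x = fst z" "ov = snd z"
  define c where "c = loss A x"
  define v where "v = (\<lambda>p. x p * (1 - \<eta> * c p))"
  define D where "D = F A - f S"
  have x': "fst z' p = min 1 (v p)" and ov': "snd z' p = ov p + max 0 (v p - 1)" if "p < n" for p
    using that unfolding z'_def mw_step_def v_def c_def defs by (simp_all add: Let_def)
  have I: "\<And>p. p < n \<Longrightarrow> 0 \<le> x p \<and> x p \<le> 1 \<and> (0 < x p \<longleftrightarrow> live n kn R p) \<and> 0 \<le> ov p \<and> (p \<in> A \<longrightarrow> ov p = 0)"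
    and I2: "(\<Sum>p<n. x p + ov p) \<le> 1 + real t * (\<eta> * D)"
    and I3: "A \<subseteq> insert n S \<Longrightarrow> (\<Sum>p\<in>S. ln (x p) + ov p) \<ge>
        real t * (\<eta> * D - 50 * (\<eta> * (real kn * M))\<^sup>2) - real kn * ln (real n)"
    using inv unfolding mw_inv_def defs D_def by auto
  have \<eta>: "0 < \<eta>" and \<eta>1: "\<eta> * (real kn * M) \<le> 1 / 400" using rate_pos rate_knM by (auto simp: defs)
  have D0: "0 \<le> D" using low by (simp add: D_def)
  have D1: "D \<le> 4 * real kn * M" using base_bound by (simp add: D_def defs)
  have half: "1 / 2 \<le> 1 - \<eta> * c p" if "p < n" "live n kn R p" for p
  proof -
    have "\<eta> * c p \<le> \<eta> * (2 * real kn * M)"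
      using charge_le[OF that] \<eta> unfolding c_def by (intro mult_left_mono) auto
    then show ?thesis using \<eta>1 by (simp add: mult_ac)
  qed
  have v: "0 \<le> v p \<and> (0 < v p \<longleftrightarrow> live n kn R p)" if "p < n" for p
  proof (cases "live n kn R p")
    case True
    then have "0 < x p" "0 < 1 - \<eta> * c p" using I[OF that] half[OF that True] by auto
    then show ?thesis using True unfolding v_def by simp
  next
    case False
    then have "x p = 0" using I[OF that] by force
    then show ?thesis using False unfolding v_def by simp
  qed
  have base: "v p = x p" if "p \<in> A" "p < n" for p
    using charge_base[of A p x] A_closed that by (simp add: v_def c_def defs)
  have 1: "0 \<le> fst z' p \<and> fst z' p \<le> 1 \<and> (0 < fst z' p \<longleftrightarrow> live n kn R p) \<and> 0 \<le> snd z' p \<and> (p \<in> A \<longrightarrow> snd z' p = 0)"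
    if "p < n" for p
    using v[OF that] I[OF that] base[OF _ that] by (auto simp: x'[OF that] ov'[OF that])
  have "(\<Sum>p<n. fst z' p + snd z' p) = (\<Sum>p<n. v p + ov p)"
    by (rule sum.cong) (auto simp: x' ov')
  also have "\<dots> = (\<Sum>p<n. x p + ov p) - \<eta> * (\<Sum>p<n. x p * c p)"
    unfolding sum_distrib_left sum_subtractf[symmetric]
    by (rule sum.cong) (auto simp: v_def algebra_simps)
  also have "\<dots> \<le> (\<Sum>p<n. x p + ov p) + \<eta> * D"
  proof -
    have "- D \<le> (\<Sum>p<n. x p * c p)" using charge_lower[of x A] I unfolding D_def c_def by auto
    then have "\<eta> * - D \<le> \<eta> * (\<Sum>p<n. x p * c p)" using \<eta> by (intro mult_left_mono) auto
    then show ?thesis by simp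
  qed
  finally have 2: "(\<Sum>p<n. fst z' p + snd z' p) \<le> 1 + real (Suc t) * (\<eta> * D)"
    using I2 by (simp add: distrib_right)
  have 3: "(\<Sum>p\<in>S. ln (fst z' p) + snd z' p) \<ge>
        real (Suc t) * (\<eta> * D - 50 * (\<eta> * (real kn * M))\<^sup>2) - real kn * ln (real n)"
    if rS: "A \<subseteq> insert n S"
  proof -
    have e1: "2 * real kn * M = 2 * (real kn * M)" by simp
    have g: "(\<Sum>p\<in>S. ln (1 - \<eta> * c p)) \<ge> \<eta> * D - 2 * (\<eta> * (2 * real kn * M))\<^sup>2 - (\<eta> * (D + 2 * real kn * M))\<^sup>2"
    proof (rule sum_ln_growth[OF finite_S \<eta> D0])
      show "sum c S \<le> - D" using charge_S[OF rS n_in_A, of x] by (simp add: c_def D_def defs)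
      show "(\<Sum>p\<in>S. max (c p) 0) \<le> 2 * real kn * M" unfolding c_def by (rule charge_S_pos)
      show "\<eta> * (2 * real kn * M) \<le> 1 / 2" using \<eta>1 by (simp add: mult_ac)
      have "\<eta> * (D + 2 * real kn * M) \<le> \<eta> * (6 * real kn * M)" by (rule mult_left_mono) (use D1 \<eta> in linarith)+
      then show "\<eta> * (D + 2 * real kn * M) \<le> 1" using \<eta>1 by (simp add: mult_ac)
    qed
    have "(\<eta> * (D + 2 * real kn * M))\<^sup>2 \<le> (6 * (\<eta> * (real kn * M)))\<^sup>2"
    proof (rule power_mono)
      have "\<eta> * (D + 2 * real kn * M) \<le> \<eta> * (6 * real kn * M)" by (rule mult_left_mono) (use D1 \<eta> in linarith)+
      then show "\<eta> * (D + 2 * real kn * M) \<le> 6 * (\<eta> * (real kn * M))" by (simp add: mult_ac)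
    qed (use \<eta> D0 M_pos in simp)
    moreover have "2 * (\<eta> * (2 * real kn * M))\<^sup>2 = 8 * (\<eta> * (real kn * M))\<^sup>2"
      by (simp add: power2_eq_square)
    moreover have "(6 * (\<eta> * (real kn * M)))\<^sup>2 = 36 * (\<eta> * (real kn * M))\<^sup>2"
      by (simp add: power2_eq_square)
    \<comment> \<open>The positive parts contribute \<open>2 * 2^2 = 8\<close>, and
      \<open>D + 2 * kn * M \<le> 6 * kn * M\<close> contributes \<open>6^2 = 36\<close>; the sum 44
      is rounded up to 50.\<close>
    ultimately have g2: "(\<Sum>p\<in>S. ln (1 - \<eta> * c p)) \<ge> \<eta> * D - 50 * (\<eta> * (real kn * M))\<^sup>2"
      using g zero_le_power2[of "\<eta> * (real kn * M)"] by linarith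
    have "(\<Sum>p\<in>S. ln (fst z' p) + snd z' p) \<ge> (\<Sum>p\<in>S. (ln (x p) + ov p) + ln (1 - \<eta> * c p))"
    proof (rule sum_mono)
      fix p assume "p \<in> S"
      then have p: "p < n" "live n kn R p" using S_sub S_live[OF R, of p] by auto
      have pos: "0 < x p" "0 < 1 - \<eta> * c p" using I[OF p(1)] half[OF p] p by auto
      then have "ln (v p) = ln (x p) + ln (1 - \<eta> * c p)" unfolding v_def by (rule ln_mult_pos)
      \<comment> \<open>The exchange at the cap: \<open>ln v \<le> v - 1\<close> turns the logarithm
        lost by capping into recorded mass.\<close>
      moreover have "ln (v p) \<le> ln (min 1 (v p)) + max 0 (v p - 1)"
        using ln_le_minus_one[of "v p"] v[OF p(1)] p by (auto simp: min_def max_def)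
      ultimately show "(ln (x p) + ov p) + ln (1 - \<eta> * c p) \<le> ln (fst z' p) + snd z' p"
        by (simp add: x'[OF p(1)] ov'[OF p(1)])
    qed
    then show ?thesis using I3[OF rS] g2 by (simp only: sum.distrib of_nat_Suc distrib_right) simp
  qed
  show ?thesis using 1 2 3 unfolding mw_inv_def by (simp add: defs D_def)
qed

lemma mw_inv_run:
  shows "mw_inv t (fst (mw_run n kn f R M A t)) (snd (mw_run n kn f R M A t))"
  by (induction t) (simp_all add: mw_run_def mw_inv_init mw_inv_step)

context
  fixes el :: nat and ov :: "nat \<Rightarrow> real"
  assumes el: "1 \<le> el" "ln (real n) \<le> real el"
  defines "ov \<equiv> snd (mw_run n kn f R M A (mw_rounds kn el))"
begin

lemma overflow_bounds:
  shows "p < n \<Longrightarrow> 0 \<le> ov p" "p < n \<Longrightarrow> p \<in> A \<Longrightarrow> ov p = 0"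
    and "(\<Sum>p<n. ov p) \<le> 1 + 16 * (real kn)\<^sup>2 * real el / M * (F A - f S)"
    and "A \<subseteq> insert n S \<Longrightarrow> (\<Sum>p\<in>S. ov p) \<ge>
      16 * (real kn)\<^sup>2 * real el / M * (F A - f S) - 3 * real kn * real el"
proof -
  define T where "T = mw_rounds kn el"
  define x where "x = fst (mw_run n kn f R M A T)"
  have inv: "mw_inv T x ov" unfolding x_def ov_def T_def by (rule mw_inv_run)
  define a where "a = real kn"
  have a: "a \<noteq> 0" "M \<noteq> 0" using kn_pos M_pos by (auto simp: a_def)
  have T: "real T = 6400 * (a * a * (a * a * a)) * real el"
  proof -
    have "a ^ 5 = a ^ (2 + 3)" by simp
    also have "\<dots> = a * a * (a * a * a)" unfolding power_add power2_eq_square power3_eq_cube ..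
    finally show ?thesis by (simp add: T_def mw_rounds_def a_def)
  qed
  have rate: "mw_rate kn M = 1 / (400 * (a * a * a) * M)"
    by (simp add: mw_rate_def a_def power3_eq_cube)
  have T\<eta>: "real T * mw_rate kn M = 16 * (real kn)\<^sup>2 * real el / M"
    unfolding T rate a_def[symmetric] power2_eq_square using a by (simp add: divide_simps)
  have TE: "real T * (50 * (mw_rate kn M * (real kn * M))\<^sup>2) = 2 * real kn * real el"
    unfolding T rate a_def[symmetric] power2_eq_square using a by (simp add: divide_simps)
  let ?D = "F A - f S"
  have I: "0 \<le> x p" "x p \<le> 1" "0 < x p \<longleftrightarrow> live n kn R p" "0 \<le> ov p" "p \<in> A \<Longrightarrow> ov p = 0" if "p < n" for p
    using inv that unfolding mw_inv_def by auto
  show "p < n \<Longrightarrow> 0 \<le> ov p" "p < n \<Longrightarrow> p \<in> A \<Longrightarrow> ov p = 0" by (fact I)+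
  have "(\<Sum>p<n. ov p) \<le> (\<Sum>p<n. x p + ov p)" using I by (intro sum_mono) auto
  also have "\<dots> \<le> 1 + real T * mw_rate kn M * ?D" using inv unfolding mw_inv_def by (simp add: mult.assoc)
  finally show "(\<Sum>p<n. ov p) \<le> 1 + 16 * (real kn)\<^sup>2 * real el / M * ?D" unfolding T\<eta> .
  assume rS: "A \<subseteq> insert n S"
  have "real T * mw_rate kn M * ?D - real T * (50 * (mw_rate kn M * (real kn * M))\<^sup>2) - real kn * ln (real n)
      \<le> (\<Sum>p\<in>S. ln (x p) + ov p)"
    using inv rS by (auto simp: mw_inv_def right_diff_distrib mult.assoc)
  also have "\<dots> \<le> (\<Sum>p\<in>S. ov p)"
  proof (rule sum_mono)
    fix p assume "p \<in> S"
    then have "p < n" "live n kn R p" using S_sub S_live[OF R, of p] by auto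
    then have "ln (x p) \<le> 0" using I[of p] by simp
    then show "ln (x p) + ov p \<le> ov p" by simp
  qed
  finally have "16 * (real kn)\<^sup>2 * real el / M * ?D - 2 * real kn * real el - real kn * ln (real n) \<le> (\<Sum>p\<in>S. ov p)"
    unfolding T\<eta> TE .
  moreover have "real kn * ln (real n) \<le> real kn * real el" using el by (intro mult_left_mono) auto
  ultimately show "(\<Sum>p\<in>S. ov p) \<ge> 16 * (real kn)\<^sup>2 * real el / M * ?D - 3 * real kn * real el" by linarith
qed

lemma overflow_in_S:
  assumes "A \<subseteq> insert n S" "q < n" "real (mw_thr kn el) < ov q"
  shows "q \<in> S"
proof (rule ccontr)
  assume q: "q \<notin> S"
  have "ov q + (\<Sum>p\<in>S. ov p) = (\<Sum>p\<in>insert q S. ov p)" using q finite_S by simp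
  also have "\<dots> \<le> (\<Sum>p<n. ov p)"
    using S_sub assms(2) overflow_bounds(1) by (intro sum_mono2) auto
  finally show False using overflow_bounds(3) overflow_bounds(4)[OF assms(1)] assms(3) by (simp add: mw_thr_def)
qed

lemma no_overflow_gap:
  assumes "A \<subseteq> insert n S" "\<And>q. q < n \<Longrightarrow> ov q \<le> real (mw_thr kn el)"
  shows "F A - f S \<le> M / 2"
proof -
  let ?D = "F A - f S"
  have "(\<Sum>p\<in>S. ov p) \<le> (\<Sum>p\<in>S. real (mw_thr kn el))" using assms(2) S_sub by (intro sum_mono) auto
  also have "\<dots> \<le> real kn * real (mw_thr kn el)" using S_card by (simp add: mult_right_mono)
  finally have "16 * (real kn)\<^sup>2 * real el / M * ?D \<le> 3 * real kn * real el + real kn * (1 + 3 * real kn * real el)"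
    using overflow_bounds(4)[OF assms(1)] by (simp add: mw_thr_def)
  \<comment> \<open>Since \<open>kn\<close> and \<open>el\<close> are at least 1, the terms are at
    most 3, 1 and 3 times \<open>kn^2 * el\<close>. The 8 is half of the 16 in the accumulated rate,
    which yields \<open>M / 2\<close>.\<close>
  also have "\<dots> \<le> 8 * ((real kn)\<^sup>2 * real el)"
  proof -
    have k: "1 \<le> real kn" "1 \<le> real el" using kn_pos el by auto
    have "real kn * 1 \<le> real kn * real el" using k by (intro mult_left_mono) auto
    moreover have "1 * (real kn * real el) \<le> real kn * (real kn * real el)" using k by (intro mult_right_mono) auto
    ultimately show ?thesis by (simp add: power2_eq_square algebra_simps)
  qed
  finally have "16 * ((real kn)\<^sup>2 * real el) * ?D \<le> 16 * ((real kn)\<^sup>2 * real el) * (M / 2)"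
    using M_pos by (simp add: divide_simps mult_ac)
  moreover have "0 < 16 * ((real kn)\<^sup>2 * real el)" using kn_pos el by simp
  ultimately show ?thesis by (simp only: mult_le_cancel_left_pos)
qed

lemma overflow_new: "q < n \<Longrightarrow> real (mw_thr kn el) < ov q \<Longrightarrow> q \<notin> A"
  using overflow_bounds(2)[of q] by auto

end

end

section \<open>Arc insertion\<close>

text \<open>A loop that overwrites a default value at every hit ends with the last hit;
  \<open>find_targets\<close> contains this loop.\<close>

primrec last_idx :: "(nat \<Rightarrow> bool) \<Rightarrow> nat \<Rightarrow> nat \<Rightarrow> nat" where
  "last_idx P d 0 = d"
| "last_idx P d (Suc m) = (if P m then m else last_idx P d m)"

lemma last_idx_cases:
  obtains "last_idx P d m < m" "P (last_idx P d m)" | "last_idx P d m = d" "\<And>i. i < m \<Longrightarrow> \<not> P i"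
proof -
  have "last_idx P d m < m \<and> P (last_idx P d m) \<or> last_idx P d m = d \<and> (\<forall>i<m. \<not> P i)"
    by (induction m) (auto simp: less_Suc_eq)
  then show ?thesis using that by blast
qed

abbreviation overflow ::
  "nat \<Rightarrow> nat \<Rightarrow> nat \<Rightarrow> (nat set \<Rightarrow> real) \<Rightarrow> (nat \<Rightarrow> nat \<Rightarrow> bool) \<Rightarrow> real \<Rightarrow> nat set \<Rightarrow> nat \<Rightarrow> real" where
  "overflow n kn el f R0 M A \<equiv> snd (mw_run n kn f R0 M A (mw_rounds kn el))"

text \<open>
  A row without overflow whose value is still large cannot belong to an element of \<open>S\<close>, so it is
  sent to falsity. The value \<open>r\<close> stands for no new arc.
\<close>

definition target ::
  "nat \<Rightarrow> nat \<Rightarrow> nat \<Rightarrow> (nat set \<Rightarrow> real) \<Rightarrow> (nat \<Rightarrow> nat \<Rightarrow> bool) \<Rightarrow> real \<Rightarrow> (nat \<Rightarrow> nat \<Rightarrow> bool) \<Rightarrow> nat \<Rightarrow> nat" where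
  "target n kn el f R0 M R r =
     (if live n kn R r
      then last_idx (\<lambda>d. real (mw_thr kn el) < overflow n kn el f R0 M (Collect (R r)) d)
        (if M / 2 < ev n f (Collect (R r)) - ev n f (Collect (R n)) then n + 1 else r) n
      else r)"

text \<open>For a preorder \<open>R\<close> this is the transitive closure after adding one arc, as
  a path needs the new arc at most once. If \<open>p = q\<close>, nothing changes.\<close>

definition insert_arc :: "nat \<Rightarrow> nat \<Rightarrow> (nat \<Rightarrow> nat \<Rightarrow> bool) \<Rightarrow> nat \<Rightarrow> nat \<Rightarrow> bool" where
  "insert_arc p q R = (\<lambda>a b. R a b \<or> R a p \<and> R q b)"

primrec insert_arcs :: "(nat \<Rightarrow> nat) \<Rightarrow> nat \<Rightarrow> (nat \<Rightarrow> nat \<Rightarrow> bool) \<Rightarrow> nat \<Rightarrow> nat \<Rightarrow> bool" where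
  "insert_arcs tg 0 R = R"
| "insert_arcs tg (Suc m) R = insert_arc m (tg m) (insert_arcs tg m R)"

text \<open>All targets are computed from the same \<open>R\<close>, in parallel; only the
  insertions, which need no queries, are sequential. Each arc is inserted into a preorder, so
  transitivity never has to be restored afterwards.\<close>

definition iterate ::
  "nat \<Rightarrow> nat \<Rightarrow> nat \<Rightarrow> (nat set \<Rightarrow> real) \<Rightarrow> (nat \<Rightarrow> nat \<Rightarrow> bool) \<Rightarrow> real \<Rightarrow> (nat \<Rightarrow> nat \<Rightarrow> bool) \<Rightarrow> nat \<Rightarrow> nat \<Rightarrow> bool" where
  "iterate n kn el f R0 M R = insert_arcs (target n kn el f R0 M R) (n + 1) R"

definition phase ::
  "nat \<Rightarrow> nat \<Rightarrow> nat \<Rightarrow> (nat set \<Rightarrow> real) \<Rightarrow> real \<Rightarrow> (nat \<Rightarrow> nat \<Rightarrow> bool) \<Rightarrow> nat \<Rightarrow> nat \<Rightarrow> bool" where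
  "phase n kn el f M R = (iterate n kn el f R M ^^ (kn + 1)) R"

text \<open>The program does not know \<open>f S\<close>. Increments are therefore measured against
  the root row, whose value it can query; only the gap of the root row refers to
  \<open>f S\<close>.\<close>

definition scale_inv ::
  "nat \<Rightarrow> nat \<Rightarrow> (nat set \<Rightarrow> real) \<Rightarrow> nat set \<Rightarrow> real \<Rightarrow> (nat \<Rightarrow> nat \<Rightarrow> bool) \<Rightarrow> bool" where
  "scale_inv n kn f S M R \<longleftrightarrow> ev n f (Collect (R n)) - f S \<le> M \<and>
     (\<forall>p<n. live n kn R p \<longrightarrow> ev n f (Collect (R p)) - ev n f (Collect (R n)) \<le> M)"

lemma arc_rel_insert_arc:
  assumes R: "arc_rel n S R" and pq: "p < n + 2" "q < n + 2" "p \<in> insert n S \<Longrightarrow> q \<in> insert n S"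
  shows "arc_rel n S (insert_arc p q R)"
proof -
  have 1: "R a b \<Longrightarrow> a < n + 2 \<and> b < n + 2" "a < n + 2 \<Longrightarrow> R a a" "R a b \<Longrightarrow> R b c \<Longrightarrow> R a c"
    "a < n + 2 \<Longrightarrow> R a n" "R a b \<Longrightarrow> a \<in> insert n S \<Longrightarrow> b \<in> insert n S" for a b c
    using R[unfolded arc_rel_def] by blast+
  show ?thesis
    unfolding arc_rel_def insert_arc_def
  proof (intro conjI allI impI)
    fix a b c
    assume "R a b \<or> R a p \<and> R q b" "R b c \<or> R b p \<and> R q c"
    then show "R a c \<or> R a p \<and> R q c" using 1(3) by blast
  next
    fix a b
    assume "R a b \<or> R a p \<and> R q b" "a \<in> insert n S"
    then show "b \<in> insert n S" using 1(5)[of a b] 1(5)[of a p] 1(5)[of q b] pq(3) by blast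
  next
    fix a b
    assume *: "R a b \<or> R a p \<and> R q b"
    then show "a < n + 2" using 1(1)[of a b] 1(1)[of a p] by blast
    show "b < n + 2" using * 1(1)[of a b] 1(1)[of q b] by blast
  qed (use 1 in simp_all)
qed

lemma arc_rel_insert_arcs:
  assumes R: "arc_rel n S R" and tg: "\<And>p. p < m \<Longrightarrow> tg p < n + 2 \<and> (p \<in> insert n S \<longrightarrow> tg p \<in> insert n S)"
    and m: "m \<le> n + 2"
  shows "arc_rel n S (insert_arcs tg m R)"
  using tg m
proof (induction m)
  case (Suc m)
  have "arc_rel n S (insert_arcs tg m R)"
  proof (rule Suc.IH)
    show "tg p < n + 2 \<and> (p \<in> insert n S \<longrightarrow> tg p \<in> insert n S)" if "p < m" for p
      using Suc.prems(1)[of p] that by simp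
  qed (use Suc.prems(2) in simp)
  then show ?case
    unfolding insert_arcs.simps
    by (rule arc_rel_insert_arc) (use Suc.prems(1)[of m] Suc.prems(2) in auto)
qed (use R in simp)

lemma insert_arcs_mono: "R a b \<Longrightarrow> insert_arcs tg m R a b"
  by (induction m) (auto simp: insert_arc_def)

lemma insert_arcs_mono': "m \<le> m' \<Longrightarrow> insert_arcs tg m R a b \<Longrightarrow> insert_arcs tg m' R a b"
  by (induction m' rule: dec_induct) (auto simp: insert_arc_def)

lemma insert_arcs_arc:
  assumes "\<And>a. a < n + 2 \<Longrightarrow> R a a" "p < m" "p < n + 2" "tg p < n + 2"
  shows "insert_arcs tg m R p (tg p)"
proof -
  have "insert_arcs tg (Suc p) R p (tg p)"
    using insert_arcs_mono[of R _ _ tg p] assms by (simp add: insert_arc_def)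
  then show ?thesis using insert_arcs_mono'[of "Suc p" m] assms(2) by simp
qed

text \<open>Only an arc that leaves a member of the row can enlarge the row, and a self-arc is
  harmless by transitivity. Rows only grow, so a condition on the final row covers every
  intermediate one.\<close>

lemma insert_arcs_row_unchanged:
  assumes R: "arc_rel n S R" and tg: "\<And>p. p < m \<Longrightarrow> tg p < n + 2 \<and> (p \<in> insert n S \<longrightarrow> tg p \<in> insert n S)"
    and m: "m \<le> n + 2" and fixp: "\<And>p. p < m \<Longrightarrow> insert_arcs tg m R r p \<Longrightarrow> tg p = p"
  shows "insert_arcs tg m R r = R r"
  using tg m fixp
proof (induction m)
  case (Suc m)
  let ?R = "insert_arcs tg m R"
  have IH: "?R r = R r"
  proof (rule Suc.IH)
    show "tg p = p" if "p < m" "?R r p" for p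
      using Suc.prems(3)[of p] that by (simp add: insert_arc_def)
    show tg: "tg p < n + 2 \<and> (p \<in> insert n S \<longrightarrow> tg p \<in> insert n S)" if "p < m" for p
      using Suc.prems(1)[of p] that by simp
  qed (use Suc.prems(2) in simp)
  have "arc_rel n S ?R"
  proof (rule arc_rel_insert_arcs[OF R])
    show "tg p < n + 2 \<and> (p \<in> insert n S \<longrightarrow> tg p \<in> insert n S)" if "p < m" for p
      using Suc.prems(1)[of p] that by simp
  qed (use Suc.prems(2) in simp)
  then have tr: "?R a b \<Longrightarrow> ?R b c \<Longrightarrow> ?R a c" for a b c unfolding arc_rel_def by blast
  have "insert_arc m (tg m) ?R r b = ?R r b" for b
  proof (cases "?R r m")
    case True
    then have "tg m = m" using Suc.prems(3)[of m] by (simp add: insert_arc_def)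
    then show ?thesis using tr[of r m b] by (auto simp: insert_arc_def)
  qed (simp add: insert_arc_def)
  then show ?case using IH by auto
qed simp

section \<open>Halving the scale\<close>

locale phase_start = sparse_submodular +
  fixes R0 :: "nat \<Rightarrow> nat \<Rightarrow> bool" and M :: real and el :: nat
  assumes R0: "arc_rel n S R0" and M_pos: "0 < M" and el: "1 \<le> el" "ln (real n) \<le> real el"
    and inv: "scale_inv n kn f S M R0"
begin

abbreviation "tgt \<equiv> target n kn el f R0 M"

abbreviation "step \<equiv> iterate n kn el f R0 M"

sublocale arc_search n kn f S R0 M
proof
  show "arc_rel n S R0" "0 < M" by (fact R0 M_pos)+
  show "F (Collect (R0 a)) - f S \<le> 2 * M" if "a \<le> n" "live n kn R0 a" for a
  proof (cases "a = n")
    case True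
    then show ?thesis using inv M_pos unfolding scale_inv_def by simp
  next
    case False
    then have "F (Collect (R0 a)) - F (Collect (R0 n)) \<le> M"
      using that inv unfolding scale_inv_def by simp
    then show ?thesis using inv unfolding scale_inv_def by linarith
  qed
qed

definition extends :: "(nat \<Rightarrow> nat \<Rightarrow> bool) \<Rightarrow> bool" where
  "extends R \<longleftrightarrow> arc_rel n S R \<and> (\<forall>a b. R0 a b \<longrightarrow> R a b)"

lemma extendsD:
  assumes "extends R"
  shows "a < n + 2 \<Longrightarrow> R a a" "R a b \<Longrightarrow> R b c \<Longrightarrow> R a c" "a < n + 2 \<Longrightarrow> R a n"
    "R a b \<Longrightarrow> a \<in> insert n S \<Longrightarrow> b \<in> insert n S" "R a b \<Longrightarrow> b < n + 2" "R0 a b \<Longrightarrow> R a b"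
  using assms[unfolded extends_def arc_rel_def] by blast+

text \<open>The current row of \<open>r\<close> is the union of the \<open>R0\<close>-rows of its
  members. There are at most \<open>kn + 1 \<le> 2 * kn\<close> of them, each live in
  \<open>R0\<close> as a part of the row of \<open>r\<close>, so each has excess at most
  \<open>2 * M\<close>.\<close>

lemma base_search:
  assumes R: "extends R" and r: "r \<le> n" "live n kn R r"
  shows "base_search n kn f S R0 M (Collect (R r))"
proof
  note R = extendsD[OF R]
  show "c \<in> Collect (R r)" if "b \<in> Collect (R r)" "R0 b c" for b c using that R(2,6) by blast
  show "n \<in> Collect (R r)" using R(3)[of r] r by simp
  define I where "I = {b. b \<le> n \<and> R r b}"
  have I: "finite I" "I \<noteq> {}" "card I \<le> 2 * kn"
    using r R(3)[of r] kn_pos by (auto simp: I_def live_def row_size_def)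
  have "F (Collect (R r)) = F (\<Union>b\<in>I. Collect (R0 b))"
  proof (rule ev_cong)
    show "Collect (R r) \<inter> {..<n} = (\<Union>b\<in>I. Collect (R0 b)) \<inter> {..<n}"
    proof (intro equalityI subsetI)
      show "b \<in> (\<Union>b\<in>I. Collect (R0 b)) \<inter> {..<n}" if "b \<in> Collect (R r) \<inter> {..<n}" for b
      proof -
        have "R0 b b" "b \<in> I" using that R_refl[of b] by (auto simp: I_def)
        then show ?thesis using that by blast
      qed
      show "c \<in> Collect (R r) \<inter> {..<n}" if "c \<in> (\<Union>b\<in>I. Collect (R0 b)) \<inter> {..<n}" for c
        using that R(2,6) by (auto simp: I_def)
    qed
  qed
  also have "\<dots> - f S \<le> real (card I) * (2 * M)"
  proof (rule ev_UN_le[OF submod low I(1,2)])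
    show "F (Collect (R0 i)) - f S \<le> 2 * M" if "i \<in> I" for i
    proof (rule bound)
      show "i \<le> n" using that by (simp add: I_def)
      show "live n kn R0 i"
      proof (rule live_mono[where R' = R and a = r])
        show "R r c" if "R0 i c" for c using that \<open>i \<in> I\<close> R(2,6) unfolding I_def by blast
      qed (rule r)
    qed
  qed
  also have "\<dots> \<le> real (2 * kn) * (2 * M)"
    using I(3) M_pos by (intro mult_right_mono) (auto simp only: of_nat_le_iff)
  finally show "F (Collect (R r)) - f S \<le> 4 * real kn * M" by simp
qed

lemma target_spec:
  assumes R: "extends R" and r: "r \<le> n"
  defines "t \<equiv> tgt R r"
  shows "t < n + 2 \<and> (r \<in> insert n S \<longrightarrow> t \<in> insert n S) \<and> (t \<noteq> r \<longrightarrow> live n kn R r \<and> \<not> R r t) \<and>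
    (t = r \<longrightarrow> live n kn R r \<longrightarrow> F (Collect (R r)) - F (Collect (R n)) \<le> M / 2) \<and>
    (t = r \<longrightarrow> live n kn R r \<longrightarrow> r \<in> insert n S \<longrightarrow> F (Collect (R r)) - f S \<le> M / 2)"
proof (cases "live n kn R r")
  case False
  then show ?thesis using r by (simp add: t_def target_def)
next
  case True
  interpret base_search n kn f S R0 M "Collect (R r)" by (rule base_search[OF R r True])
  let ?P = "\<lambda>d. real (mw_thr kn el) < overflow n kn el f R0 M (Collect (R r)) d"
  let ?d = "if M / 2 < F (Collect (R r)) - F (Collect (R n)) then n + 1 else r"
  have t: "t = last_idx ?P ?d n" using True by (simp add: t_def target_def)
  have sub: "Collect (R r) \<subseteq> insert n S" if "r \<in> insert n S" using that extendsD(4)[OF R] by blast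
  have ge: "f S \<le> F (Collect (R n))" by (rule low)
  show ?thesis
  proof (cases rule: last_idx_cases[of ?P ?d n])
    case 1
    then have q: "t < n" "?P t" by (simp_all add: t)
    have new: "\<not> R r t" using overflow_new[OF el q] by simp
    then have "t \<noteq> r" using extendsD(1)[OF R, of r] r by auto
    moreover have "t \<in> S" if "r \<in> insert n S" by (rule overflow_in_S[OF el sub[OF that] q])
    ultimately show ?thesis using q new True by auto
  next
    case 2
    have td: "t = ?d" using 2 by (simp add: t)
    have gap: "F (Collect (R r)) - f S \<le> M / 2" if "r \<in> insert n S"
      by (rule no_overflow_gap[OF el sub[OF that]]) (use 2(2) in force)
    show ?thesis
    proof (cases "M / 2 < F (Collect (R r)) - F (Collect (R n))")
      case T2: True
      \<comment> \<open>The root row has value at least \<open>f S\<close>, so the increment that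
        the program tests is a lower bound for the gap of \<open>r\<close>.\<close>
      then have "r \<notin> insert n S" using gap ge by linarith
      then show ?thesis using td T2 r True by (auto simp: live_def)
    next
      case False
      then show ?thesis using td gap r by auto
    qed
  qed
qed

lemmas target_props = target_spec[THEN conjunct1] target_spec[THEN conjunct2, THEN conjunct1, rule_format]
  target_spec[THEN conjunct2, THEN conjunct2, THEN conjunct1, rule_format]
  target_spec[THEN conjunct2, THEN conjunct2, THEN conjunct2, THEN conjunct1, rule_format]
  target_spec[THEN conjunct2, THEN conjunct2, THEN conjunct2, THEN conjunct2, rule_format]

lemma iterate_extends:
  assumes "extends R"
  shows "extends (step R)"
  unfolding extends_def iterate_def
proof (intro conjI allI impI)
  show "arc_rel n S (insert_arcs (tgt R) (n + 1) R)"
    by (rule arc_rel_insert_arcs) (use assms target_props(1,2)[OF assms] in \<open>auto simp: extends_def\<close>)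
  show "insert_arcs (tgt R) (n + 1) R a b" if "R0 a b" for a b
    by (rule insert_arcs_mono) (rule extendsD(6)[OF assms that])
qed

lemma iterations_extend: "extends ((step ^^ s) R0)"
  by (induction s) (simp_all add: iterate_extends, simp add: extends_def R0)

lemma iterate_arc:
  assumes "extends R" "p \<le> n"
  shows "step R p (tgt R p)"
  unfolding iterate_def
  by (rule insert_arcs_arc[where n = n]) (use assms extendsD(1) target_props(1) in auto)

lemma iterate_row_unchanged:
  assumes "extends R"
    and "\<And>p. p \<le> n \<Longrightarrow> step R r p \<Longrightarrow> tgt R p = p"
  shows "step R r = R r"
  unfolding iterate_def
  by (rule insert_arcs_row_unchanged[where n = n and S = S])
    (use assms target_props(1,2) in \<open>auto simp: extends_def iterate_def\<close>)

text \<open>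
  If \<open>r\<close> still has a target after a further round, then the row of \<open>r\<close> contains some \<open>p\<close> that had
  a target before that round, since otherwise nothing on which the target of \<open>r\<close> depends has changed.
  The row of \<open>p\<close> has grown in that round and is contained in the row of \<open>r\<close>.
\<close>

lemma row_size_iterations:
  assumes "r \<le> n" "tgt ((step ^^ s) R0) r \<noteq> r"
  shows "s + 1 \<le> row_size n ((step ^^ s) R0) r"
  using assms
proof (induction s arbitrary: r)
  case 0
  then have "{r} \<subseteq> {b. b \<le> n \<and> R0 r b}" using R_refl[of r] by auto
  then have "card {r} \<le> row_size n R0 r" unfolding row_size_def by (intro card_mono) auto
  then show ?case by simp
next
  case (Suc s)
  define R where "R = (step ^^ s) R0"
  define R' where "R' = step R"
  have R: "extends R" and R': "extends R'" unfolding R'_def R_def using iterations_extend[of s] iterations_extend[of "Suc s"] by simp_all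
  have t: "tgt R' r \<noteq> r" using Suc.prems(2) by (simp add: R'_def R_def)
  have live: "live n kn R' r" using target_props(3)[OF R' Suc.prems(1) t] by blast
  have "\<exists>p\<le>n. R' r p \<and> tgt R p \<noteq> p"
  proof (rule ccontr)
    assume "\<not> (\<exists>p\<le>n. R' r p \<and> tgt R p \<noteq> p)"
    then have no: "tgt R p = p" if "p \<le> n" "R' r p" for p using that by blast
    have rn: "R' r n" using extendsD(3)[OF R', of r] Suc.prems(1) by simp
    have row: "R' r = R r"
      unfolding R'_def by (rule iterate_row_unchanged[OF R]) (use no in \<open>auto simp: R'_def\<close>)
    have rown: "R' n = R n"
      unfolding R'_def
      by (rule iterate_row_unchanged[OF R]) (use no extendsD(2)[OF R' rn] in \<open>auto simp: R'_def\<close>)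
    have "tgt R' r = tgt R r"
      unfolding target_def live_def row_size_def row rown ..
    moreover have "tgt R r = r"
      using no[OF Suc.prems(1)] extendsD(1)[OF R', of r] Suc.prems(1) by simp
    ultimately show False using t by simp
  qed
  then obtain p where p: "p \<le> n" "R' r p" and tp: "tgt R p \<noteq> p" by blast
  let ?q = "tgt R p"
  have rq: "R' r ?q"
    using extendsD(2)[OF R' p(2)] iterate_arc[OF R p(1)] by (simp add: R'_def)
  have "?q \<noteq> n + 1" using live rq unfolding live_def by auto
  then have q: "?q \<le> n" using target_props(1)[OF R p(1)] by linarith
  have "s + 1 \<le> row_size n R p" using Suc.IH[OF p(1)] tp by (simp add: R_def)
  also have "row_size n R p < row_size n R' r"
    unfolding row_size_def
  proof (rule psubset_card_mono)
    have mono: "R a b \<Longrightarrow> R' a b" for a b unfolding R'_def iterate_def by (rule insert_arcs_mono)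
    have "{b. b \<le> n \<and> R p b} \<subseteq> {b. b \<le> n \<and> R' r b}"
      using mono extendsD(2)[OF R' p(2)] by blast
    moreover have "?q \<in> {b. b \<le> n \<and> R' r b}" using q rq by simp
    moreover have "?q \<notin> {b. b \<le> n \<and> R p b}" using target_props(3)[OF R p(1) tp] by simp
    ultimately show "{b. b \<le> n \<and> R p b} \<subset> {b. b \<le> n \<and> R' r b}" by blast
  qed simp
  finally show ?case by (simp add: R'_def R_def)
qed

lemma phase_correct: "arc_rel n S (phase n kn el f M R0) \<and> scale_inv n kn f S (M / 2) (phase n kn el f M R0)"
proof -
  define R where "R = (step ^^ (kn + 1)) R0"
  have R: "extends R" unfolding R_def by (rule iterations_extend)
  have fixp: "tgt R r = r" if r: "r \<le> n" "live n kn R r" for r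
  proof (rule ccontr)
    assume "tgt R r \<noteq> r"
    \<comment> \<open>This is one more than a live row may have, which fixes the number of rounds in
      \<open>phase\<close>.\<close>
    then have "kn + 1 + 1 \<le> row_size n R r" unfolding R_def by (rule row_size_iterations[OF r(1)])
    then show False using r(2) by (simp add: live_def)
  qed
  have nl: "live n kn R n" by (rule S_live) (use R in \<open>auto simp: extends_def\<close>)
  have "F (Collect (R n)) - f S \<le> M / 2"
    using target_props(5)[OF R, of n] fixp nl by auto
  moreover have "F (Collect (R p)) - F (Collect (R n)) \<le> M / 2" if "p < n" "live n kn R p" for p
    using target_props(4)[OF R, of p] fixp that by auto
  moreover have "phase n kn el f M R0 = R" by (simp add: phase_def R_def)
  ultimately show ?thesis using R unfolding scale_inv_def extends_def by auto
qed

end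

section \<open>Reasoning about programs\<close>

primrec nat_writes :: "com \<Rightarrow> vname set" where
  "nat_writes Skip = {}"
| "nat_writes (NAssign x i a) = {x}"
| "nat_writes (RAssign x i a) = {}"
| "nat_writes (Seq c d) = nat_writes c \<union> nat_writes d"
| "nat_writes (Cond b c d) = nat_writes c \<union> nat_writes d"
| "nat_writes (While b c) = nat_writes c"
| "nat_writes (QueryRound x a y) = {}"

primrec real_writes :: "com \<Rightarrow> vname set" where
  "real_writes Skip = {}"
| "real_writes (NAssign x i a) = {}"
| "real_writes (RAssign x i a) = {x}"
| "real_writes (Seq c d) = real_writes c \<union> real_writes d"
| "real_writes (Cond b c d) = real_writes c \<union> real_writes d"
| "real_writes (While b c) = real_writes c"
| "real_writes (QueryRound x a y) = {y}"

definition agree :: "com \<Rightarrow> state \<Rightarrow> state \<Rightarrow> bool" where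
  "agree c s t \<longleftrightarrow> (\<forall>x. x \<notin> nat_writes c \<longrightarrow> nats t x = nats s x) \<and>
     (\<forall>x. x \<notin> real_writes c \<longrightarrow> reals t x = reals s x)"

lemma agree_nats: "agree c s t \<Longrightarrow> x \<notin> nat_writes c \<Longrightarrow> nats t x = nats s x"
  and agree_reals: "agree c s t \<Longrightarrow> x \<notin> real_writes c \<Longrightarrow> reals t x = reals s x"
  by (auto simp: agree_def)

lemmas agreeD = agree_nats agree_reals

lemmas agree_n = agree_nats[where x = "''n''"]

lemma agree_trans: "agree c s t \<Longrightarrow> agree c t u \<Longrightarrow> agree c s u"
  by (simp add: agree_def)

lemma agree_mono:
  "agree c s t \<Longrightarrow> nat_writes c \<subseteq> nat_writes d \<Longrightarrow> real_writes c \<subseteq> real_writes d \<Longrightarrow> agree d s t"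
  unfolding agree_def by blast

lemma nats_set_nat [simp]: "nats (set_nat x i v s) = (nats s)(x := (nats s x)(i := v))"
  and reals_set_nat [simp]: "reals (set_nat x i v s) = reals s"
  and nats_set_real [simp]: "nats (set_real x i w s) = nats s"
  and reals_set_real [simp]: "reals (set_real x i w s) = (reals s)(x := (reals s x)(i := w))"
  by (simp_all add: set_nat_def set_real_def)

lemma nats_answer_round [simp]: "nats (answer_round n f x m y s) = nats s"
  and reals_answer_round [simp]: "reals (answer_round n f x m y s) =
    (reals s)(y := (\<lambda>j. if j < m then f (set_at n x (j * n) s) else reals s y j))"
  by (simp_all add: answer_round_def)

text \<open>Frame rule: an array that the text of a program never assigns keeps all its cells.
  Specifications of subprograms therefore need not list what they leave unchanged.\<close>

lemma exec_agree: "exec n f c s t k qs \<Longrightarrow> agree c s t"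
  by (induction rule: exec.induct) (auto simp: agree_def)

primrec com_size :: "com \<Rightarrow> nat" where
  "com_size Skip = 1"
| "com_size (NAssign x i a) = 1"
| "com_size (RAssign x i a) = 1"
| "com_size (Seq c d) = com_size c + com_size d"
| "com_size (Cond b c d) = 1 + com_size c + com_size d"
| "com_size (While b c) = 1 + com_size c"
| "com_size (QueryRound x a y) = 1"

abbreviation var :: "vname \<Rightarrow> nexp" where
  "var x \<equiv> NCell x (NConst 0)"

abbreviation "rvar x \<equiv> RCell x (NConst 0)"

abbreviation "set_var x \<equiv> NAssign x (NConst 0)"

abbreviation "set_rvar x \<equiv> RAssign x (NConst 0)"

abbreviation "succ_n \<equiv> NAdd (var ''n'') (NConst 1)"

definition For :: "vname \<Rightarrow> nexp \<Rightarrow> com \<Rightarrow> com" where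
  "For x e c = Seq (set_var x (NConst 0))
     (While (NLess (var x) e) (Seq c (set_var x (NAdd (var x) (NConst 1)))))"

lemma For_simps [simp]:
  "nat_writes (For x e c) = insert x (nat_writes c)" "real_writes (For x e c) = real_writes c"
  "com_size (For x e c) = com_size c + 3"
  by (auto simp: For_def)

locale query_model =
  fixes n :: nat and f :: "nat set \<Rightarrow> real"
begin

text \<open>Total correctness with a budget of \<open>K\<close> steps and \<open>D\<close> rounds.
  The cap on the queries of a round is the demand of \<open>mw_round\<close>, two sets for each of
  \<open>n + 1\<close> bases and \<open>n\<close> elements.\<close>

definition runs :: "com \<Rightarrow> state \<Rightarrow> nat \<Rightarrow> nat \<Rightarrow> (state \<Rightarrow> bool) \<Rightarrow> bool" where
  "runs c s K D Q \<longleftrightarrow> (\<exists>t k qs. exec n f c s t k qs \<and> k \<le> K \<and> length qs \<le> D \<and>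
     (\<forall>m\<in>set qs. m \<le> 2 * n * (n + 1)) \<and> Q t)"

lemma runsE:
  assumes "runs c s K D Q"
  obtains t k qs where "exec n f c s t k qs" "k \<le> K" "length qs \<le> D" "\<forall>m\<in>set qs. m \<le> 2 * n * (n + 1)" "Q t"
  using assms unfolding runs_def by blast

lemma runs_conseq:
  assumes "runs c s K D P" "K \<le> K'" "D \<le> D'" "\<And>t. P t \<Longrightarrow> agree c s t \<Longrightarrow> Q t"
  shows "runs c s K' D' Q"
proof -
  obtain t k qs where *: "exec n f c s t k qs" "k \<le> K" "length qs \<le> D"
    "\<forall>m\<in>set qs. m \<le> 2 * n * (n + 1)" "P t"
    by (rule runsE[OF assms(1)])
  then have "k \<le> K'" "length qs \<le> D'" "Q t" using assms exec_agree by auto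
  then show ?thesis using * unfolding runs_def by blast
qed

lemma runs_seq:
  assumes "runs c s K D (\<lambda>t. runs d t K' D' Q)"
  shows "runs (Seq c d) s (K + K') (D + D') Q"
proof -
  obtain t k qs where 1: "exec n f c s t k qs" "k \<le> K" "length qs \<le> D"
    "\<forall>m\<in>set qs. m \<le> 2 * n * (n + 1)" "runs d t K' D' Q"
    using assms unfolding runs_def by blast
  obtain u k' qs' where 2: "exec n f d t u k' qs'" "k' \<le> K'" "length qs' \<le> D'"
    "\<forall>m\<in>set qs'. m \<le> 2 * n * (n + 1)" "Q u"
    using 1(5) unfolding runs_def by blast
  have "exec n f (Seq c d) s u (k + k') (qs @ qs')" by (rule exec.Seq[OF 1(1) 2(1)])
  moreover have "k + k' \<le> K + K'" "length (qs @ qs') \<le> D + D'"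
    "\<forall>m\<in>set (qs @ qs'). m \<le> 2 * n * (n + 1)" using 1 2 by auto
  ultimately show ?thesis using 2(5) unfolding runs_def by blast
qed

lemma runs_skip: "Q s \<Longrightarrow> runs Skip s 1 0 Q"
  unfolding runs_def using exec.Skip by fastforce

lemma runs_nassign: "Q (set_nat x (nval i s) (nval a s) s) \<Longrightarrow> runs (NAssign x i a) s 1 0 Q"
  unfolding runs_def using exec.NAssign by fastforce

lemma runs_rassign: "Q (set_real x (nval i s) (rval a s) s) \<Longrightarrow> runs (RAssign x i a) s 1 0 Q"
  unfolding runs_def using exec.RAssign by fastforce

lemma runs_cond:
  assumes "bval b s \<Longrightarrow> runs c s K D Q" "\<not> bval b s \<Longrightarrow> runs d s K D Q"
  shows "runs (Cond b c d) s (Suc K) D Q"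
proof -
  obtain t k qs where *: "exec n f (if bval b s then c else d) s t k qs" "k \<le> K" "length qs \<le> D"
    "\<forall>m\<in>set qs. m \<le> 2 * n * (n + 1)" "Q t"
    using assms unfolding runs_def by (cases "bval b s") auto
  then have "exec n f (Cond b c d) s t (Suc k) qs"
    by (cases "bval b s") (auto intro: exec.CondTrue exec.CondFalse)
  moreover have "Suc k \<le> Suc K" using * by simp
  ultimately show ?thesis using * unfolding runs_def by blast
qed

lemma runs_query:
  assumes "nval a s = m" "m \<le> 2 * n * (n + 1)" "Q (answer_round n f x m y s)"
  shows "runs (QueryRound x a y) s (Suc m) 1 Q"
proof -
  have "exec n f (QueryRound x a y) s (answer_round n f x m y s) (Suc m) [m]"
    by (rule exec.QueryRound) (simp add: assms)
  moreover have "length [m] \<le> 1" "\<forall>m\<in>set [m]. m \<le> 2 * n * (n + 1)" using assms by auto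
  ultimately show ?thesis using assms(3) unfolding runs_def by blast
qed

lemma runs_while_false: "\<not> bval b s \<Longrightarrow> Q s \<Longrightarrow> runs (While b c) s 1 0 Q"
  unfolding runs_def using exec.WhileFalse by fastforce

lemma runs_while_true:
  assumes "bval b s" "runs c s K D (\<lambda>t. runs (While b c) t K' D' Q)"
  shows "runs (While b c) s (Suc (K + K')) (D + D') Q"
proof -
  obtain t k qs where 1: "exec n f c s t k qs" "k \<le> K" "length qs \<le> D"
    "\<forall>m\<in>set qs. m \<le> 2 * n * (n + 1)" "runs (While b c) t K' D' Q"
    using assms unfolding runs_def by blast
  obtain u k' qs' where 2: "exec n f (While b c) t u k' qs'" "k' \<le> K'" "length qs' \<le> D'"
    "\<forall>m\<in>set qs'. m \<le> 2 * n * (n + 1)" "Q u"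
    using 1(5) unfolding runs_def by blast
  have "exec n f (While b c) s u (Suc (k + k')) (qs @ qs')"
    by (rule exec.WhileTrue[OF assms(1) 1(1) 2(1)])
  moreover have "Suc (k + k') \<le> Suc (K + K')" "length (qs @ qs') \<le> D + D'"
    "\<forall>m\<in>set (qs @ qs'). m \<le> 2 * n * (n + 1)" using 1 2 by auto
  ultimately show ?thesis using 2(5) unfolding runs_def by blast
qed

text \<open>The outer 2 pays for the initialisation and the failing test, the inner 2 for the test
  and the increment of one pass. The invariant must ignore the counter cell, which the loop rewrites
  between passes.\<close>

lemma runs_for:
  assumes x: "x \<notin> nat_writes c" and e: "\<And>t. agree (For x e c) s t \<Longrightarrow> nval e t = N"
    and init: "I 0 s"
    and step: "\<And>i t. i < N \<Longrightarrow> I i t \<Longrightarrow> nats t x 0 = i \<Longrightarrow> agree (For x e c) s t \<Longrightarrow> runs c t K D (I (Suc i))"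
    and indep: "\<And>i t v. I i t \<Longrightarrow> I i (set_nat x 0 v t)"
    and final: "\<And>t. I N t \<Longrightarrow> agree (For x e c) s t \<Longrightarrow> Q t"
  shows "runs (For x e c) s (2 + N * (K + 2)) (N * D) Q"
proof -
  let ?body = "Seq c (set_var x (NAdd (var x) (NConst 1)))"
  let ?w = "While (NLess (var x) e) ?body"
  have loop: "runs ?w t (1 + (N - i) * (K + 2)) ((N - i) * D) Q"
    if "i \<le> N" "I i t" "nats t x 0 = i" "agree (For x e c) s t" for i t
    using that
  proof (induction "N - i" arbitrary: i t)
    case 0
    have "runs ?w t 1 0 Q" by (rule runs_while_false) (use 0 e final in auto)
    then show ?case using 0 by simp
  next
    case (Suc m)
    have iN: "i < N" using Suc by simp
    have "runs ?w t (Suc ((K + 1) + (1 + (N - Suc i) * (K + 2)))) ((D + 0) + (N - Suc i) * D) Q"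
    proof (rule runs_while_true)
      show "bval (NLess (var x) e) t" using Suc.prems iN e by simp
      show "runs ?body t (K + 1) (D + 0) (\<lambda>t. runs ?w t (1 + (N - Suc i) * (K + 2)) ((N - Suc i) * D) Q)"
      proof (rule runs_seq, rule runs_conseq[OF step[OF iN]])
        fix t' assume t': "I (Suc i) t'" "agree c t t'"
        have xt': "nats t' x 0 = i" using agree_nats[OF t'(2) x] Suc.prems by simp
        have ag: "agree (For x e c) s t'"
          using agree_trans[OF Suc.prems(4) agree_mono[OF t'(2)]] by auto
        show "runs (set_var x (NAdd (var x) (NConst 1))) t' 1 0
          (\<lambda>t. runs ?w t (1 + (N - Suc i) * (K + 2)) ((N - Suc i) * D) Q)"
        proof (rule runs_nassign, rule Suc.hyps(1))
          let ?t = "set_nat x (nval (NConst 0) t') (nval (NAdd (var x) (NConst 1)) t') t'"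
          show "I (Suc i) ?t" using indep[OF t'(1)] by simp
          show "agree (For x e c) s ?t" using ag by (simp add: agree_def)
        qed (use Suc xt' in auto)
      qed (use Suc.prems in auto)
    qed
    moreover have m: "N - Suc i = m" "N - i = Suc m" using Suc.hyps(2) by simp_all
    ultimately show ?case unfolding m by (simp add: algebra_simps)
  qed
  have "runs (For x e c) s (1 + (1 + (N - 0) * (K + 2))) (0 + (N - 0) * D) Q"
    unfolding For_def
  proof (rule runs_seq, rule runs_nassign, rule loop)
    let ?t = "set_nat x (nval (NConst 0) s) (nval (NConst 0) s) s"
    show "I 0 ?t" using indep[OF init] by simp
    show "agree (For x e c) s ?t" by (simp add: agree_def)
  qed auto
  then show ?thesis by simp
qed

text \<open>
  The step budget is proportional to the size of the program, so that budgets add up along \<open>Seq\<close>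
  and a loop only raises the exponent.
\<close>

definition quick :: "nat \<Rightarrow> com \<Rightarrow> state \<Rightarrow> (state \<Rightarrow> bool) \<Rightarrow> bool" where
  "quick j c s Q \<longleftrightarrow> runs c s (com_size c * (n + 2) ^ j) 0 Q"

lemma quick_conseq:
  assumes "quick j c s P" "j \<le> j'" "\<And>t. P t \<Longrightarrow> agree c s t \<Longrightarrow> Q t"
  shows "quick j' c s Q"
  unfolding quick_def
  by (rule runs_conseq[OF assms(1)[unfolded quick_def]])
    (use assms in \<open>auto intro!: mult_le_mono power_increasing\<close>)

lemma quick_skip: "Q s \<Longrightarrow> quick j Skip s Q"
  unfolding quick_def by (rule runs_conseq[OF runs_skip[of Q]]) auto

lemma quick_nassign: "Q (set_nat x (nval i s) (nval a s) s) \<Longrightarrow> quick j (NAssign x i a) s Q"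
  unfolding quick_def by (rule runs_conseq[OF runs_nassign[of Q]]) auto

lemma quick_rassign: "Q (set_real x (nval i s) (rval a s) s) \<Longrightarrow> quick j (RAssign x i a) s Q"
  unfolding quick_def by (rule runs_conseq[OF runs_rassign[of Q]]) auto

lemma quick_seq: "quick j c s (\<lambda>t. quick j d t Q) \<Longrightarrow> quick j (Seq c d) s Q"
  unfolding quick_def using runs_seq[of c s _ 0 d _ 0 Q] by (simp add: distrib_right)

lemma quick_cond:
  assumes "bval b s \<Longrightarrow> quick j c s Q" "\<not> bval b s \<Longrightarrow> quick j d s Q"
  shows "quick j (Cond b c d) s Q"
proof -
  have "runs (Cond b c d) s (Suc (com_size c * (n + 2) ^ j + com_size d * (n + 2) ^ j)) 0 Q"
    by (rule runs_cond; rule runs_conseq) (use assms in \<open>auto simp: quick_def\<close>)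
  then show ?thesis
    unfolding quick_def by (rule runs_conseq) (auto simp: distrib_right)
qed

lemma quick_for:
  assumes x: "x \<notin> nat_writes c" and N: "N \<le> n + 2"
    and e: "\<And>t. agree (For x e c) s t \<Longrightarrow> nval e t = N"
    and init: "I 0 s"
    and step: "\<And>i t. i < N \<Longrightarrow> I i t \<Longrightarrow> nats t x 0 = i \<Longrightarrow> agree (For x e c) s t \<Longrightarrow> quick j c t (I (Suc i))"
    and indep: "\<And>i t v. I i t \<Longrightarrow> I i (set_nat x 0 v t)"
    and final: "\<And>t. I N t \<Longrightarrow> agree (For x e c) s t \<Longrightarrow> Q t"
  shows "quick (Suc j) (For x e c) s Q"
proof -
  let ?W = "(n + 2) ^ j"
  have "runs (For x e c) s (2 + N * (com_size c * ?W + 2)) (N * 0) Q"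
    by (rule runs_for[where I = I, OF x e init]) (use step indep final in \<open>auto simp: quick_def\<close>)
  moreover have "2 + N * (com_size c * ?W + 2) \<le> com_size (For x e c) * (n + 2) ^ Suc j"
  proof -
    have W: "1 \<le> ?W" by simp
    have "2 + N * (com_size c * ?W + 2) \<le> (n + 2) + (n + 2) * (com_size c * ?W + 2)"
      using N by (intro add_mono mult_le_mono) auto
    also have "\<dots> = (n + 2) * (com_size c * ?W + 3 * 1)" by (simp add: algebra_simps)
    also have "\<dots> \<le> (n + 2) * (com_size c * ?W + 3 * ?W)"
      using W by (intro mult_le_mono add_mono) auto
    finally show ?thesis by (simp add: algebra_simps)
  qed
  ultimately show ?thesis unfolding quick_def by (auto elim: runs_conseq)
qed

lemma quick_for_fold:
  fixes view :: "state \<Rightarrow> 'v"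
  assumes "x \<notin> nat_writes c" "N \<le> n + 2" "\<And>t. agree (For x e c) s t \<Longrightarrow> nval e t = N"
    and "view s = F 0"
    and "\<And>i t. i < N \<Longrightarrow> view t = F i \<Longrightarrow> nats t x 0 = i \<Longrightarrow> agree (For x e c) s t \<Longrightarrow>
      quick j c t (\<lambda>t'. view t' = F (Suc i))"
    and "\<And>t v. view (set_nat x 0 v t) = view t"
    and "\<And>t. view t = F N \<Longrightarrow> agree (For x e c) s t \<Longrightarrow> Q t"
  shows "quick (Suc j) (For x e c) s Q"
  by (rule quick_for[where I = "\<lambda>i t. view t = F i"]) (use assms in auto)

text \<open>
  A loop whose \<open>i\<close>-th pass rewrites exactly the entries \<open>k\<close> with \<open>cls k = i\<close>. Nested loops are handled
  by giving all entries that the inner loop must not touch a class beyond its range.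
\<close>

lemma quick_for_par:
  fixes view :: "'k \<Rightarrow> state \<Rightarrow> 'v"
  assumes x: "x \<notin> nat_writes c" and N: "N \<le> n + 2"
    and e: "\<And>t. agree (For x e c) s t \<Longrightarrow> nval e t = N"
    and step: "\<And>i t. i < N \<Longrightarrow> nats t x 0 = i \<Longrightarrow> agree (For x e c) s t \<Longrightarrow>
      (\<And>k. k \<in> Ks \<Longrightarrow> cls k = i \<Longrightarrow> view k t = view k s) \<Longrightarrow>
      quick j c t (\<lambda>t'. \<forall>k\<in>Ks. view k t' = (if cls k = i then E k else view k t))"
    and indep: "\<And>k t v. view k (set_nat x 0 v t) = view k t"
    and final: "\<And>t. (\<And>k. k \<in> Ks \<Longrightarrow> view k t = (if cls k < N then E k else view k s)) \<Longrightarrow>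
      agree (For x e c) s t \<Longrightarrow> Q t"
  shows "quick (Suc j) (For x e c) s Q"
proof (rule quick_for[where N = N and I = "\<lambda>i t. \<forall>k\<in>Ks. view k t = (if cls k < i then E k else view k s)"])
  fix i t
  assume i: "i < N" and t: "\<forall>k\<in>Ks. view k t = (if cls k < i then E k else view k s)"
    and xi: "nats t x 0 = i" and ag: "agree (For x e c) s t"
  show "quick j c t (\<lambda>t. \<forall>k\<in>Ks. view k t = (if cls k < Suc i then E k else view k s))"
    by (rule quick_conseq[OF step[OF i xi ag]]) (use t in \<open>auto simp: less_Suc_eq\<close>)
qed (use x N e indep final in auto)

end

lemma index_eq_iff: "b < w \<Longrightarrow> b' < w \<Longrightarrow> a * w + b = a' * w + b' \<longleftrightarrow> a = a' \<and> b = (b'::nat)"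
  by (metis add_right_cancel div_mult_self3 div_less add.right_neutral gr_implies_not0 add_left_cancel
      mult.commute div_mult_self2 add.commute)

lemma index_less: "a < m \<Longrightarrow> b < w \<Longrightarrow> a * w + b < m * (w::nat)"
proof -
  assume "a < m" "b < w"
  then have "a * w + b < Suc a * w" by simp
  also have "\<dots> \<le> m * w" using \<open>a < m\<close> by (intro mult_le_mono1) simp
  finally show ?thesis .
qed

section \<open>The program\<close>

abbreviation rel_cell :: "vname \<Rightarrow> nexp \<Rightarrow> nexp \<Rightarrow> nexp" where
  "rel_cell X a b \<equiv> NCell X (NAdd (NMul a (NAdd (var ''n'') (NConst 2))) b)"

abbreviation row_index :: "nexp \<Rightarrow> nexp \<Rightarrow> nexp" where
  "row_index a b \<equiv> NAdd (NMul a (var ''n'')) b"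

text \<open>Every nonzero entry counts as true, so that addition computes disjunctions and
  multiplication computes conjunctions. Out-of-range pairs are false, which allows relations to be
  compared by equality.\<close>

definition rel :: "nat \<Rightarrow> vname \<Rightarrow> state \<Rightarrow> nat \<Rightarrow> nat \<Rightarrow> bool" where
  "rel n X t = (\<lambda>a b. a < n + 2 \<and> b < n + 2 \<and> nats t X (a * (n + 2) + b) \<noteq> 0)"

lemma rel_iff: "a < n + 2 \<Longrightarrow> b < n + 2 \<Longrightarrow> rel n X t a b \<longleftrightarrow> nats t X (a * (n + 2) + b) \<noteq> 0"
  by (simp add: rel_def)

lemma rel_cong: "nats t X = nats s Y \<Longrightarrow> rel n X t = rel n Y s"
  by (simp add: rel_def)

text \<open>Subtraction is truncated: \<open>1 - (1 - x)\<close> normalises a nonzero entry to 1.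
  The product stored in \<open>lv\<close> is nonzero exactly if the row has at most
  \<open>kk + 1\<close> entries and there is no arc to falsity.\<close>

definition count_rows :: "vname \<Rightarrow> vname \<Rightarrow> com" where
  "count_rows ct lv = For ''a'' succ_n
     (Seq (set_var ''acc'' (NConst 0))
     (Seq (For ''b'' succ_n
        (set_var ''acc''
          (NAdd (var ''acc'') (NSub (NConst 1) (NSub (NConst 1) (rel_cell ''R'' (var ''a'') (var ''b'')))))))
     (Seq (NAssign ct (var ''a'') (var ''acc''))
        (NAssign lv (var ''a'') (NMul (NSub (NAdd (var ''kk'') (NConst 2)) (var ''acc''))
          (NSub (NConst 1) (rel_cell ''R'' (var ''a'') succ_n)))))))"

context query_model
begin

lemma count_rows:
  assumes n: "nats s ''n'' 0 = n" and kn: "nats s ''kk'' 0 = kn"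
    and ct: "ct \<notin> {''R'', ''acc'', ''a'', ''b'', ''n'', ''kk''}" "lv \<notin> {''R'', ''acc'', ''a'', ''b'', ''n'', ''kk''}"
    "ct \<noteq> lv"
    and Q: "\<And>t. (\<And>a. a \<le> n \<Longrightarrow> nats t ct a = row_size n (rel n ''R'' s) a \<and>
        (nats t lv a \<noteq> 0 \<longleftrightarrow> live n kn (rel n ''R'' s) a)) \<Longrightarrow> agree (count_rows ct lv) s t \<Longrightarrow> Q t"
  shows "quick (Suc (Suc 0)) (count_rows ct lv) s Q"
proof -
  have ne [simp]: "(x = ct) = False" "(ct = x) = False" "(x = lv) = False" "(lv = x) = False"
    if "x \<in> {''R'', ''acc'', ''a'', ''b'', ''n'', ''kk''}" for x
    using ct that by auto
  note [simp] = ct(3) ct(3)[symmetric]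
  show ?thesis
    unfolding count_rows_def
  proof (rule quick_for_par[where N = "n + 1" and Ks = "{..n}" and cls = "\<lambda>a. a"
        and view = "\<lambda>a t. (nats t ct a, nats t lv a \<noteq> 0)"
        and E = "\<lambda>a. (row_size n (rel n ''R'' s) a, live n kn (rel n ''R'' s) a)"], goal_cases)
    case (4 a t)
    have [simp]: "nats t ''n'' 0 = n" "nats t ''kk'' 0 = kn" "nats t ''R'' = nats s ''R''"
      using agree_nats[OF 4(3)] n kn ct by auto
    let ?C = "\<lambda>m. card {b. b < m \<and> rel n ''R'' s a b}"
    have C: "?C (Suc m) = ?C m + (if rel n ''R'' s a m then 1 else 0)" for m
    proof -
      have "{b. b < Suc m \<and> rel n ''R'' s a b} = {b. b < m \<and> rel n ''R'' s a b} \<union> (if rel n ''R'' s a m then {m} else {})"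
        by (auto simp: less_Suc_eq)
      then show ?thesis by (simp add: card_insert_if)
    qed
    show ?case
    proof (rule quick_seq, rule quick_nassign, rule quick_seq,
        rule quick_for_fold[where N = "n + 1" and view = "\<lambda>t. nats t ''acc'' 0" and F = ?C], goal_cases)
      case (5 m u)
      have [simp]: "nats u ''n'' 0 = n" "nats u ''R'' = nats s ''R''" "nats u ''a'' 0 = a"
        using agree_nats[OF 5(4)] 4(2) ct by auto
      show ?case
        by (rule quick_nassign) (use 5(1,2,3) 4(1) rel_iff[of a n m "''R''" s] in \<open>simp add: C\<close>)
    next
      case (7 u)
      have [simp]: "nats u ''n'' 0 = n" "nats u ''kk'' 0 = kn" "nats u ''R'' = nats s ''R''" "nats u ''a'' 0 = a"
        and ctlv: "nats u ct = nats t ct" "nats u lv = nats t lv"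
        using agree_nats[OF 7(2)] 4(2) ct by auto
      have size: "?C (n + 1) = row_size n (rel n ''R'' s) a" by (simp add: row_size_def less_Suc_eq_le)
      have live: "?C (n + 1) < kn + 2 \<and> nats s ''R'' (a * (n + 2) + (n + 1)) = 0 \<longleftrightarrow> live n kn (rel n ''R'' s) a"
        using 4(1) rel_iff[of a n "n + 1" "''R''" s] unfolding size live_def by auto
      show ?case
        by (rule quick_seq, rule quick_nassign, rule quick_nassign, rule ballI)
          (use ctlv size 7(1) live in \<open>simp del: mult_Suc_right\<close>)
    qed (use agree_n in auto)
  next
    case (6 t)
    then show ?case using Q[of t] unfolding count_rows_def by auto
  qed (use n agree_n in auto)
qed

lemma quick_for2:
  fixes view :: "'k \<Rightarrow> state \<Rightarrow> 'v"
  assumes x: "x \<notin> nat_writes c" "y \<notin> nat_writes c" "x \<noteq> y" and N: "N1 \<le> n + 2" "N2 \<le> n + 2"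
    and e: "\<And>t. agree (For x e1 (For y e2 c)) s t \<Longrightarrow> nval e1 t = N1 \<and> nval e2 t = N2"
    and step: "\<And>i j t. i < N1 \<Longrightarrow> j < N2 \<Longrightarrow> nats t x 0 = i \<Longrightarrow> nats t y 0 = j \<Longrightarrow>
      agree (For x e1 (For y e2 c)) s t \<Longrightarrow>
      (\<And>k. k \<in> Ks \<Longrightarrow> cls1 k = i \<Longrightarrow> cls2 k = j \<Longrightarrow> view k t = view k s) \<Longrightarrow>
      quick J c t (\<lambda>t'. \<forall>k\<in>Ks. view k t' = (if cls1 k = i \<and> cls2 k = j then E k else view k t))"
    and cls2: "\<And>k. k \<in> Ks \<Longrightarrow> cls2 k < N2"
    and indep: "\<And>k t v. view k (set_nat x 0 v t) = view k t" "\<And>k t v. view k (set_nat y 0 v t) = view k t"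
    and final: "\<And>t. (\<And>k. k \<in> Ks \<Longrightarrow> view k t = (if cls1 k < N1 then E k else view k s)) \<Longrightarrow>
      agree (For x e1 (For y e2 c)) s t \<Longrightarrow> Q t"
  shows "quick (Suc (Suc J)) (For x e1 (For y e2 c)) s Q"
proof (rule quick_for_par[where N = N1 and Ks = Ks and cls = cls1 and view = view and E = E], goal_cases)
  case (4 i t)
  let ?cls = "\<lambda>k. if cls1 k = i then cls2 k else N2"
  show ?case
  proof (rule quick_for_par[where N = N2 and Ks = Ks and cls = ?cls and view = view and E = E], goal_cases)
    case (3 u)
    then show ?case using agree_trans[OF 4(3) agree_mono[OF 3]] e by auto
  next
    case (4 j u)
    have ag: "agree (For x e1 (For y e2 c)) s u"
      using agree_trans[OF \<open>agree (For x e1 (For y e2 c)) s t\<close> agree_mono[OF 4(3)]] by auto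
    have xi: "nats u x 0 = i" using agree_nats[OF 4(3), of x] x \<open>nats t x 0 = i\<close> by simp
    show ?case
    proof (rule quick_conseq[OF step[OF \<open>i < N1\<close> 4(1) xi 4(2) ag]])
      show "view k u = view k s" if "k \<in> Ks" "cls1 k = i" "cls2 k = j" for k
        using 4(4)[OF that(1)] \<open>\<And>k. k \<in> Ks \<Longrightarrow> cls1 k = i \<Longrightarrow> view k t = view k s\<close>[OF that(1,2)] that by simp
      show "\<forall>k\<in>Ks. view k v = (if (if cls1 k = i then cls2 k else N2) = j then E k else view k u)"
        if "\<forall>k\<in>Ks. view k v = (if cls1 k = i \<and> cls2 k = j then E k else view k u)" for v
        using that 4(1) by auto
    qed simp
  next
    case (6 u)
    then show ?case using cls2 by auto
  qed (use x N indep in auto)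
qed (use x N e indep final in auto)

lemmas quick_for_rows =
  quick_for2[where ?N1.0 = "n + 1" and ?N2.0 = n and Ks = "{..n} \<times> {..<n}" and ?cls1.0 = fst and ?cls2.0 = snd]

end

definition write_base_sets :: com where
  "write_base_sets = For ''r'' succ_n (For ''i'' (var ''n'')
     (NAssign ''x'' (row_index (var ''r'') (var ''i'')) (rel_cell ''R'' (var ''r'') (var ''i''))))"

definition init_weights :: com where
  "init_weights = For ''r'' succ_n (For ''d'' (var ''n'')
     (Seq (RAssign ''z'' (row_index (var ''r'') (var ''d''))
        (RDiv (ROfNat (NSub (NConst 1) (NSub (NConst 1) (NCell ''lz'' (var ''d''))))) (ROfNat (var ''n''))))
      (RAssign ''ov'' (row_index (var ''r'') (var ''d'')) (ROfNat (NConst 0)))))"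

definition row_fun :: "nat \<Rightarrow> vname \<Rightarrow> nat \<Rightarrow> state \<Rightarrow> nat \<Rightarrow> real" where
  "row_fun n X r t = (\<lambda>d. if d < n then reals t X (r * n + d) else 0)"

context query_model
begin

lemma write_base_sets:
  assumes n: "nats s ''n'' 0 = n"
    and Q: "\<And>t. (\<And>r. r \<le> n \<Longrightarrow> f (set_at n ''x'' (r * n) t) = ev n f (Collect (rel n ''R'' s r))) \<Longrightarrow>
      agree write_base_sets s t \<Longrightarrow> Q t"
  shows "quick (Suc (Suc 0)) write_base_sets s Q"
  unfolding write_base_sets_def
proof (rule quick_for_rows[where view = "\<lambda>k t. nats t ''x'' (fst k * n + snd k)"
      and E = "\<lambda>k. nats s ''R'' (fst k * (n + 2) + snd k)"], goal_cases)
  case (7 i j t)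
  have [simp]: "nats t ''n'' 0 = n" "nats t ''R'' = nats s ''R''"
    using agree_nats[OF 7(5)] n by auto
  show ?case
    by (rule quick_nassign) (use 7(1-4) in \<open>auto simp: index_eq_iff\<close>)
next
  case (11 t)
  show ?case
  proof (rule Q)
    fix r assume r: "r \<le> n"
    have "nats t ''x'' (r * n + i) = nats s ''R'' (r * (n + 2) + i)" if "i < n" for i
      using 11(1)[of "(r, i)"] r that by simp
    then have "set_at n ''x'' (r * n) t = Collect (rel n ''R'' s r) \<inter> {..<n}"
      using r by (auto simp: set_at_def rel_def)
    then show "f (set_at n ''x'' (r * n) t) = ev n f (Collect (rel n ''R'' s r))" by (simp add: ev_def)
  qed (use 11 in \<open>simp add: write_base_sets_def\<close>)
qed (use n agree_n in auto)

lemma init_weights: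
  assumes n: "nats s ''n'' 0 = n"
    and live: "\<And>d. d \<le> n \<Longrightarrow> nats s ''lz'' d \<noteq> 0 \<longleftrightarrow> live n kn R d"
    and Q: "\<And>t. (\<And>r. r \<le> n \<Longrightarrow> (row_fun n ''z'' r t, row_fun n ''ov'' r t) = mw_init n kn R) \<Longrightarrow>
      agree init_weights s t \<Longrightarrow> Q t"
  shows "quick (Suc (Suc 0)) init_weights s Q"
  unfolding init_weights_def
proof (rule quick_for_rows[where view = "\<lambda>k t. (reals t ''z'' (fst k * n + snd k), reals t ''ov'' (fst k * n + snd k))"
      and E = "\<lambda>k. (if live n kn R (snd k) then 1 / real n else 0, 0)"], goal_cases)
  case (7 i j t)
  have [simp]: "nats t ''n'' 0 = n" "nats t ''lz'' = nats s ''lz''"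
    using agree_nats[OF 7(5)] n by auto
  have "real (1 - (1 - nats s ''lz'' j)) / real n = (if live n kn R j then 1 / real n else 0)"
    using live[of j] 7(2) by (cases "nats s ''lz'' j = 0") auto
  then show ?case
    by (intro quick_seq quick_rassign) (use 7(1-4) in \<open>auto simp: index_eq_iff\<close>)
next
  case (11 t)
  show ?case
  proof (rule Q)
    fix r assume r: "r \<le> n"
    show "(row_fun n ''z'' r t, row_fun n ''ov'' r t) = mw_init n kn R"
      using 11(1)[of "(r, d)" for d] r by (auto simp: row_fun_def mw_init_def)
  qed (use 11 in \<open>simp add: init_weights_def\<close>)
qed (use n agree_n in auto)

end

section \<open>One step of multiplicative weights as a program, for all bases in a single query
  round\<close>

abbreviation "rd_index \<equiv> row_index (var ''r'') (var ''d'')"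

definition find_leaders :: com where
  "find_leaders = For ''r'' succ_n (For ''d'' (var ''n'')
     (Seq (set_var ''acc'' (var ''d''))
     (Seq (For ''p'' (var ''n'')
        (Cond (BAnd (NLess (NConst 0) (rel_cell ''R0'' (var ''p'') (var ''d'')))
            (RLess (RCell ''z'' (row_index (var ''r'') (var ''acc'')))
              (RCell ''z'' (row_index (var ''r'') (var ''p'')))))
          (set_var ''acc'' (var ''p'')) Skip))
     (Seq (NAssign ''pi'' rd_index (var ''acc''))
        (RAssign ''w'' rd_index
          (RCell ''z'' (row_index (var ''r'') (var ''acc''))))))))"

text \<open>This is the disjunction in \<open>prec\<close>, written by De Morgan's law because tests
  provide only negation and conjunction.\<close>

definition prec_test :: bexp where
  "prec_test =
    (let we = RCell ''w'' (row_index (var ''r'') (var ''e'')); wd = RCell ''w'' rd_index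
     in BNot (BAnd (BNot (RLess wd we)) (BNot (BAnd (BNot (RLess we wd))
       (NLess (row_index (NCell ''cz'' (var ''e'')) (var ''e''))
         (row_index (NCell ''cz'' (var ''d'')) (var ''d'')))))))"

abbreviation query_index :: "nat \<Rightarrow> nexp" where
  "query_index c \<equiv> NAdd (NMul (NAdd (NMul rd_index (NConst 2)) (NConst c)) (var ''n'')) (var ''i'')"

text \<open>For base \<open>r\<close> and element \<open>d\<close>, the sets with numbers
  \<open>2 * (r * n + d)\<close> and \<open>2 * (r * n + d) + 1\<close> are the prefix without and
  with the row of \<open>d\<close>; the marginal is the difference of the two answers.\<close>

definition write_query_sets :: com where
  "write_query_sets = For ''r'' succ_n (For ''d'' (var ''n'') (For ''i'' (var ''n'')
     (Seq (set_var ''acc'' (rel_cell ''R'' (var ''r'') (var ''i'')))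
     (Seq (For ''e'' (var ''n'') (Cond prec_test
        (set_var ''acc'' (NAdd (var ''acc'') (rel_cell ''R0'' (var ''e'') (var ''i'')))) Skip))
     (Seq (NAssign ''x'' (query_index 0) (var ''acc''))
        (NAssign ''x'' (query_index 1) (NAdd (var ''acc'') (rel_cell ''R0'' (var ''d'') (var ''i'')))))))))"

definition marginals :: com where
  "marginals = For ''r'' succ_n (For ''d'' (var ''n'')
     (RAssign ''g'' rd_index
       (RSub (RCell ''y'' (NAdd (NMul rd_index (NConst 2)) (NConst 1)))
         (RCell ''y'' (NMul rd_index (NConst 2))))))"

definition update_weights :: com where
  "update_weights =
    (let idx = rd_index; rc = rvar ''racc''; zc = RCell ''z'' idx
     in For ''r'' succ_n (For ''d'' (var ''n'')
     (Seq (set_rvar ''racc'' (ROfNat (NConst 0)))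
     (Seq (For ''q'' (var ''n'')
        (Cond (BAnd (BAnd (BNot (NLess (NCell ''pi'' (row_index (var ''r'') (var ''q''))) (var ''d'')))
                          (BNot (NLess (var ''d'') (NCell ''pi'' (row_index (var ''r'') (var ''q''))))))
            (RLess (ROfNat (NConst 0)) (RCell ''g'' (row_index (var ''r'') (var ''q'')))))
          (set_rvar ''racc'' (RAdd rc (RCell ''g'' (row_index (var ''r'') (var ''q'')))))
          Skip))
     (Seq (Cond (RLess (RCell ''g'' idx) (ROfNat (NConst 0)))
        (set_rvar ''racc'' (RAdd (RCell ''g'' idx) rc)) Skip)
     (Seq (set_rvar ''racc'' (RMul zc (RSub (ROfNat (NConst 1)) (RMul (rvar ''eta'') rc))))
        (Cond (RLess (ROfNat (NConst 1)) rc)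
          (Seq (RAssign ''ov'' idx (RAdd (RCell ''ov'' idx) (RSub rc (ROfNat (NConst 1)))))
             (RAssign ''z'' idx (ROfNat (NConst 1))))
          (RAssign ''z'' idx rc))))))))"

context query_model
begin

lemma quick_nassign_eq:
  "nval i s = a \<Longrightarrow> nval e s = b \<Longrightarrow> Q (set_nat x a b s) \<Longrightarrow> quick j (NAssign x i e) s Q"
  by (blast intro: quick_nassign)

lemma find_leaders:
  fixes s
  defines "R0 \<equiv> rel n ''R0'' s" and "x \<equiv> \<lambda>r. row_fun n ''z'' r s"
  assumes n: "nats s ''n'' 0 = n"
    and Q: "\<And>t. (\<And>r d. r \<le> n \<Longrightarrow> d < n \<Longrightarrow> nats t ''pi'' (r * n + d) = leader n R0 (x r) d \<and>
        reals t ''w'' (r * n + d) = x r (leader n R0 (x r) d)) \<Longrightarrow>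
      agree find_leaders s t \<Longrightarrow> Q t"
  shows "quick (Suc (Suc (Suc 0))) find_leaders s Q"
  unfolding find_leaders_def
proof (rule quick_for_rows[where view = "\<lambda>k t. (nats t ''pi'' (fst k * n + snd k), reals t ''w'' (fst k * n + snd k))"
      and E = "\<lambda>k. (leader n R0 (x (fst k)) (snd k), x (fst k) (leader n R0 (x (fst k)) (snd k)))"], goal_cases)
  case (7 r d t)
  have [simp]: "nats t ''n'' 0 = n" "nats t ''R0'' = nats s ''R0''" "reals t ''z'' = reals s ''z''"
    using agreeD[OF 7(5)] n by auto
  let ?F = "leader_upto R0 (x r) d"
  have F: "?F m < n" if "m \<le> n" for m using leader_upto_less[OF 7(2) that] .
  show ?case
  proof (rule quick_seq, rule quick_nassign, rule quick_seq,
      rule quick_for_fold[where N = n and view = "\<lambda>t. nats t ''acc'' 0" and F = ?F], goal_cases)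
    case (5 p u)
    have [simp]: "nats u ''n'' 0 = n" "nats u ''R0'' = nats s ''R0''" "reals u ''z'' = reals s ''z''"
      "nats u ''r'' 0 = r" "nats u ''d'' 0 = d"
      using agreeD[OF 5(4)] 7(3,4) by auto
    have "R0 p d \<longleftrightarrow> nats s ''R0'' (p * (n + 2) + d) \<noteq> 0"
      unfolding R0_def by (rule rel_iff) (use 5(1) 7(2) in auto)
    moreover have "x r (?F p) = reals s ''z'' (r * n + ?F p)" "x r p = reals s ''z'' (r * n + p)"
      using F[of p] 5(1) by (auto simp: x_def row_fun_def)
    ultimately show ?case
      by (intro quick_cond quick_nassign quick_skip) (use 5(2,3) in auto)
  next
    case (7 u)
    have [simp]: "nats u ''n'' 0 = n" "nats u ''pi'' = nats t ''pi''" "reals u ''w'' = reals t ''w''"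
      "reals u ''z'' = reals s ''z''" "nats u ''r'' 0 = r" "nats u ''d'' 0 = d"
      using agreeD[OF 7(2)] \<open>nats t ''r'' 0 = r\<close> \<open>nats t ''d'' 0 = d\<close> by auto
    have "x r (leader n R0 (x r) d) = reals s ''z'' (r * n + leader n R0 (x r) d)"
      using F[of n] by (simp add: x_def row_fun_def leader_def)
    then show ?case
      by (intro quick_seq quick_nassign quick_rassign)
        (use 7(1) \<open>r < n + 1\<close> \<open>d < n\<close> in \<open>auto simp: index_eq_iff leader_def\<close>)
  qed (use 7(4) agree_n in auto)
next
  case (11 t)
  show ?case
  proof (rule Q)
    fix r d assume "r \<le> n" "d < n"
    then show "nats t ''pi'' (r * n + d) = leader n R0 (x r) d \<and>
        reals t ''w'' (r * n + d) = x r (leader n R0 (x r) d)"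
      using 11(1)[of "(r, d)"] by simp
  qed (use 11 in \<open>simp add: find_leaders_def\<close>)
qed (use n agree_n in auto)

lemma write_query_sets:
  fixes s and x :: "nat \<Rightarrow> nat \<Rightarrow> real"
  defines "R0 \<equiv> rel n ''R0'' s" and "R \<equiv> rel n ''R'' s"
  assumes n: "nats s ''n'' 0 = n"
    and w: "\<And>r d. r \<le> n \<Longrightarrow> d < n \<Longrightarrow> reals s ''w'' (r * n + d) = x r (leader n R0 (x r) d)"
    and cz: "\<And>d. d \<le> n \<Longrightarrow> nats s ''cz'' d = row_size n R0 d"
    and Q: "\<And>t. (\<And>r d. r \<le> n \<Longrightarrow> d < n \<Longrightarrow>
        f (set_at n ''x'' ((r * n + d) * 2 * n) t) = ev n f (prefix_set n R0 (Collect (R r)) (x r) d) \<and>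
        f (set_at n ''x'' (((r * n + d) * 2 + 1) * n) t) =
          ev n f (prefix_set n R0 (Collect (R r)) (x r) d \<union> Collect (R0 d))) \<Longrightarrow>
      agree write_query_sets s t \<Longrightarrow> Q t"
  shows "quick (Suc (Suc (Suc (Suc 0)))) write_query_sets s Q"
proof -
  define ix where "ix = (\<lambda>r d c i. ((r * n + d) * 2 + c) * n + (i::nat))"
  show ?thesis
    unfolding write_query_sets_def
  proof (rule quick_for_par[where N = "n + 1" and Ks = "{..n} \<times> {..<n} \<times> {..<n}" and cls = fst
        and view = "\<lambda>(r, d, i) t. (nats t ''x'' (ix r d 0 i) \<noteq> 0, nats t ''x'' (ix r d 1 i) \<noteq> 0)"
        and E = "\<lambda>(r, d, i). (i \<in> prefix_set n R0 (Collect (R r)) (x r) d,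
          i \<in> prefix_set n R0 (Collect (R r)) (x r) d \<or> R0 d i)"], goal_cases)
    case (4 r s1)
    have s1: "nats s1 ''n'' 0 = n" "nats s1 ''R0'' = nats s ''R0''" "nats s1 ''R'' = nats s ''R''"
      "nats s1 ''cz'' = nats s ''cz''" "reals s1 ''w'' = reals s ''w''" "nats s1 ''r'' 0 = r"
      using agreeD[OF 4(3)] n 4(2) by (auto simp: prec_test_def Let_def)
    have rn: "r \<le> n" using 4(1) by simp
    show ?case
    \<comment> \<open>Entries of other bases receive the class \<open>n\<close>, beyond the range of
      the loop over \<open>d\<close>, so that this pass is required to leave them alone.\<close>
    proof (rule quick_for2[where ?N1.0 = n and ?N2.0 = n and Ks = "{..n} \<times> {..<n} \<times> {..<n}"
        and ?cls1.0 = "\<lambda>(r', d, i). if r' = r then d else n" and ?cls2.0 = "\<lambda>(r, d, i). i"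
        and view = "\<lambda>(r, d, i) t. (nats t ''x'' (ix r d 0 i) \<noteq> 0, nats t ''x'' (ix r d 1 i) \<noteq> 0)"
        and E = "\<lambda>(r, d, i). (i \<in> prefix_set n R0 (Collect (R r)) (x r) d,
          i \<in> prefix_set n R0 (Collect (R r)) (x r) d \<or> R0 d i)"], goal_cases)
      case (7 d i t)
      have t [simp]: "nats t ''n'' 0 = n" "nats t ''R0'' = nats s ''R0''" "nats t ''R'' = nats s ''R''"
        "nats t ''cz'' = nats s ''cz''" "reals t ''w'' = reals s ''w''" "nats t ''r'' 0 = r"
        "nats t ''d'' 0 = d" "nats t ''i'' 0 = i"
        using agreeD[OF 7(5)] s1 7(3,4) by auto
      let ?F = "\<lambda>m. R r i \<or> (\<exists>e<m. prec n R0 (x r) e d \<and> R0 e i)"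
      have F: "?F n \<longleftrightarrow> i \<in> prefix_set n R0 (Collect (R r)) (x r) d" by (auto simp: prefix_set_def)
      have Rri: "R r i \<longleftrightarrow> nats s ''R'' (r * (n + 2) + i) \<noteq> 0"
        unfolding R_def by (rule rel_iff) (use rn 7(2) in auto)
      have R0i: "R0 e i \<longleftrightarrow> nats s ''R0'' (e * (n + 2) + i) \<noteq> 0" if "e < n" for e
        unfolding R0_def by (rule rel_iff) (use that 7(2) in auto)
      show ?case
      proof (rule quick_seq, rule quick_nassign, rule quick_seq,
          rule quick_for_fold[where N = n and view = "\<lambda>t. nats t ''acc'' 0 \<noteq> 0" and F = ?F], goal_cases)
        case (5 e u)
        have u [simp]: "nats u ''n'' 0 = n" "nats u ''R0'' = nats s ''R0''" "nats u ''R'' = nats s ''R''"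
          "nats u ''cz'' = nats s ''cz''" "reals u ''w'' = reals s ''w''" "nats u ''r'' 0 = r"
          "nats u ''d'' 0 = d" "nats u ''i'' 0 = i"
          using agreeD[OF 5(4)] t by auto
        have "bval prec_test u \<longleftrightarrow> prec n R0 (x r) e d"
          using 5(1,3) 7(1) rn by (auto simp: prec_test_def Let_def prec_def w cz)
        moreover have "?F (Suc e) \<longleftrightarrow> ?F e \<or> prec n R0 (x r) e d \<and> R0 e i"
          by (auto simp: less_Suc_eq)
        ultimately show ?case
          by (intro quick_cond quick_nassign quick_skip) (use 5(2,3) R0i[OF 5(1)] in auto)
      next
        case (7 u)
        have [simp]: "nats u ''n'' 0 = n" "nats u ''R0'' = nats s ''R0''" "nats u ''x'' = nats t ''x''"
          "nats u ''r'' 0 = r" "nats u ''d'' 0 = d" "nats u ''i'' 0 = i"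
          using agreeD[OF 7(2)] t by auto
        note di = \<open>d < n\<close> \<open>i < n\<close>
        have acc: "nats u ''acc'' 0 \<noteq> 0 \<longleftrightarrow> i \<in> prefix_set n R0 (Collect (R r)) (x r) d"
          using 7(1) F by simp
        have idx: "ix r' d' c' i' = ix r d c i \<longleftrightarrow> r' = r \<and> d' = d \<and> c' = c \<and> i' = i"
          if "d' < n" "i' < n" "c < 2" "c' < 2" for r' d' c c' i'
          unfolding ix_def using that di by (simp only: index_eq_iff conj_assoc)
        show ?case
        proof (rule quick_seq, rule quick_nassign_eq[where a = "ix r d 0 i" and b = "nats u ''acc'' 0"], goal_cases)
          case 3
          show ?case
            by (rule quick_nassign_eq[where a = "ix r d 1 i" and b = "nats u ''acc'' 0 + nats s ''R0'' (d * (n + 2) + i)"])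
              (use acc R0i[OF di(1)] di in \<open>auto simp: idx, auto simp: ix_def\<close>)
        qed (auto simp: ix_def)
      qed (use Rri agree_n in auto)
    qed (use s1 agree_n in \<open>auto simp: prec_test_def Let_def\<close>)
  next
    case (6 t)
    show ?case
    proof (rule Q)
      fix r d assume rd: "r \<le> n" "d < n"
      let ?P = "prefix_set n R0 (Collect (R r)) (x r) d"
      have v: "(nats t ''x'' (((r * n + d) * 2) * n + i) \<noteq> 0 \<longleftrightarrow> i \<in> ?P) \<and>
          (nats t ''x'' (((r * n + d) * 2 + 1) * n + i) \<noteq> 0 \<longleftrightarrow> i \<in> ?P \<or> R0 d i)" if "i < n" for i
        using 6(1)[of "(r, d, i)"] rd that by (simp add: ix_def)
      have "set_at n ''x'' ((r * n + d) * 2 * n) t = ?P \<inter> {..<n}"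
        "set_at n ''x'' (((r * n + d) * 2 + 1) * n) t = (?P \<union> Collect (R0 d)) \<inter> {..<n}"
        unfolding set_at_def using v by blast+
      then show "f (set_at n ''x'' ((r * n + d) * 2 * n) t) = ev n f ?P \<and>
          f (set_at n ''x'' (((r * n + d) * 2 + 1) * n) t) = ev n f (?P \<union> Collect (R0 d))"
        by (simp add: ev_def)
    qed (use 6 in \<open>simp add: write_query_sets_def\<close>)
  qed (use n agree_n in \<open>auto simp: prec_test_def Let_def\<close>)
qed

end

definition mw_round :: com where
  "mw_round = Seq find_leaders (Seq write_query_sets
     (Seq (QueryRound ''x'' (NMul (NMul (NConst 2) (var ''n'')) succ_n) ''y'')
     (Seq marginals update_weights)))"

context query_model
begin

text \<open>The factor 2 covers a query round, which has program size 1 but may take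
  \<open>2 * n * (n + 1) + 1\<close> steps. The factor \<open>m\<close> counts passes of loops whose
  length is not bounded by \<open>n + 2\<close>.\<close>

definition slow :: "nat \<Rightarrow> nat \<Rightarrow> nat \<Rightarrow> com \<Rightarrow> state \<Rightarrow> (state \<Rightarrow> bool) \<Rightarrow> bool" where
  "slow j m D c s Q \<longleftrightarrow> runs c s (2 * com_size c * (n + 2) ^ j * m) D Q"

lemma slow_quick:
  assumes "quick j c s Q" "j \<le> j'" "1 \<le> m"
  shows "slow j' m D c s Q"
  unfolding slow_def
proof (rule runs_conseq[OF assms(1)[unfolded quick_def]])
  have "com_size c * (n + 2) ^ j * 1 \<le> 2 * com_size c * (n + 2) ^ j' * m"
    using assms(2,3) by (intro mult_le_mono power_increasing) auto
  then show "com_size c * (n + 2) ^ j \<le> 2 * com_size c * (n + 2) ^ j' * m" by simp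
qed auto

lemma slow_query:
  assumes "nval a s = m" "m \<le> 2 * n * (n + 1)" "2 \<le> j" "1 \<le> m'" "Q (answer_round n f x m y s)"
  shows "slow j m' 1 (QueryRound x a y) s Q"
  unfolding slow_def
proof (rule runs_conseq[OF runs_query[where Q = Q, OF assms(1,2,5)]])
  have "Suc m \<le> 2 * (n + 2) ^ 2 * 1" using assms(2) by (simp add: power2_eq_square)
  also have "\<dots> \<le> 2 * (n + 2) ^ j * m'" using assms(3,4) by (intro mult_le_mono power_increasing) auto
  finally show "Suc m \<le> 2 * com_size (QueryRound x a y) * (n + 2) ^ j * m'" by simp
qed auto

lemma slow_seq: "slow j m D c s (\<lambda>t. slow j m D' d t Q) \<Longrightarrow> slow j m (D + D') (Seq c d) s Q"
  unfolding slow_def using runs_seq[of c s _ D d _ D' Q] by (simp add: distrib_right distrib_left)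

lemma slow_mono:
  assumes "slow j m D c s P" "m \<le> m'" "D \<le> D'" "\<And>t. P t \<Longrightarrow> agree c s t \<Longrightarrow> Q t"
  shows "slow j m' D' c s Q"
  unfolding slow_def
  by (rule runs_conseq[OF assms(1)[unfolded slow_def]]) (use assms in auto)

lemma marginals:
  assumes n: "nats s ''n'' 0 = n"
    and Q: "\<And>t. (\<And>r d. r \<le> n \<Longrightarrow> d < n \<Longrightarrow> reals t ''g'' (r * n + d) =
        reals s ''y'' ((r * n + d) * 2 + 1) - reals s ''y'' ((r * n + d) * 2)) \<Longrightarrow>
      agree marginals s t \<Longrightarrow> Q t"
  shows "quick (Suc (Suc 0)) marginals s Q"
  unfolding marginals_def
proof (rule quick_for_rows[where view = "\<lambda>k t. reals t ''g'' (fst k * n + snd k)"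
      and E = "\<lambda>k. reals s ''y'' ((fst k * n + snd k) * 2 + 1) - reals s ''y'' ((fst k * n + snd k) * 2)"], goal_cases)
  case (7 i j t)
  have [simp]: "nats t ''n'' 0 = n" "reals t ''y'' = reals s ''y''"
    using agreeD[OF 7(5)] n by auto
  show ?case
    by (rule quick_rassign) (use 7(1-4) in \<open>auto simp: index_eq_iff\<close>)
next
  case (11 t)
  show ?case
  proof (rule Q)
    fix r d assume "r \<le> n" "d < n"
    then show "reals t ''g'' (r * n + d) =
        reals s ''y'' ((r * n + d) * 2 + 1) - reals s ''y'' ((r * n + d) * 2)"
      using 11(1)[of "(r, d)"] by simp
  qed (use 11 in \<open>simp add: marginals_def\<close>)
qed (use n agree_n in auto)

lemma update_weights:
  fixes s and R0 :: "nat \<Rightarrow> nat \<Rightarrow> bool" and G :: "nat \<Rightarrow> nat \<Rightarrow> real"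
  defines "x \<equiv> \<lambda>r. row_fun n ''z'' r s" and "ov \<equiv> \<lambda>r. row_fun n ''ov'' r s"
  defines "v \<equiv> \<lambda>r p. x r p * (1 - reals s ''eta'' 0 * charge n R0 (x r) (G r) p)"
  assumes n: "nats s ''n'' 0 = n"
    and pi: "\<And>r d. r \<le> n \<Longrightarrow> d < n \<Longrightarrow> nats s ''pi'' (r * n + d) = leader n R0 (x r) d"
    and g: "\<And>r d. r \<le> n \<Longrightarrow> d < n \<Longrightarrow> reals s ''g'' (r * n + d) = G r d"
    and Q: "\<And>t. (\<And>r. r \<le> n \<Longrightarrow>
        row_fun n ''z'' r t = (\<lambda>p. if p < n then min 1 (v r p) else 0) \<and>
        row_fun n ''ov'' r t = (\<lambda>p. if p < n then ov r p + max 0 (v r p - 1) else 0)) \<Longrightarrow>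
      agree update_weights s t \<Longrightarrow> Q t"
  shows "quick (Suc (Suc (Suc 0))) update_weights s Q"
  unfolding update_weights_def Let_def
proof (rule quick_for_rows[where view = "\<lambda>k t. (reals t ''z'' (fst k * n + snd k), reals t ''ov'' (fst k * n + snd k))"
      and E = "\<lambda>k. (min 1 (v (fst k) (snd k)), ov (fst k) (snd k) + max 0 (v (fst k) (snd k) - 1))"], goal_cases)
  case (7 r d t)
  note rd = 7(1,2)
  have t [simp]: "nats t ''n'' 0 = n" "nats t ''pi'' = nats s ''pi''" "reals t ''g'' = reals s ''g''"
    "reals t ''eta'' = reals s ''eta''" "nats t ''r'' 0 = r" "nats t ''d'' 0 = d"
    using agreeD[OF 7(5)] n 7(3,4) by auto
  have zt: "reals t ''z'' (r * n + d) = x r d" "reals t ''ov'' (r * n + d) = ov r d"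
    using 7(6)[of "(r, d)"] rd by (auto simp: x_def ov_def row_fun_def)
  let ?F = "\<lambda>m. \<Sum>q<m. if leader n R0 (x r) q = d \<and> 0 < G r q then G r q else 0"
  show ?case
  proof (rule quick_seq, rule quick_rassign, rule quick_seq,
      rule quick_for_fold[where N = n and view = "\<lambda>t. reals t ''racc'' 0" and F = ?F], goal_cases)
    case (5 q u)
    have u [simp]: "nats u ''n'' 0 = n" "nats u ''pi'' = nats s ''pi''" "reals u ''g'' = reals s ''g''"
      "nats u ''r'' 0 = r" "nats u ''d'' 0 = d"
      using agreeD[OF 5(4)] t by auto
    have "nats s ''pi'' (r * n + q) = leader n R0 (x r) q" "reals s ''g'' (r * n + q) = G r q"
      using pi g 5(1) rd by auto
    then show ?case
      by (intro quick_cond quick_rassign quick_skip) (use 5(2,3) in auto)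
  next
    case (7 u)
    have u [simp]: "nats u ''n'' 0 = n" "reals u ''g'' = reals s ''g''" "reals u ''eta'' = reals s ''eta''"
      "nats u ''r'' 0 = r" "nats u ''d'' 0 = d" "reals u ''z'' = reals t ''z''" "reals u ''ov'' = reals t ''ov''"
      using agreeD[OF 7(2)] t by auto
    have gd: "reals s ''g'' (r * n + d) = G r d" using g rd by auto
    have ch: "charge n R0 (x r) (G r) d = min (G r d) 0 + reals u ''racc'' 0" using 7(1) by (simp add: charge_def)
    show ?case
    proof (rule quick_seq, rule quick_conseq[where j = "Suc 0" and P = "\<lambda>u'. reals u' ''racc'' 0 = charge n R0 (x r) (G r) d \<and>
          (\<forall>y. y \<noteq> ''racc'' \<longrightarrow> reals u' y = reals u y) \<and> nats u' = nats u"], goal_cases)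
      case 1
      show ?case
        by (intro quick_cond quick_rassign quick_skip) (auto simp: gd ch)
    next
      case (3 u')
      then have u' [simp]: "reals u' ''racc'' 0 = charge n R0 (x r) (G r) d" "nats u' = nats u"
        "reals u' ''z'' = reals t ''z''" "reals u' ''ov'' = reals t ''ov''" "reals u' ''eta'' = reals s ''eta''"
        by auto
      show ?case
        by (intro quick_seq quick_cond quick_rassign)
          (use rd zt in \<open>auto simp: index_eq_iff v_def\<close>)
    qed simp
  qed (use agree_n in auto)
next
  case (11 t)
  show ?case
  proof (rule Q)
    fix r assume "r \<le> n"
    then show "row_fun n ''z'' r t = (\<lambda>p. if p < n then min 1 (v r p) else 0) \<and>
        row_fun n ''ov'' r t = (\<lambda>p. if p < n then ov r p + max 0 (v r p - 1) else 0)"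
      using 11(1)[of "(r, d)" for d] by (auto simp: row_fun_def)
  qed (use 11 in \<open>simp add: update_weights_def Let_def\<close>)
qed (use n agree_n in auto)

lemma mw_round:
  fixes s
  defines "R0 \<equiv> rel n ''R0'' s" and "R \<equiv> rel n ''R'' s"
  assumes n: "nats s ''n'' 0 = n"
    and cz: "\<And>d. d \<le> n \<Longrightarrow> nats s ''cz'' d = row_size n R0 d"
  shows "slow 4 1 1 mw_round s (\<lambda>t. \<forall>r\<le>n. (row_fun n ''z'' r t, row_fun n ''ov'' r t) =
      mw_step n f R0 (reals s ''eta'' 0) (Collect (R r)) (row_fun n ''z'' r s, row_fun n ''ov'' r s))"
proof -
  let ?x = "\<lambda>r. row_fun n ''z'' r s"
  let ?P = "\<lambda>r. prefix_set n R0 (Collect (R r)) (?x r)"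
  have "slow 4 1 (0 + (0 + (1 + (0 + 0)))) mw_round s (\<lambda>t. \<forall>r\<le>n. (row_fun n ''z'' r t, row_fun n ''ov'' r t) =
      mw_step n f R0 (reals s ''eta'' 0) (Collect (R r)) (row_fun n ''z'' r s, row_fun n ''ov'' r s))"
    unfolding mw_round_def
  proof (rule slow_seq, rule slow_quick, rule find_leaders[OF n], goal_cases)
    case (1 t1)
    note lead = 1(1)[folded R0_def]
    have t1: "nats t1 ''n'' 0 = n" "nats t1 ''R0'' = nats s ''R0''" "nats t1 ''R'' = nats s ''R''"
      "nats t1 ''cz'' = nats s ''cz''" "reals t1 ''z'' = reals s ''z''" "reals t1 ''ov'' = reals s ''ov''"
      "reals t1 ''eta'' = reals s ''eta''"
      using agreeD[OF 1(2)] n by (auto simp: find_leaders_def)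
    have rel1: "rel n ''R0'' t1 = R0" "rel n ''R'' t1 = R"
      unfolding R0_def R_def using t1 by (auto intro: rel_cong)
    show ?case
    proof (rule slow_seq, rule slow_quick, rule write_query_sets[where x = ?x], goal_cases)
      case (4 t2)
      have t2: "nats t2 ''n'' 0 = n" "nats t2 ''pi'' = nats t1 ''pi''"
        "reals t2 ''z'' = reals s ''z''" "reals t2 ''ov'' = reals s ''ov''"
        "reals t2 ''eta'' = reals s ''eta''"
        using agreeD[OF 4(2)] t1 by (auto simp: write_query_sets_def)
      show ?case
      proof (rule slow_seq, rule slow_query, rule refl, goal_cases _ _ _ answered)
        case answered
        let ?m = "nval (NMul (NMul (NConst 2) (var ''n'')) succ_n) t2"
        let ?t3 = "answer_round n f ''x'' ?m ''y'' t2"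
        have y: "reals ?t3 ''y'' j = f (set_at n ''x'' (j * n) t2)" if "j < 2 * n * (n + 1)" for j
          using that t2(1) by simp
        have ix: "(r * n + d) * 2 + c < 2 * n * (n + 1)" if "r \<le> n" "d < n" "c < 2" for r d c
        proof -
          have "r * n + d < (n + 1) * n" using that by (intro index_less) auto
          then have "(r * n + d) * 2 + c < ((n + 1) * n) * 2" by (rule index_less) (rule that(3))
          then show ?thesis by (simp add: algebra_simps)
        qed
        have y0: "reals ?t3 ''y'' ((r * n + d) * 2) = ev n f (?P r d)"
          and y1: "reals ?t3 ''y'' ((r * n + d) * 2 + 1) = ev n f (?P r d \<union> Collect (R0 d))"
          if "r \<le> n" "d < n" for r d
          using 4(1)[OF that, unfolded rel1] y[OF ix[OF that, of 0]] y[OF ix[OF that, of 1]]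
          by (simp_all del: reals_answer_round)
        show ?case
        proof (rule slow_seq, rule slow_quick, rule marginals, goal_cases)
          case (2 t4)
          have t4: "nats t4 ''n'' 0 = n" "nats t4 ''pi'' = nats t1 ''pi''"
            "reals t4 ''z'' = reals s ''z''" "reals t4 ''ov'' = reals s ''ov''"
            "reals t4 ''eta'' = reals s ''eta''"
            using agreeD[OF 2(2)] t2 by (auto simp: marginals_def)
          have rows: "row_fun n ''z'' r t4 = ?x r" "row_fun n ''ov'' r t4 = row_fun n ''ov'' r s" for r
            unfolding row_fun_def t4 by (rule refl)+
          have g: "reals t4 ''g'' (r * n + d) = marg n f R0 (Collect (R r)) (?x r) d" if "r \<le> n" "d < n" for r d
            unfolding 2(1)[OF that] y0[OF that] y1[OF that] marg_def ..
          show ?case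
          proof (rule slow_quick, rule update_weights[where ?R0.0 = R0 and G = "\<lambda>r. marg n f R0 (Collect (R r)) (?x r)"], goal_cases)
            case (2 r d)
            then show ?case using lead[of r d] t4 rows by simp
          next
            case (4 t5)
            show ?case
            proof (intro allI impI)
              fix r assume "r \<le> n"
              show "(row_fun n ''z'' r t5, row_fun n ''ov'' r t5) =
                mw_step n f R0 (reals s ''eta'' 0) (Collect (R r)) (row_fun n ''z'' r s, row_fun n ''ov'' r s)"
                using 4(1)[OF \<open>r \<le> n\<close>] unfolding mw_step_def Let_def rows t4 fst_conv snd_conv by simp
            qed
          qed (use g rows t4 in auto)
        qed (use t2 in auto)
      qed (use t2 in auto)
    qed (use t1 rel1 lead cz in auto)
  qed simp_all
  then show ?thesis by simp
qed

end

section \<open>Choosing targets and inserting arcs as programs\<close>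

definition find_targets :: com where
  "find_targets = For ''r'' succ_n
     (Seq (set_var ''acc'' (var ''r''))
     (Seq (Cond (NLess (NConst 0) (NCell ''lv'' (var ''r'')))
        (Seq (Cond (RLess (RDiv (rvar ''M'') (ROfNat (NConst 2)))
                (RSub (RCell ''u'' (var ''r'')) (RCell ''u'' (var ''n''))))
              (set_var ''acc'' succ_n) Skip)
           (For ''d'' (var ''n'')
              (Cond (RLess (ROfNat (NAdd (NConst 1) (NMul (NMul (NConst 3) (var ''kk'')) (var ''l''))))
                  (RCell ''ov'' (row_index (var ''r'') (var ''d''))))
                (set_var ''acc'' (var ''d'')) Skip)))
        Skip)
      (NAssign ''tg'' (var ''r'') (var ''acc''))))"

definition fill_rel :: "vname \<Rightarrow> nexp \<Rightarrow> com" where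
  "fill_rel Y v = For ''a'' (NAdd (var ''n'') (NConst 2)) (For ''b'' (NAdd (var ''n'') (NConst 2))
     (NAssign Y (NAdd (NMul (var ''a'') (NAdd (var ''n'') (NConst 2))) (var ''b'')) v))"

text \<open>The copy \<open>R1\<close> freezes the relation while \<open>R\<close> is being
  overwritten. The sum and the product stand for the disjunction and the conjunction in
  \<open>insert_arc\<close>.\<close>

definition insert_all :: com where
  "insert_all = For ''p'' succ_n
     (Seq (fill_rel ''R1'' (rel_cell ''R'' (var ''a'') (var ''b'')))
        (fill_rel ''R'' (NAdd (rel_cell ''R1'' (var ''a'') (var ''b''))
          (NMul (rel_cell ''R1'' (var ''a'') (var ''p''))
            (rel_cell ''R1'' (NCell ''tg'' (var ''p'')) (var ''b''))))))"

context query_model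
begin

lemma find_targets:
  fixes s
  defines "M \<equiv> reals s ''M'' 0"
  assumes n: "nats s ''n'' 0 = n" and kn: "nats s ''kk'' 0 = kn" and el: "nats s ''l'' 0 = el"
    and lv: "\<And>r. r \<le> n \<Longrightarrow> nats s ''lv'' r \<noteq> 0 \<longleftrightarrow> live n kn R r"
    and u: "\<And>r. r \<le> n \<Longrightarrow> reals s ''u'' r = ev n f (Collect (R r))"
    and ov: "\<And>r. r \<le> n \<Longrightarrow> row_fun n ''ov'' r s = snd (mw_run n kn f R0 (M) (Collect (R r)) (mw_rounds kn el))"
    and Q: "\<And>t. (\<And>r. r \<le> n \<Longrightarrow> nats t ''tg'' r = target n kn el f R0 (M) R r) \<Longrightarrow>
      agree find_targets s t \<Longrightarrow> Q t"
  shows "quick (Suc (Suc 0)) find_targets s Q"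
  unfolding find_targets_def
proof (rule quick_for_par[where N = "n + 1" and Ks = "{..n}" and cls = "\<lambda>r. r"
      and view = "\<lambda>r t. nats t ''tg'' r" and E = "target n kn el f R0 (M) R"], goal_cases)
  case (4 r t)
  have rn: "r \<le> n" using 4(1) by simp
  have t [simp]: "nats t ''n'' 0 = n" "nats t ''kk'' 0 = kn" "nats t ''l'' 0 = el" "nats t ''lv'' = nats s ''lv''"
    "nats t ''r'' 0 = r"
    using agree_nats[OF 4(3)] n kn el 4(2) by auto
  have [simp]: "reals t = reals s" by (rule ext, rule agree_reals[OF 4(3)]) simp
  let ?P = "\<lambda>d. real (mw_thr kn el) < snd (mw_run n kn f R0 (M) (Collect (R r)) (mw_rounds kn el)) d"
  let ?d = "if M / 2 < ev n f (Collect (R r)) - ev n f (Collect (R n)) then n + 1 else r"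
  have ovd: "reals s ''ov'' (r * n + d) = snd (mw_run n kn f R0 (M) (Collect (R r)) (mw_rounds kn el)) d"
    if "d < n" for d
    using fun_cong[OF ov[OF rn], of d] that by (simp add: row_fun_def)
  show ?case
  proof (rule quick_seq, rule quick_nassign, rule quick_seq,
      rule quick_conseq[where j = "Suc 0" and P = "\<lambda>u. nats u ''acc'' 0 = target n kn el f R0 (M) R r"], goal_cases)
    case 1
    let ?t = "set_nat ''acc'' (nval (NConst 0) t) (nval (var ''r'') t) t"
    show ?case
    proof (rule quick_cond, goal_cases)
      case 1
      then have lr: "live n kn R r" using lv[OF rn] by simp
      show ?case
      proof (rule quick_seq, rule quick_conseq[where j = "Suc 0" and P = "\<lambda>u. nats u ''acc'' 0 = ?d"], goal_cases)
        case 1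
        show ?case
          by (intro quick_cond quick_nassign quick_skip) (use u rn in \<open>auto simp: M_def\<close>)
      next
        case (3 v)
        have v [simp]: "nats v ''n'' 0 = n" "nats v ''kk'' 0 = kn" "nats v ''l'' 0 = el"
          "nats v ''r'' 0 = r"
          using agree_nats[OF 3(2)] by auto
        have [simp]: "reals v = reals s" by (rule ext, subst agree_reals[OF 3(2)]) simp_all
        show ?case
        proof (rule quick_for_fold[where N = n and view = "\<lambda>t. nats t ''acc'' 0" and F = "last_idx ?P ?d"], goal_cases)
          case (5 d w)
          have [simp]: "nats w ''n'' 0 = n" "nats w ''kk'' 0 = kn" "nats w ''l'' 0 = el"
            "nats w ''r'' 0 = r"
            using agree_nats[OF 5(4)] v by auto
          have [simp]: "reals w = reals s" by (rule ext, subst agree_reals[OF 5(4)]) simp_all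
          show ?case
            by (intro quick_cond quick_nassign quick_skip) (use 5(1-3) ovd[OF 5(1)] in \<open>auto simp: mw_thr_def\<close>)
        next
          case (7 w)
          then show ?case using lr by (simp add: target_def)
        qed (use 3(1) v agree_n in auto)
      qed simp
    next
      case 2
      then have "\<not> live n kn R r" using lv[OF rn] by simp
      then show ?case by (intro quick_skip) (simp add: target_def)
    qed
  next
    case (3 v)
    have [simp]: "nats v ''tg'' = nats t ''tg''" "nats v ''r'' 0 = r"
      using agree_nats[OF 3(2)] by auto
    show ?case by (rule quick_nassign) (use 3(1) in auto)
  qed simp
next
  case (6 t)
  show ?case
    by (rule Q) (use 6 in \<open>auto simp: find_targets_def\<close>)
qed (use n agree_n in auto)

lemma fill_rel:
  assumes n: "nats s ''n'' 0 = n" and Y: "Y \<notin> {''a'', ''b'', ''n''}"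
    and v: "\<And>a b t. a < n + 2 \<Longrightarrow> b < n + 2 \<Longrightarrow> nats t ''a'' 0 = a \<Longrightarrow> nats t ''b'' 0 = b \<Longrightarrow>
      (\<And>x. x \<notin> {Y, ''a'', ''b''} \<Longrightarrow> nats t x = nats s x) \<Longrightarrow> nval v t \<noteq> 0 \<longleftrightarrow> E a b"
    and E: "\<And>a b. E a b \<Longrightarrow> a < n + 2 \<and> b < n + 2"
    and Q: "\<And>t. rel n Y t = E \<Longrightarrow> agree (fill_rel Y v) s t \<Longrightarrow> Q t"
  shows "quick (Suc (Suc 0)) (fill_rel Y v) s Q"
  unfolding fill_rel_def
proof (rule quick_for2[where ?N1.0 = "n + 2" and ?N2.0 = "n + 2" and Ks = "{..<n+2} \<times> {..<n+2}" and ?cls1.0 = fst and ?cls2.0 = snd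
      and view = "\<lambda>k t. nats t Y (fst k * (n + 2) + snd k) \<noteq> 0" and E = "\<lambda>k. E (fst k) (snd k)"], goal_cases)
  case (7 i j t)
  have nt: "nats t ''n'' 0 = n" using agree_nats[OF 7(5), of "''n''"] n Y by auto
  have "nval v t \<noteq> 0 \<longleftrightarrow> E i j" by (rule v[OF 7(1-4)]) (use agree_nats[OF 7(5)] in auto)
  then show ?case
    by (intro quick_nassign) (use nt 7(1-4) in \<open>auto simp: index_eq_iff simp del: mult_Suc_right add_2_eq_Suc'\<close>)
next
  case (11 t)
  show ?case
  proof (rule Q)
    show "rel n Y t = E"
    proof (intro ext)
      fix a b
      show "rel n Y t a b = E a b"
        using 11(1)[of "(a, b)"] E[of a b] unfolding rel_def by auto
    qed
  qed (use 11 in \<open>simp add: fill_rel_def\<close>)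
qed (use n Y agree_n in auto)

lemma insert_all:
  fixes s
  assumes n: "nats s ''n'' 0 = n" and tg: "\<And>p. p \<le> n \<Longrightarrow> nats s ''tg'' p = tg p \<and> tg p < n + 2"
    and Q: "\<And>t. rel n ''R'' t = insert_arcs tg (n + 1) (rel n ''R'' s) \<Longrightarrow> agree insert_all s t \<Longrightarrow> Q t"
  shows "quick (Suc (Suc (Suc 0))) insert_all s Q"
  unfolding insert_all_def
proof (rule quick_for_fold[where N = "n + 1" and view = "rel n ''R''" and F = "\<lambda>m. insert_arcs tg m (rel n ''R'' s)"], goal_cases)
  case (5 p t)
  have t [simp]: "nats t ''n'' 0 = n" "nats t ''tg'' = nats s ''tg''"
    using agree_nats[OF 5(4)] n by (auto simp: fill_rel_def)
  have tgp: "nats s ''tg'' p = tg p" "tg p < n + 2" using tg[of p] 5(1) by auto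
  let ?R = "rel n ''R'' t"
  show ?case
  proof (rule quick_seq, rule fill_rel[where E = ?R], goal_cases)
    case (3 a b w)
    have "nats w ''R'' = nats t ''R''" "nats w ''n'' = nats t ''n''" using 3(5) by auto
    then show ?case using 3(1-4) by (simp add: rel_def)
  next
    case (5 w)
    have w [simp]: "nats w ''n'' 0 = n" "nats w ''tg'' = nats s ''tg''" "nats w ''p'' 0 = p"
      using agree_nats[OF 5(2)] t \<open>nats t ''p'' 0 = p\<close> by (auto simp: fill_rel_def)
    show ?case
    proof (rule fill_rel[where E = "insert_arc p (tg p) ?R"], goal_cases)
      case (3 a b q)
      have q: "nats q ''R1'' = nats w ''R1''" "nats q ''n'' 0 = n" "nats q ''p'' 0 = p" "nats q ''tg'' = nats s ''tg''"
        using 3(5) w by auto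
      have "nats q ''R1'' (a' * (n + 2) + b') \<noteq> 0 \<longleftrightarrow> ?R a' b'" if "a' < n + 2" "b' < n + 2" for a' b'
        unfolding q(1) 5(1)[symmetric] by (rule rel_iff[symmetric, OF that])
      from this[of a b] this[of a p] this[of "tg p" b]
      show ?case using 3(1-4) q tgp \<open>p < n + 1\<close> by (simp add: insert_arc_def)
    next
      case (4 a b)
      then show ?case by (auto simp: insert_arc_def rel_def)
    next
      case (5 q)
      then show ?case using \<open>?R = insert_arcs tg p (rel n ''R'' s)\<close> by simp
    qed simp_all
  qed (auto simp: rel_def)
next
  case (6 t v)
  show ?case by (rule rel_cong) simp
next
  case (7 t)
  show ?case by (rule Q) (use 7 in \<open>simp_all add: insert_all_def\<close>)
qed (use n agree_n in \<open>auto simp: fill_rel_def\<close>)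

end

section \<open>One round of arc insertion and one phase as programs\<close>

definition rounds_exp :: nexp where
  "rounds_exp = (let k = var ''kk'' in
     NMul (NMul (NConst 6400) (NMul (NMul (NMul k k) (NMul k k)) k)) (var ''l''))"

definition iteration :: com where
  "iteration = Seq (count_rows ''cr'' ''lv'') (Seq write_base_sets
     (Seq (QueryRound ''x'' succ_n ''u'')
     (Seq init_weights (Seq (For ''t'' rounds_exp mw_round) (Seq find_targets insert_all)))))"

definition phase_prog :: com where
  "phase_prog = Seq (fill_rel ''R0'' (rel_cell ''R'' (var ''a'') (var ''b'')))
     (Seq (count_rows ''cz'' ''lz'')
     (Seq (set_rvar ''eta'' (RDiv (ROfNat (NConst 1))
        (RMul (ROfNat (NMul (NConst 400) (NMul (NMul (var ''kk'') (var ''kk'')) (var ''kk'')))) (rvar ''M''))))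
     (Seq (For ''s'' (NAdd (var ''kk'') (NConst 1)) iteration)
        (set_rvar ''M'' (RDiv (rvar ''M'') (ROfNat (NConst 2)))))))"

lemma writes_simps [simp]:
  "nat_writes (count_rows ct lv) = {''a'', ''acc'', ''b'', ct, lv}" "real_writes (count_rows ct lv) = {}"
  "nat_writes write_base_sets = {''r'', ''i'', ''x''}" "real_writes write_base_sets = {}"
  "nat_writes init_weights = {''r'', ''d''}" "real_writes init_weights = {''z'', ''ov''}"
  "nat_writes mw_round = {''r'', ''d'', ''acc'', ''p'', ''pi'', ''i'', ''e'', ''x'', ''q''}"
  "real_writes mw_round = {''w'', ''y'', ''g'', ''racc'', ''ov'', ''z''}"
  "nat_writes find_targets = {''r'', ''acc'', ''d'', ''tg''}" "real_writes find_targets = {}"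
  "nat_writes (fill_rel Y v) = {''a'', ''b'', Y}" "real_writes (fill_rel Y v) = {}"
  "nat_writes insert_all = {''p'', ''a'', ''b'', ''R1'', ''R''}" "real_writes insert_all = {}"
  by (auto simp: count_rows_def write_base_sets_def init_weights_def mw_round_def find_leaders_def
      write_query_sets_def marginals_def update_weights_def find_targets_def fill_rel_def insert_all_def Let_def)

lemma iteration_writes [simp]:
  "nat_writes iteration = {''a'', ''acc'', ''b'', ''cr'', ''lv'', ''r'', ''i'', ''x'', ''d'', ''t'', ''p'', ''pi'', ''e'', ''q'', ''tg'', ''R1'', ''R''}"
  "real_writes iteration = {''u'', ''z'', ''ov'', ''w'', ''y'', ''g'', ''racc''}"
  by (auto simp: iteration_def)

lemma target_less: "r \<le> n \<Longrightarrow> target n kn el f R0 M R r < n + 2"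
  by (cases rule: last_idx_cases[of "\<lambda>d. real (mw_thr kn el) < overflow n kn el f R0 M (Collect (R r)) d"
        "if M / 2 < ev n f (Collect (R r)) - ev n f (Collect (R n)) then n + 1 else r" n])
    (auto simp: target_def)

lemma row_fun_set_nat [simp]: "row_fun n X r (set_nat x i v t) = row_fun n X r t"
  unfolding row_fun_def reals_set_nat ..

context query_model
begin

text \<open>The additional pass in \<open>N + 1\<close> and the three units of size that
  \<open>For\<close> adds to its body absorb the cost of the loop control.\<close>

lemma slow_for:
  assumes x: "x \<notin> nat_writes c" and e: "\<And>t. agree (For x e c) s t \<Longrightarrow> nval e t = N" and m: "1 \<le> m"
    and init: "I 0 s"
    and step: "\<And>i t. i < N \<Longrightarrow> I i t \<Longrightarrow> nats t x 0 = i \<Longrightarrow> agree (For x e c) s t \<Longrightarrow> slow j m D c t (I (Suc i))"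
    and indep: "\<And>i t v. I i t \<Longrightarrow> I i (set_nat x 0 v t)"
    and final: "\<And>t. I N t \<Longrightarrow> agree (For x e c) s t \<Longrightarrow> Q t"
  shows "slow j ((N + 1) * m) (N * D) (For x e c) s Q"
proof -
  let ?X = "(n + 2) ^ j * m"
  have "runs (For x e c) s (2 + N * (2 * com_size c * (n + 2) ^ j * m + 2)) (N * D) Q"
    by (rule runs_for[where I = I, OF x e init]) (use step indep final in \<open>auto simp: slow_def\<close>)
  moreover have "2 + N * (2 * com_size c * (n + 2) ^ j * m + 2)
      \<le> 2 * com_size (For x e c) * (n + 2) ^ j * ((N + 1) * m)"
  proof -
    have X: "1 \<le> ?X" using m by simp
    have "2 + N * (2 * com_size c * (n + 2) ^ j * m + 2) \<le> (N + 1) * (2 * com_size c * ?X + 2)"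
      by (simp add: algebra_simps)
    also have "\<dots> \<le> (N + 1) * (2 * com_size c * ?X + 6 * ?X)"
      using X by (intro mult_le_mono add_mono) auto
    also have "\<dots> = 2 * com_size (For x e c) * (n + 2) ^ j * ((N + 1) * m)" by (simp add: algebra_simps)
    finally show ?thesis .
  qed
  ultimately show ?thesis unfolding slow_def by (auto elim: runs_conseq)
qed

text \<open>One query round evaluates all \<open>n + 1\<close> rows, and every step of
  multiplicative weights takes one more, shared by all bases; hence
  \<open>mw_rounds kn el + 1\<close>.\<close>

lemma iteration:
  fixes s
  defines "R0 \<equiv> rel n ''R0'' s" and "R \<equiv> rel n ''R'' s" and "M \<equiv> reals s ''M'' 0"
  assumes n: "nats s ''n'' 0 = n" "1 \<le> n" and kn: "nats s ''kk'' 0 = kn" and el: "nats s ''l'' 0 = el"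
    and cz: "\<And>d. d \<le> n \<Longrightarrow> nats s ''cz'' d = row_size n R0 d"
    and lz: "\<And>d. d \<le> n \<Longrightarrow> nats s ''lz'' d \<noteq> 0 \<longleftrightarrow> live n kn R0 d"
    and eta: "reals s ''eta'' 0 = mw_rate kn M"
  shows "slow 4 (mw_rounds kn el + 1) (mw_rounds kn el + 1) iteration s
    (\<lambda>t. rel n ''R'' t = iterate n kn el f R0 M R)"
proof -
  let ?T = "mw_rounds kn el"
  have m: "1 \<le> ?T + 1" by simp
  have "slow 4 (?T + 1) (0 + (0 + (1 + (0 + (?T * 1 + (0 + 0)))))) iteration s
    (\<lambda>t. rel n ''R'' t = iterate n kn el f R0 M R)"
    unfolding iteration_def
  proof (rule slow_seq, rule slow_quick[OF _ _ m], rule count_rows[OF n(1) kn], goal_cases)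
    case (4 t1)
    have t1: "nats t1 ''n'' 0 = n" "nats t1 ''kk'' 0 = kn" "nats t1 ''l'' 0 = el" "nats t1 ''cz'' = nats s ''cz''"
      "nats t1 ''lz'' = nats s ''lz''" "nats t1 ''R0'' = nats s ''R0''" "nats t1 ''R'' = nats s ''R''"
      "reals t1 ''M'' = reals s ''M''" "reals t1 ''eta'' = reals s ''eta''"
      using agreeD[OF 4(2)] n kn el by auto
    have lv: "nats t1 ''lv'' r \<noteq> 0 \<longleftrightarrow> live n kn R r" if "r \<le> n" for r using 4(1)[OF that] R_def by simp
    have R1: "rel n ''R'' t1 = R" unfolding R_def using t1 by (auto intro: rel_cong)
    show ?case
    proof (rule slow_seq, rule slow_quick[OF _ _ m], rule write_base_sets, goal_cases)
      case (2 t2)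
      have t2: "nats t2 ''n'' 0 = n" "nats t2 ''kk'' 0 = kn" "nats t2 ''l'' 0 = el" "nats t2 ''cz'' = nats s ''cz''"
        "nats t2 ''lz'' = nats s ''lz''" "nats t2 ''R0'' = nats s ''R0''" "nats t2 ''R'' = nats s ''R''"
        "reals t2 ''M'' = reals s ''M''" "reals t2 ''eta'' = reals s ''eta''" "nats t2 ''lv'' = nats t1 ''lv''"
        using agreeD[OF 2(2)] t1 by auto
      show ?case
      proof (rule slow_seq, rule slow_query[OF _ _ _ m], rule refl, goal_cases)
        case 1
        have "n + 1 \<le> 2 * n * (n + 1)" using n(2) by simp
        then show ?case using t2(1) by simp
      next
        case 3
        let ?t3 = "answer_round n f ''x'' (nval succ_n t2) ''u'' t2"
        have t3: "nats ?t3 = nats t2" "reals ?t3 ''M'' = reals s ''M''" "reals ?t3 ''eta'' = reals s ''eta''"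
          using t2 by simp_all
        have u: "reals ?t3 ''u'' r = ev n f (Collect (R r))" if "r \<le> n" for r
          using that 2(1)[OF that] R1 t2(1) by simp
        show ?case
        proof (rule slow_seq, rule slow_quick[OF _ _ m], rule init_weights[where kn = kn and R = R0], goal_cases)
          case (3 t4)
          have t4: "nats t4 ''n'' 0 = n" "nats t4 ''kk'' 0 = kn" "nats t4 ''l'' 0 = el" "nats t4 ''cz'' = nats s ''cz''"
            "nats t4 ''R0'' = nats s ''R0''" "nats t4 ''R'' = nats s ''R''"
            "reals t4 ''M'' = reals s ''M''" "reals t4 ''eta'' = reals s ''eta''" "nats t4 ''lv'' = nats t1 ''lv''"
            "reals t4 ''u'' = reals ?t3 ''u''"
            using agreeD[OF 3(2)] t2 t3 by auto
          show ?case
          proof (rule slow_seq, rule slow_mono[where m = "(?T + 1) * 1" and D = "?T * 1" and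
                P = "\<lambda>t. \<forall>r\<le>n. (row_fun n ''z'' r t, row_fun n ''ov'' r t) = mw_run n kn f R0 M (Collect (R r)) ?T"],
              rule slow_for[where I = "\<lambda>i t. \<forall>r\<le>n. (row_fun n ''z'' r t, row_fun n ''ov'' r t) =
                mw_run n kn f R0 M (Collect (R r)) i"], goal_cases)
            case (2 t)
            have "nats t ''kk'' = nats t4 ''kk''" "nats t ''l'' = nats t4 ''l''" using agree_nats[OF 2] by auto
            moreover have "kn ^ 5 = kn * kn * (kn * kn) * kn"
              by (simp add: eval_nat_numeral)
            ultimately show ?case using t4 by (simp add: rounds_exp_def Let_def mw_rounds_def)
          next
            case 4
            then show ?case using \<open>\<And>r. r \<le> n \<Longrightarrow> (row_fun n ''z'' r t4, row_fun n ''ov'' r t4) = mw_init n kn R0\<close>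
              by (simp add: mw_run_def)
          next
            case (5 i t)
            have t: "nats t ''n'' 0 = n" "nats t ''cz'' = nats s ''cz''" "nats t ''R0'' = nats s ''R0''"
              "nats t ''R'' = nats s ''R''" "reals t ''eta'' = reals s ''eta''"
              using agreeD[OF 5(4)] t4 by auto
            have rels: "rel n ''R0'' t = R0" "rel n ''R'' t = R"
              unfolding R0_def R_def using t by (auto intro: rel_cong)
            show ?case
            proof (rule slow_mono[OF mw_round], goal_cases _ _ _ _ stepped)
              case (stepped t')
              show ?case
              proof (intro allI impI)
                fix r assume r: "r \<le> n"
                have "(row_fun n ''z'' r t', row_fun n ''ov'' r t') = mw_step n f R0 (mw_rate kn M) (Collect (R r))
                    (row_fun n ''z'' r t, row_fun n ''ov'' r t)"
                  using stepped(1) r unfolding rels t eta by blast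
                also have "(row_fun n ''z'' r t, row_fun n ''ov'' r t) = mw_run n kn f R0 M (Collect (R r)) i"
                  using 5(2) r by blast
                finally show "(row_fun n ''z'' r t', row_fun n ''ov'' r t') = mw_run n kn f R0 M (Collect (R r)) (Suc i)"
                  by (simp add: mw_run_def)
              qed
            qed (use t rels cz in auto)
          next
            case (6 i t v)
            then show ?case by simp
          next
            case (7 t)
            show ?case by (rule 7(1))
          next
            case (10 t5)
            note run = 10(1)
            have t5: "nats t5 ''n'' 0 = n" "nats t5 ''kk'' 0 = kn" "nats t5 ''l'' 0 = el"
              "nats t5 ''R'' = nats s ''R''" "reals t5 ''M'' = reals s ''M''" "nats t5 ''lv'' = nats t1 ''lv''"
              "reals t5 ''u'' = reals ?t3 ''u''"
              using agreeD[OF 10(2)] t4 by auto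
            show ?case
            proof (rule slow_seq, rule slow_quick[OF _ _ m], rule find_targets[where kn = kn and el = el and R = R and ?R0.0 = R0], goal_cases)
              case (6 r)
              then show ?case using run t5 by (metis M_def snd_conv)
            next
              case (7 t6)
              have t6: "nats t6 ''n'' 0 = n" "nats t6 ''R'' = nats s ''R''" using agree_nats[OF 7(2)] t5 by auto
              have "rel n ''R'' t6 = R" unfolding R_def using t6 by (auto intro: rel_cong)
              show ?case
              proof (rule slow_quick[OF _ _ m], rule insert_all[where tg = "target n kn el f R0 M R"], goal_cases)
                case (2 p)
                then show ?case using 7(1) t5 target_less[of p n] by (simp add: M_def)
              next
                case (3 t7)
                then show ?case using \<open>rel n ''R'' t6 = R\<close> by (simp add: iterate_def)
              qed (use t6 in auto)
            qed (use t5 lv u in auto)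
          qed auto
        qed (use t2 t3 lz in auto)
      qed simp_all
    qed (use t1 in auto)
  qed auto
  then show ?thesis by (simp add: add.commute)
qed

end

section \<open>Setup, main loop and output\<close>

definition init_rel :: "nat \<Rightarrow> nat \<Rightarrow> nat \<Rightarrow> bool" where
  "init_rel n = (\<lambda>a b. a < n + 2 \<and> b < n + 2 \<and> (a = b \<or> b = n))"

text \<open>As \<open>|f|\<close> is not part of the input, the first scale is obtained from
  queries. The last prefix \<open>{..n - 1}\<close> is the whole ground set, whose value is used in
  \<open>init_inv\<close> to bound the least value of \<open>f\<close> from below.\<close>

definition init_scale :: "nat \<Rightarrow> (nat set \<Rightarrow> real) \<Rightarrow> real" where
  "init_scale n f = (\<Sum>p<n. \<bar>f {p}\<bar> + \<bar>f {..p}\<bar>)"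

text \<open>There is no logarithm to call, so \<open>l\<close> counts the doublings of
  \<open>pw\<close> until it reaches \<open>n\<close>. Capping the sparsity at \<open>n\<close>
  makes the step count polynomial in \<open>n\<close> whatever \<open>k\<close> is.\<close>

definition set_params :: com where
  "set_params = Seq (Cond (NLess (var ''k'') (var ''n''))
        (set_var ''kk'' (var ''k'')) (set_var ''kk'' (var ''n'')))
     (Seq (set_var ''pw'' (NConst 1)) (Seq (set_var ''l'' (NConst 1))
     (For ''i'' (var ''n'') (Cond (NLess (var ''pw'') (var ''n''))
        (Seq (set_var ''pw'' (NMul (NConst 2) (var ''pw'')))
           (set_var ''l'' (NAdd (var ''l'') (NConst 1)))) Skip))))"

text \<open>With truncated subtraction, \<open>1 - ((i - p) + (p - i))\<close> is the indicator of
  \<open>i = p\<close>, and \<open>1 - (i - p)\<close> is that of \<open>i \<le> p\<close>.\<close>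

definition write_init_sets :: com where
  "write_init_sets = For ''p'' (var ''n'') (For ''i'' (var ''n'')
     (Seq (NAssign ''x'' (row_index (var ''p'') (var ''i''))
        (NSub (NConst 1) (NAdd (NSub (var ''i'') (var ''p'')) (NSub (var ''p'') (var ''i'')))))
      (NAssign ''x'' (row_index (NAdd (var ''n'') (var ''p'')) (var ''i''))
        (NSub (NConst 1) (NSub (var ''i'') (var ''p''))))))"

definition add_abs :: "nexp \<Rightarrow> com" where
  "add_abs j = (let m = rvar ''M''; y = RCell ''y'' j in Cond (RLess y (ROfNat (NConst 0)))
     (set_rvar ''M'' (RSub m y)) (set_rvar ''M'' (RAdd m y)))"

definition sum_abs :: com where
  "sum_abs = Seq (set_rvar ''M'' (ROfNat (NConst 0)))
     (For ''i'' (var ''n'') (Seq (add_abs (var ''i'')) (add_abs (NAdd (var ''n'') (var ''i'')))))"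

definition setup_prog :: com where
  "setup_prog = Seq set_params (Seq write_init_sets
     (Seq (QueryRound ''x'' (NMul (NConst 2) (var ''n'')) ''y'') (Seq sum_abs
     (fill_rel ''R'' (NAdd
        (NSub (NConst 1) (NAdd (NSub (var ''a'') (var ''b'')) (NSub (var ''b'') (var ''a''))))
        (NSub (NConst 1) (NAdd (NSub (var ''n'') (var ''b'')) (NSub (var ''b'') (var ''n'')))))))))"

definition output_prog :: com where
  "output_prog = For ''i'' (var ''n'') (NAssign ''out'' (var ''i'') (rel_cell ''R'' (var ''n'') (var ''i'')))"

definition phases_prog :: com where
  "phases_prog = While (RLess (rvar ''eps'') (rvar ''M'')) phase_prog"

definition main_prog :: com where
  "main_prog = Seq setup_prog (Seq phases_prog output_prog)"

lemma power2_less_imp: "2 ^ m < 2 * (n::nat) \<Longrightarrow> real m \<le> log 2 (real n + 2) + 1"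
proof -
  assume "2 ^ m < 2 * n"
  then have "real (2 ^ m) \<le> real (2 * n)" by (simp only: of_nat_le_iff)
  then have "(2::real) ^ m \<le> 2 * (real n + 2)" by simp
  then have "log 2 (2 ^ m) \<le> log 2 (2 * (real n + 2))" by (subst log_le_cancel_iff) auto
  also have "\<dots> = log 2 (real n + 2) + 1" by (subst log_mult) auto
  finally show ?thesis by simp
qed

context query_model
begin

lemma phase_prog:
  fixes s
  defines "M \<equiv> reals s ''M'' 0"
  assumes n: "nats s ''n'' 0 = n" "1 \<le> n" and kn: "nats s ''kk'' 0 = kn" and el: "nats s ''l'' 0 = el"
  shows "slow 4 ((kn + 2) * (mw_rounds kn el + 1)) ((kn + 1) * (mw_rounds kn el + 1)) phase_prog s
    (\<lambda>t. rel n ''R'' t = phase n kn el f M (rel n ''R'' s) \<and> reals t ''M'' 0 = M / 2)"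
proof -
  let ?T = "mw_rounds kn el"
  let ?m = "(kn + 2) * (?T + 1)"
  let ?R = "rel n ''R'' s"
  have m: "1 \<le> ?m" by simp
  have "slow 4 ?m (0 + (0 + (0 + ((kn + 1) * (?T + 1) + 0)))) phase_prog s
    (\<lambda>t. rel n ''R'' t = phase n kn el f M (rel n ''R'' s) \<and> reals t ''M'' 0 = M / 2)"
    unfolding phase_prog_def
  proof (rule slow_seq, rule slow_quick[OF _ _ m], rule fill_rel[where E = ?R], goal_cases)
    case (3 a b t)
    have "nats t ''R'' = nats s ''R''" "nats t ''n'' = nats s ''n''" using 3(5) by auto
    then show ?case using 3(1-4) n by (simp add: rel_def)
  next
    case (5 t1)
    have t1: "nats t1 ''n'' 0 = n" "nats t1 ''kk'' 0 = kn" "nats t1 ''l'' 0 = el" "nats t1 ''R'' = nats s ''R''"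
      "reals t1 ''M'' = reals s ''M''"
      using agreeD[OF 5(2)] n kn el by auto
    have R1: "rel n ''R'' t1 = ?R" using t1 by (auto intro: rel_cong)
    show ?case
    proof (rule slow_seq, rule slow_quick[OF _ _ m], rule count_rows[OF t1(1,2)], goal_cases)
      case (4 t2)
      note cz = 4(1)[unfolded R1]
      have t2: "nats t2 ''n'' 0 = n" "nats t2 ''kk'' 0 = kn" "nats t2 ''l'' 0 = el" "nats t2 ''R'' = nats s ''R''"
        "nats t2 ''R0'' = nats t1 ''R0''" "reals t2 ''M'' = reals s ''M''"
        using agreeD[OF 4(2)] t1 by auto
      have R2: "rel n ''R'' t2 = ?R" "rel n ''R0'' t2 = ?R"
        using t2 5(1) rel_cong[of t2 "''R0''" t1 "''R0''" n] by (auto intro: rel_cong)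
      show ?case
      proof (rule slow_seq, rule slow_quick[OF _ _ m, where j = 0], rule quick_rassign, goal_cases)
        case 1
        define t3 where "t3 = set_real ''eta'' (nval (NConst 0) t2) (rval (RDiv (ROfNat (NConst 1))
          (RMul (ROfNat (NMul (NConst 400) (NMul (NMul (var ''kk'') (var ''kk'')) (var ''kk'')))) (rvar ''M''))) t2) t2"
        have nt3: "nats t3 = nats t2" and Mt3: "reals t3 ''M'' = reals s ''M''"
          and eta: "reals t3 ''eta'' 0 = mw_rate kn M"
          using t2 by (simp_all add: t3_def mw_rate_def M_def power3_eq_cube mult_ac)
        have R3: "rel n ''R'' t3 = ?R" "rel n ''R0'' t3 = ?R"
          using R2 nt3 by (auto simp: rel_def)
        show ?case
          unfolding t3_def[symmetric]
        proof (rule slow_seq, rule slow_mono[where m = "(kn + 1 + 1) * (?T + 1)" and D = "(kn + 1) * (?T + 1)"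
                and P = "\<lambda>t. rel n ''R'' t = (iterate n kn el f ?R M ^^ (kn + 1)) ?R"],
              rule slow_for[where I = "\<lambda>i t. rel n ''R'' t = (iterate n kn el f ?R M ^^ i) ?R"], goal_cases)
          case (2 t)
          then show ?case using agree_nats[OF 2, of "''kk''"] nt3 t2 by simp
        next
          case (5 i t)
          have t: "nats t ''n'' 0 = n" "nats t ''kk'' 0 = kn" "nats t ''l'' 0 = el" "nats t ''R0'' = nats t3 ''R0''"
            "nats t ''cz'' = nats t2 ''cz''" "nats t ''lz'' = nats t2 ''lz''"
            "reals t ''M'' = reals s ''M''" "reals t ''eta'' 0 = mw_rate kn M"
            using agreeD[OF 5(4)] nt3 Mt3 eta t2 by auto
          have R0: "rel n ''R0'' t = ?R" using t(4) R3(2) rel_cong by metis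
          show ?case
          proof (rule slow_mono[OF iteration[OF t(1) n(2) t(2,3)]], goal_cases)
            case (6 t')
            then show ?case using 5(2) R0 t by (simp add: M_def)
          qed (use t R0 cz M_def in auto)
        next
          case (6 i t v)
          have "rel n ''R'' (set_nat ''s'' 0 v t) = rel n ''R'' t" by (rule rel_cong) simp
          then show ?case using 6 by simp
        next
          case (7 t)
          then show ?case by simp
        next
          case (10 t4)
          have M4: "reals t4 ''M'' = reals s ''M''" using agree_reals[OF 10(2)] Mt3 by auto
          show ?case
            by (rule slow_quick[OF quick_rassign _ m, where j = 0])
              (use 10(1) M4 in \<open>auto simp: phase_def M_def rel_def\<close>)
        qed (use R3 in auto)
      qed simp
    qed simp_all
  qed (use n in \<open>auto simp: rel_def\<close>)
  then show ?thesis by simp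
qed

lemma set_params:
  assumes n: "nats s ''n'' 0 = n" and k: "nats s ''k'' 0 = k"
    and Q: "\<And>t. nats t ''kk'' 0 = min k n \<Longrightarrow> 1 \<le> nats t ''l'' 0 \<Longrightarrow> ln (real n) \<le> real (nats t ''l'' 0) \<Longrightarrow>
      real (nats t ''l'' 0) \<le> log 2 (real n + 2) + 2 \<Longrightarrow> agree set_params s t \<Longrightarrow> Q t"
  shows "quick (Suc 0) set_params s Q"
  unfolding set_params_def
proof (rule quick_seq, rule quick_conseq[where j = "Suc 0" and P = "\<lambda>t. nats t ''kk'' 0 = min k n \<and> nats t ''n'' 0 = n"], goal_cases)
  case 1
  show ?case by (intro quick_cond quick_nassign) (use n k in auto)
next
  case (3 t1)
  note t1 = 3(1)
  \<comment> \<open>As long as \<open>pw\<close> is below \<open>n\<close>, every pass so far has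
    doubled it. If this were still so after \<open>n\<close> passes, then \<open>2^n < n\<close>.
    The clause \<open>2^m < 2 * n\<close> says that the last doubling started below
    \<open>n\<close>, and bounds \<open>l\<close> from above.\<close>
  let ?I = "\<lambda>i t. \<exists>m. nats t ''l'' 0 = m + 1 \<and> nats t ''pw'' 0 = 2 ^ m \<and> (m = 0 \<or> 2 ^ m < 2 * n) \<and>
      (nats t ''pw'' 0 < n \<longrightarrow> m = i)"
  show ?case
  proof (rule quick_seq, rule quick_nassign, rule quick_seq, rule quick_nassign,
      rule quick_for[where N = n and I = ?I], goal_cases)
    case (5 i t)
    have nt: "nats t ''n'' 0 = n" using agree_nats[OF 5(4)] t1 by auto
    show ?case
      by (intro quick_cond quick_seq quick_nassign quick_skip) (use 5(2) nt in \<open>auto intro!: exI[of _ "Suc _"]\<close>)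
  next
    case (7 t)
    have t: "nats t ''kk'' 0 = min k n" using agree_nats[OF 7(2)] t1 by auto
    obtain m where m: "nats t ''l'' 0 = m + 1" "nats t ''pw'' 0 = 2 ^ m" "m = 0 \<or> 2 ^ m < 2 * n"
      "nats t ''pw'' 0 < n \<longrightarrow> m = n" using 7(1) by blast
    have nm: "n \<le> 2 ^ m"
    proof (rule ccontr)
      assume "\<not> n \<le> 2 ^ m"
      then have "2 ^ n < n" using m by simp
      then show False using less_exp[of n] by simp
    qed
    show ?case
    proof (rule Q[OF t], goal_cases)
      case 2
      show ?case
      proof (cases "n = 0")
        case False
        have "real n \<le> real (2 ^ m)" using nm by (simp only: of_nat_le_iff)
        then have "real n \<le> 2 ^ m" by simp
        then have "ln (real n) \<le> ln (2 ^ m)" using False by (subst ln_le_cancel_iff) auto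
        also have "\<dots> = real m * ln 2" by (simp add: ln_realpow)
        also have "\<dots> \<le> real m * 1" using ln_2_less_1 by (intro mult_left_mono) auto
        finally show ?thesis using m(1) by simp
      qed simp
    next
      case 3
      have "real m \<le> log 2 (real n + 2) + 1"
      proof (cases "m = 0")
        case True
        have "0 \<le> log 2 (real n + 2)" by simp
        then show ?thesis using True by simp
      qed (use m(3) power2_less_imp[of m n] in simp)
      then show ?case using m(1) by simp
    next
      case 4
      have a: "agree set_params s t1" by (rule agree_mono[OF 3(2)]) (auto simp: set_params_def)
      note c = agree_mono[OF 7(2), of set_params]
      show ?case
        by (rule agree_trans[OF a], rule agree_trans[OF _ c]) (auto simp: agree_def set_params_def)
    qed (use m(1) in simp)
  qed (use t1 agree_n in auto)
qed simp

lemma write_init_sets: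
  assumes n: "nats s ''n'' 0 = n"
    and Q: "\<And>t. (\<And>p. p < n \<Longrightarrow> f (set_at n ''x'' (p * n) t) = f {p} \<and> f (set_at n ''x'' ((n + p) * n) t) = f {..p}) \<Longrightarrow>
      agree write_init_sets s t \<Longrightarrow> Q t"
  shows "quick (Suc (Suc 0)) write_init_sets s Q"
  unfolding write_init_sets_def
proof (rule quick_for2[where ?N1.0 = n and ?N2.0 = n and Ks = "{..<n} \<times> {..<n}" and ?cls1.0 = fst and ?cls2.0 = snd
      and view = "\<lambda>k t. (nats t ''x'' (fst k * n + snd k) \<noteq> 0, nats t ''x'' ((n + fst k) * n + snd k) \<noteq> 0)"
      and E = "\<lambda>k. (snd k = fst k, snd k \<le> fst k)"], goal_cases)
  case (7 p i t)
  have nt: "nats t ''n'' 0 = n" using agree_nats[OF 7(5)] n by auto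
  have ix: "p' * n + i' = p * n + i \<longleftrightarrow> p' = p \<and> i' = i" "(n + p') * n + i' = (n + p) * n + i \<longleftrightarrow> p' = p \<and> i' = i"
    "p' * n + i' \<noteq> (n + p) * n + i" "(n + p') * n + i' \<noteq> p * n + i"
    if "p' < n" "i' < n" for p' i'
    using that 7(1,2) by (simp_all only: index_eq_iff) auto
  show ?case
    by (rule quick_seq, rule quick_nassign, rule quick_nassign)
      (use 7(1-4) nt ix in \<open>auto simp del: add_mult_distrib\<close>)
next
  case (11 t)
  show ?case
  proof (rule Q)
    fix p assume p: "p < n"
    have v: "(nats t ''x'' (p * n + i) \<noteq> 0 \<longleftrightarrow> i = p) \<and> (nats t ''x'' ((n + p) * n + i) \<noteq> 0 \<longleftrightarrow> i \<le> p)" if "i < n" for i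
      using 11(1)[of "(p, i)"] p that by simp
    have "set_at n ''x'' (p * n) t = {p}" "set_at n ''x'' ((n + p) * n) t = {..p}"
      unfolding set_at_def using v p by force+
    then show "f (set_at n ''x'' (p * n) t) = f {p} \<and> f (set_at n ''x'' ((n + p) * n) t) = f {..p}" by simp
  qed (use 11 in \<open>simp add: write_init_sets_def\<close>)
qed (use n agree_n in auto)

lemma sum_abs:
  assumes n: "nats s ''n'' 0 = n" and y: "\<And>p. p < n \<Longrightarrow> reals s ''y'' p = f {p} \<and> reals s ''y'' (n + p) = f {..p}"
    and Q: "\<And>t. reals t ''M'' 0 = init_scale n f \<Longrightarrow> agree sum_abs s t \<Longrightarrow> Q t"
  shows "quick (Suc 0) sum_abs s Q"
  unfolding sum_abs_def
proof (rule quick_seq, rule quick_rassign,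
    rule quick_for_fold[where N = n and view = "\<lambda>t. reals t ''M'' 0" and F = "\<lambda>m. \<Sum>p<m. \<bar>f {p}\<bar> + \<bar>f {..p}\<bar>"], goal_cases)
  case (5 p t)
  have t [simp]: "nats t ''n'' 0 = n" "reals t ''y'' = reals s ''y''"
    using agreeD[OF 5(4)] n by (auto simp: add_abs_def Let_def)
  show ?case
    unfolding add_abs_def Let_def
    by (intro quick_seq quick_cond quick_rassign) (use 5(1-3) y[OF 5(1)] in auto)
next
  case (7 t)
  show ?case
    by (rule Q) (use 7 in \<open>auto simp: init_scale_def agree_def sum_abs_def add_abs_def Let_def\<close>)
qed (use n agree_n in \<open>auto simp: add_abs_def Let_def\<close>)

end

lemma prog_writes [simp]:
  "nat_writes set_params = {''kk'', ''pw'', ''l'', ''i''}" "real_writes set_params = {}"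
  "nat_writes write_init_sets = {''p'', ''i'', ''x''}" "real_writes write_init_sets = {}"
  "nat_writes sum_abs = {''i''}" "real_writes sum_abs = {''M''}"
  "nat_writes phase_prog = insert ''R0'' (insert ''cz'' (insert ''lz'' (insert ''s'' (nat_writes iteration))))"
  "real_writes phase_prog = insert ''eta'' (insert ''M'' (real_writes iteration))"
  "nat_writes output_prog = {''i'', ''out''}" "real_writes output_prog = {}"
  by (auto simp: set_params_def write_init_sets_def sum_abs_def add_abs_def Let_def phase_prog_def output_prog_def)

context query_model
begin

lemma setup_prog:
  assumes n: "nats s ''n'' 0 = n" and k: "nats s ''k'' 0 = k"
  shows "slow 2 1 1 setup_prog s (\<lambda>t. nats t ''n'' 0 = n \<and> reals t ''eps'' = reals s ''eps'' \<and>
    nats t ''kk'' 0 = min k n \<and> 1 \<le> nats t ''l'' 0 \<and> ln (real n) \<le> real (nats t ''l'' 0) \<and>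
    real (nats t ''l'' 0) \<le> log 2 (real n + 2) + 2 \<and> reals t ''M'' 0 = init_scale n f \<and> rel n ''R'' t = init_rel n)"
    (is "slow 2 1 1 setup_prog s ?Q")
proof -
  have "slow 2 1 (0 + (0 + (1 + (0 + 0)))) setup_prog s ?Q"
    unfolding setup_prog_def
  proof (rule slow_seq, rule slow_quick, rule set_params[OF n k], goal_cases)
    case (1 t1)
    have t1: "nats t1 ''n'' 0 = n" "reals t1 ''eps'' = reals s ''eps''"
      using agreeD[OF 1(5)] n by auto
    show ?case
    proof (rule slow_seq, rule slow_quick, rule write_init_sets, goal_cases)
      case (2 t2)
      have t2: "nats t2 ''n'' 0 = n" "reals t2 ''eps'' = reals s ''eps''" "nats t2 ''kk'' = nats t1 ''kk''"
        "nats t2 ''l'' = nats t1 ''l''"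
        using agreeD[OF 2(2)] t1 by auto
      show ?case
      proof (rule slow_seq, rule slow_query, rule refl, goal_cases)
        case 1
        have "2 * n \<le> 2 * n * (n + 1)" by simp
        then show ?case using t2(1) by simp
      next
        case 4
        let ?t3 = "answer_round n f ''x'' (nval (NMul (NConst 2) (var ''n'')) t2) ''y'' t2"
        show ?case
        proof (rule slow_seq, rule slow_quick, rule sum_abs, goal_cases)
          case (2 p)
          then show ?case using \<open>\<And>p. p < n \<Longrightarrow> f (set_at n ''x'' (p * n) t2) = f {p} \<and> f (set_at n ''x'' ((n + p) * n) t2) = f {..p}\<close>[OF 2] t2
            by (simp del: add_mult_distrib)
        next
          case (3 t4)
          have t4: "nats t4 ''n'' 0 = n" "reals t4 ''eps'' = reals s ''eps''" "nats t4 ''kk'' = nats t1 ''kk''"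
            "nats t4 ''l'' = nats t1 ''l''"
            using agreeD[OF 3(2)] t2 by auto
          show ?case
          proof (rule slow_quick, rule fill_rel[where E = "init_rel n"], goal_cases)
            case (3 a b t)
            have "nats t ''n'' 0 = n" using 3(5) t4 by auto
            then show ?case using 3(1-4) by (auto simp: init_rel_def)
          next
            case (5 t5)
            have t5: "nats t5 ''n'' 0 = n" "reals t5 ''eps'' = reals s ''eps''" "nats t5 ''kk'' = nats t1 ''kk''"
              "nats t5 ''l'' = nats t1 ''l''" "reals t5 ''M'' = reals t4 ''M''"
              using agreeD[OF 5(2)] t4 by auto
            show ?case using t5 1(1-4) 5(1) 3(1) by simp
          qed (use t4 in \<open>auto simp: init_rel_def\<close>)
        qed (use t2 in auto)
      qed simp_all
    qed (use t1 in auto)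
  qed simp_all
  then show ?thesis by simp
qed

lemma output_prog:
  assumes n: "nats s ''n'' 0 = n"
  shows "quick (Suc 0) output_prog s (\<lambda>t. output_set n t = Collect (rel n ''R'' s n) \<inter> {..<n})"
  unfolding output_prog_def
proof (rule quick_for_par[where N = n and Ks = "{..<n}" and cls = "\<lambda>i. i"
      and view = "\<lambda>i t. nats t ''out'' i" and E = "\<lambda>i. nats s ''R'' (n * (n + 2) + i)"], goal_cases)
  case (4 i t)
  have [simp]: "nats t ''n'' 0 = n" "nats t ''R'' = nats s ''R''" using agree_nats[OF 4(3)] n by auto
  show ?case by (rule quick_nassign) (use 4(1,2) in auto)
next
  case (6 t)
  then show ?case by (auto simp: output_set_def set_at_def rel_def)
qed (use n agree_n in auto)

text \<open>The number \<open>J\<close> bounds the remaining halvings. When the test fails,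
  \<open>M \<le> \<epsilon>\<close>, and the first half of \<open>scale_inv\<close> is the required
  approximation for the root row.\<close>

lemma phase_loop:
  assumes sp: "sparse_submodular n kn f S" and l: "1 \<le> el" "ln (real n) \<le> real el" and eps: "0 < \<epsilon>"
  shows "nats s ''n'' 0 = n \<Longrightarrow> nats s ''kk'' 0 = kn \<Longrightarrow> nats s ''l'' 0 = el \<Longrightarrow> reals s ''eps'' 0 = \<epsilon> \<Longrightarrow>
    arc_rel n S (rel n ''R'' s) \<Longrightarrow> scale_inv n kn f S (reals s ''M'' 0) (rel n ''R'' s) \<Longrightarrow>
    reals s ''M'' 0 \<le> 2 ^ J * \<epsilon> \<Longrightarrow>
    runs phases_prog s
      (1 + J * (2 * com_size phase_prog * (n + 2) ^ 4 * ((kn + 2) * (mw_rounds kn el + 1)) + 1))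
      (J * ((kn + 1) * (mw_rounds kn el + 1)))
      (\<lambda>t. nats t ''n'' 0 = n \<and> ev n f (Collect (rel n ''R'' t n)) - f S \<le> \<epsilon>)"
proof (induction J arbitrary: s)
  case 0
  let ?Q = "\<lambda>t. nats t ''n'' 0 = n \<and> ev n f (Collect (rel n ''R'' t n)) - f S \<le> \<epsilon>"
  have M: "reals s ''M'' 0 \<le> \<epsilon>" using 0 by simp
  have "runs phases_prog s 1 0 ?Q"
  proof (unfold phases_prog_def, rule runs_while_false)
    show "\<not> bval (RLess (rvar ''eps'') (rvar ''M'')) s" using M 0 by simp
    show "?Q s" using M 0(1,6) unfolding scale_inv_def by linarith
  qed
  then show ?case by (rule runs_conseq) auto
next
  case (Suc J)
  let ?K = "2 * com_size phase_prog * (n + 2) ^ 4 * ((kn + 2) * (mw_rounds kn el + 1))"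
  let ?D = "(kn + 1) * (mw_rounds kn el + 1)"
  let ?Q = "\<lambda>t. nats t ''n'' 0 = n \<and> ev n f (Collect (rel n ''R'' t n)) - f S \<le> \<epsilon>"
  interpret sparse_submodular n kn f S by (rule sp)
  show ?case
  proof (cases "\<epsilon> < reals s ''M'' 0")
    case False
    have "runs phases_prog s 1 0 ?Q"
    proof (unfold phases_prog_def, rule runs_while_false)
      show "\<not> bval (RLess (rvar ''eps'') (rvar ''M'')) s" using False Suc.prems by simp
      show "?Q s" using False Suc.prems(1,6) unfolding scale_inv_def by linarith
    qed
    then show ?thesis by (rule runs_conseq) auto
  next
    case True
    let ?M = "reals s ''M'' 0"
    have start: "phase_start n kn f S (rel n ''R'' s) ?M el"
      by unfold_locales (use Suc.prems True eps l in auto)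
    have "runs phases_prog s (Suc (?K + (1 + J * (?K + 1)))) (?D + J * ?D) ?Q"
    proof (unfold phases_prog_def, rule runs_while_true, fold phases_prog_def)
      show "bval (RLess (rvar ''eps'') (rvar ''M'')) s" using True Suc.prems by simp
      show "runs phase_prog s ?K ?D (\<lambda>t. runs phases_prog t (1 + J * (?K + 1)) (J * ?D) ?Q)"
      proof (rule runs_conseq[OF phase_prog[OF Suc.prems(1) n_pos Suc.prems(2,3), unfolded slow_def]], goal_cases)
        case (3 t)
        show ?case
        proof (rule Suc.IH)
          show "nats t ''n'' 0 = n" "nats t ''kk'' 0 = kn" "nats t ''l'' 0 = el" "reals t ''eps'' 0 = \<epsilon>"
            using agreeD[OF 3(2)] Suc.prems by auto
          show "arc_rel n S (rel n ''R'' t)" "scale_inv n kn f S (reals t ''M'' 0) (rel n ''R'' t)"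
            unfolding conjunct1[OF 3(1)] conjunct2[OF 3(1)]
            using phase_start.phase_correct[OF start] by blast+
          show "reals t ''M'' 0 \<le> 2 ^ J * \<epsilon>" using 3(1) Suc.prems(7) by simp
        qed
      qed auto
    qed
    then show ?thesis by (rule runs_conseq) auto
  qed
qed

end

text \<open>Adding the elements outside \<open>S\<close> to \<open>S\<close> raises \<open>f\<close>
  by at most their singleton values. Hence \<open>f S\<close> is at least the value of the ground
  set minus the sum of all \<open>|f {z}|\<close>, which bounds the gap of the empty set; the other
  initial rows are singletons.\<close>

lemma init_inv:
  assumes sp: "sparse_submodular n kn f S" and f0: "f {} = 0"
  shows "arc_rel n S (init_rel n)" "scale_inv n kn f S (init_scale n f) (init_rel n)"
proof -
  interpret sparse_submodular n kn f S by (rule sp)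
  show "arc_rel n S (init_rel n)" unfolding arc_rel_def init_rel_def by auto
  have e0: "ev n f {} = 0" by (simp add: ev_def f0)
  have sub: "ev n f (S \<union> Z) \<le> ev n f S + (\<Sum>z\<in>Z. \<bar>f {z}\<bar>)" if "finite Z" "Z \<subseteq> {..<n} - S" for Z
    using that
  proof (induction Z rule: finite_induct)
    case (insert z Z)
    have "ev n f (S \<union> Z \<union> {z}) - ev n f (S \<union> Z) \<le> ev n f ({} \<union> {z}) - ev n f {}"
      by (rule ev_marginal[OF submod]) (use insert in auto)
    moreover have "ev n f {z} = f {z}" using insert by (simp add: ev_def)
    ultimately show ?case using insert e0 by (simp add: insert_commute)
  qed simp
  have V: "{..<n} = {..n - 1}" using n_pos by auto
  have split: "init_scale n f = (\<Sum>z<n. \<bar>f {z}\<bar>) + (\<Sum>z<n. \<bar>f {..z}\<bar>)"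
    by (simp add: init_scale_def sum.distrib)
  have "f {..<n} = ev n f (S \<union> ({..<n} - S))" using S_sub by (simp add: ev_def Un_absorb1)
  also have "\<dots> \<le> ev n f S + (\<Sum>z\<in>{..<n} - S. \<bar>f {z}\<bar>)" by (rule sub) auto
  also have "\<dots> \<le> f S + (\<Sum>z<n. \<bar>f {z}\<bar>)"
    using S_sub by (auto simp: ev_def Int_absorb2 intro!: sum_mono2)
  finally have a: "f {..<n} - f S \<le> (\<Sum>z<n. \<bar>f {z}\<bar>)" by simp
  have "\<bar>f {..n - 1}\<bar> \<le> (\<Sum>z<n. \<bar>f {..z}\<bar>)"
    using n_pos by (intro member_le_sum[of "n - 1" "{..<n}" "\<lambda>z. \<bar>f {..z}\<bar>"]) auto
  then have "- f S \<le> init_scale n f" using a V split by simp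
  moreover have row: "ev n f (Collect (init_rel n p)) = (if p < n then f {p} else 0)" if "p \<le> n" for p
  proof -
    have "Collect (init_rel n p) \<inter> {..<n} = (if p < n then {p} else {})"
      using that by (auto simp: init_rel_def)
    then show ?thesis by (simp add: ev_def f0)
  qed
  moreover have "f {p} \<le> init_scale n f" if "p < n" for p
  proof -
    have "\<bar>f {p}\<bar> \<le> (\<Sum>z<n. \<bar>f {z}\<bar>)"
      using that by (intro member_le_sum[of p "{..<n}" "\<lambda>z. \<bar>f {z}\<bar>"]) auto
    moreover have "0 \<le> (\<Sum>z<n. \<bar>f {..z}\<bar>)" by (intro sum_nonneg) auto
    ultimately show ?thesis using split by linarith
  qed
  ultimately show "scale_inv n kn f S (init_scale n f) (init_rel n)"
    unfolding scale_inv_def by simp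
qed

lemma init_scale_le: "init_scale n f \<le> 2 * real n * max_abs {..<n} f"
proof -
  have b: "\<bar>f X\<bar> \<le> max_abs {..<n} f" if "X \<subseteq> {..<n}" for X
    unfolding max_abs_def by (rule Max_ge) (use that in auto)
  have "init_scale n f \<le> (\<Sum>p<n. 2 * max_abs {..<n} f)"
    unfolding init_scale_def
  proof (rule sum_mono)
    fix p assume "p \<in> {..<n}"
    then have "{p} \<subseteq> {..<n}" "{..p} \<subseteq> {..<n}" by auto
    from this[THEN b] show "\<bar>f {p}\<bar> + \<bar>f {..p}\<bar> \<le> 2 * max_abs {..<n} f" by linarith
  qed
  then show ?thesis by (simp add: mult_ac)
qed

text \<open>The logarithm of \<open>2 * (n + 2) * F / \<epsilon>\<close> splits into three summands,
  and with all factors at least 1 a sum is dominated by products. The factor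
  \<open>log 2 (n + 2)\<close> is one of the two logarithms hidden in the final bounds. For
  \<open>n = 0\<close> the scale is at most 0 and no phase is run.\<close>

lemma number_of_phases:
  fixes M \<epsilon> F :: real
  assumes M: "M \<le> 2 * real n * F" and eps: "0 < \<epsilon>"
  obtains J where "M \<le> 2 ^ J * \<epsilon>" "real J \<le> 4 * log 2 (real n + 2) * max 1 (log 2 (F / \<epsilon>))" "n = 0 \<longrightarrow> J = 0"
proof (cases "M \<le> \<epsilon>")
  case True
  have "0 \<le> 4 * log 2 (real n + 2) * max 1 (log 2 (F / \<epsilon>))" by simp
  then show ?thesis using True by (intro that[of 0]) auto
next
  case False
  then have pos: "0 < 2 * real n * F" using M eps by linarith
  then have n: "n \<noteq> 0" by (cases "n = 0") auto
  then have F: "0 < F" using pos by (simp add: zero_less_mult_iff)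
  define J where "J = nat \<lceil>log 2 (M / \<epsilon>)\<rceil>"
  have r: "1 < M / \<epsilon>" using False eps by simp
  have l0: "0 < log 2 (M / \<epsilon>)" using r by simp
  have J: "log 2 (M / \<epsilon>) \<le> real J" "real J \<le> log 2 (M / \<epsilon>) + 1"
    using l0 unfolding J_def by linarith+
  define lg L where "lg = log 2 (real n + 2)" and "L = max 1 (log 2 (F / \<epsilon>))"
  have lg: "1 \<le> lg" unfolding lg_def using n by (subst one_le_log_cancel_iff) auto
  have L: "1 \<le> L" "log 2 (F / \<epsilon>) \<le> L" unfolding L_def by auto
  have "M / \<epsilon> = 2 powr log 2 (M / \<epsilon>)" using r by simp
  also have "\<dots> \<le> 2 powr real J" using J(1) by simp
  also have "\<dots> = 2 ^ J" by (simp add: powr_realpow)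
  finally have 1: "M \<le> 2 ^ J * \<epsilon>" using eps by (simp add: field_simps)
  have "M / \<epsilon> \<le> 2 * (real n + 2) * (F / \<epsilon>)"
  proof -
    have "M \<le> 2 * (real n + 2) * F" using M F by (simp add: algebra_simps)
    then show ?thesis using eps by (simp add: divide_right_mono)
  qed
  then have "log 2 (M / \<epsilon>) \<le> log 2 (2 * (real n + 2) * (F / \<epsilon>))"
    using r F eps by (subst log_le_cancel_iff) auto
  also have "\<dots> = 1 + lg + log 2 (F / \<epsilon>)"
    unfolding lg_def using F eps by (simp add: log_mult log_divide del: distrib_left_numeral)
  finally have "real J \<le> 2 + lg + L" using J(2) L by linarith
  also have "\<dots> \<le> 2 * (lg * L) + lg * L + lg * L"
  proof -
    have "1 * 1 \<le> lg * L" using lg L by (intro mult_mono) auto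
    moreover have "lg * 1 \<le> lg * L" using lg L by (intro mult_left_mono) auto
    moreover have "1 * L \<le> lg * L" using lg L by (intro mult_right_mono) auto
    ultimately show ?thesis by linarith
  qed
  finally have "real J \<le> 4 * lg * L" by (simp add: mult_ac)
  then show ?thesis using 1 n that unfolding lg_def L_def by blast
qed

section \<open>Explicit step and depth counts and their asymptotic form\<close>

definition step_bound :: "nat \<Rightarrow> nat \<Rightarrow> nat \<Rightarrow> nat \<Rightarrow> nat" where
  "step_bound n kn el J = 2 * com_size setup_prog * (n + 2) ^ 2 +
    (1 + J * (2 * com_size phase_prog * (n + 2) ^ 4 * ((kn + 2) * (mw_rounds kn el + 1)) + 1)
     + com_size output_prog * (n + 2))"

definition depth_bound :: "nat \<Rightarrow> nat \<Rightarrow> nat \<Rightarrow> nat" where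
  "depth_bound kn el J = 1 + J * ((kn + 1) * (mw_rounds kn el + 1))"

lemma main_prog:
  assumes sub: "submodular_on {..<n} f" and f0: "f {} = 0" and k: "0 < k" and eps: "0 < \<epsilon>"
    and sparse: "sparse_minimizer {..<n} f k S"
  obtains J el where "real J \<le> 4 * log 2 (real n + 2) * log_ratio {..<n} f \<epsilon>" "n = 0 \<longrightarrow> J = 0"
    "real el \<le> log 2 (real n + 2) + 2" "1 \<le> el"
    "query_model.runs n f main_prog (initial_state n k \<epsilon>)
      (step_bound n (min k n) el J) (depth_bound (min k n) el J)
      (\<lambda>t. approx_minimizer {..<n} f \<epsilon> (output_set n t))"
proof -
  let ?A = "\<lambda>t. approx_minimizer {..<n} f \<epsilon> (output_set n t)"
  interpret query_model n f .
  obtain J where J: "init_scale n f \<le> 2 ^ J * \<epsilon>"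
    "real J \<le> 4 * log 2 (real n + 2) * max 1 (log 2 (max_abs {..<n} f / \<epsilon>))" "n = 0 \<longrightarrow> J = 0"
    by (rule number_of_phases[OF init_scale_le eps])
  let ?s = "initial_state n k \<epsilon>" and ?kn = "min k n"
  have s: "nats ?s ''n'' 0 = n" "nats ?s ''k'' 0 = k" "reals ?s ''eps'' 0 = \<epsilon>"
    by (simp_all add: initial_state_def)
  have S: "S \<subseteq> {..<n}" "f S = min_value {..<n} f" "card S \<le> k"
    using sparse unfolding sparse_minimizer_def by auto
  have low: "f S \<le> ev n f X" for X
    unfolding S(2) min_value_def ev_def by (rule Min_le) auto
  have approx: "approx_minimizer {..<n} f \<epsilon> (X \<inter> {..<n})" if "ev n f X - f S \<le> \<epsilon>" for X
    using that S(2) unfolding approx_minimizer_def ev_def by auto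
  obtain t k1 qs where t: "exec n f setup_prog ?s t k1 qs" "k1 \<le> 2 * com_size setup_prog * (n + 2) ^ 2"
    "length qs \<le> 1" "\<forall>m\<in>set qs. m \<le> 2 * n * (n + 1)"
    and post: "nats t ''n'' 0 = n" "reals t ''eps'' = reals ?s ''eps''" "nats t ''kk'' 0 = ?kn"
      "1 \<le> nats t ''l'' 0" "ln (real n) \<le> real (nats t ''l'' 0)" "real (nats t ''l'' 0) \<le> log 2 (real n + 2) + 2"
      "reals t ''M'' 0 = init_scale n f" "rel n ''R'' t = init_rel n"
    using setup_prog[OF s(1,2)] unfolding slow_def runs_def mult_1_right by blast
  define el where "el = nats t ''l'' 0"
  let ?K = "1 + J * (2 * com_size phase_prog * (n + 2) ^ 4 * ((?kn + 2) * (mw_rounds ?kn el + 1)) + 1)"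
  let ?D = "J * ((?kn + 1) * (mw_rounds ?kn el + 1))"
  let ?Q = "\<lambda>t. nats t ''n'' 0 = n \<and> ev n f (Collect (rel n ''R'' t n)) - f S \<le> \<epsilon>"
  have loop: "runs phases_prog t ?K ?D ?Q"
  \<comment> \<open>\<open>sparse_submodular\<close> requires \<open>1 \<le> n\<close>. On the empty
    ground set the initial scale is an empty sum, so the loop is never entered.\<close>
  proof (cases "n = 0")
    case True
    have M0: "reals t ''M'' 0 = 0" using True post(7) by (simp add: init_scale_def)
    have "S = {}" using S(1) True by simp
    then have "?Q t" using True post(1) eps f0 by (simp add: ev_def)
    then have "runs phases_prog t 1 0 ?Q" using M0 post(2) s(3) eps unfolding phases_prog_def by (intro runs_while_false) simp_all
    then show ?thesis by (rule runs_conseq) auto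
  next
    case False
    have "card S \<le> n" using card_mono[OF _ S(1)] by simp
    then have sp: "sparse_submodular n ?kn f S"
      by unfold_locales (use sub S low False k in auto)
    show ?thesis
    proof (rule phase_loop[OF sp])
      show "arc_rel n S (rel n ''R'' t)" "scale_inv n ?kn f S (reals t ''M'' 0) (rel n ''R'' t)"
        unfolding post(7,8) by (rule init_inv[OF sp f0])+
    qed (use post s(3) J(1) eps el_def in auto)
  qed
  have "runs main_prog ?s (2 * com_size setup_prog * (n + 2) ^ 2 + (?K + com_size output_prog * (n + 2))) (1 + (?D + 0))
      ?A"
    unfolding main_prog_def
  proof (rule runs_seq)
    have "runs (Seq phases_prog output_prog) t (?K + com_size output_prog * (n + 2)) (?D + 0)
      ?A"
    proof (rule runs_seq, rule runs_conseq[OF loop order_refl order_refl])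
      fix u assume u: "?Q u"
      show "runs output_prog u (com_size output_prog * (n + 2)) 0 ?A"
        by (rule runs_conseq[OF output_prog[unfolded quick_def]]) (use u approx in auto)
    qed
    then show "runs setup_prog ?s (2 * com_size setup_prog * (n + 2) ^ 2) 1
      (\<lambda>t. runs (Seq phases_prog output_prog) t (?K + com_size output_prog * (n + 2)) (?D + 0)
        ?A)"
      using t unfolding runs_def[of setup_prog] by blast
  qed
  then have "runs main_prog ?s (step_bound n ?kn el J) (depth_bound ?kn el J) ?A"
    by (simp only: step_bound_def depth_bound_def add_0_right)
  then show ?thesis using J(2,3) post(4,6) that[of J el] unfolding log_ratio_def el_def by blast
qed

text \<open>The constant is \<open>3 * 6400 + 1\<close>: the 3 comes from
  \<open>el \<le> 3 * lg\<close>, and the single extra round is absorbed by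
  \<open>W^5 * lg \<ge> 1\<close>.\<close>

lemma rounds_le:
  assumes "1 \<le> lg" "real el \<le> 3 * lg" "real kn \<le> W" "1 \<le> W"
  shows "real (mw_rounds kn el + 1) \<le> 19201 * (W ^ 5 * lg)"
proof -
  have "real kn ^ 5 * real el \<le> W ^ 5 * (3 * lg)"
    using assms by (intro mult_mono power_mono) auto
  moreover have "1 * 1 \<le> W ^ 5 * lg" using assms by (intro mult_mono one_le_power) auto
  ultimately show ?thesis by (simp add: mw_rounds_def)
qed

lemma depth_le:
  assumes lg: "1 \<le> lg" and L: "1 \<le> L" and el: "real el \<le> 3 * lg" and J: "real J \<le> 4 * lg * L"
    and kn: "kn \<le> k" and k: "0 < k" and J0: "kn = 0 \<longrightarrow> J = 0"
  shows "real (depth_bound kn el J) \<le> 153625 * (lg\<^sup>2 * (real k ^ 7 * L))"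
proof -
  have one: "1 * (1 * 1) \<le> lg\<^sup>2 * (real k ^ 7 * L)"
    using lg L k by (intro mult_mono one_le_power) auto
  show ?thesis
  proof (cases "kn = 0")
    case True
    then show ?thesis using one J0 by (simp add: depth_bound_def)
  next
    case False
    then have kn1: "1 \<le> real kn" by simp
    have "real (mw_rounds kn el + 1) \<le> 19201 * (real kn ^ 5 * lg)"
      by (rule rounds_le) (use lg el kn1 in auto)
    also have "\<dots> \<le> 19201 * (real k ^ 5 * lg)"
      using kn lg by (intro mult_left_mono mult_right_mono power_mono) auto
    finally have T: "real (mw_rounds kn el + 1) \<le> 19201 * (real k ^ 5 * lg)" .
    \<comment> \<open>The left side is only of order \<open>k\<close>; the second factor
      \<open>k\<close> brings the exponent from 6 to 7.\<close>
    have K: "real (kn + 1) \<le> 2 * (real k * real k)"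
    proof -
      have "real k * 1 \<le> real k * real k" using k by (intro mult_left_mono) auto
      moreover have "real (kn + 1) \<le> 2 * real k" using kn k by simp
      ultimately show ?thesis by linarith
    qed
    have "real J * (real (kn + 1) * real (mw_rounds kn el + 1))
        \<le> (4 * lg * L) * ((2 * (real k * real k)) * (19201 * (real k ^ 5 * lg)))"
      using J K T lg L by (intro mult_mono) auto
    also have "\<dots> = 153608 * (lg\<^sup>2 * (real k ^ 7 * L))"
      by (simp add: power2_eq_square eval_nat_numeral)
    finally have "real (J * ((kn + 1) * (mw_rounds kn el + 1))) \<le> 153608 * (lg\<^sup>2 * (real k ^ 7 * L))"
      by (simp only: of_nat_mult)
    then show ?thesis using one by (simp add: depth_bound_def)
  qed
qed

text \<open>The exponent 10 consists of 4 for the loop nests inside a query round, 1 for the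
  insertion rounds of a phase and 5 for the steps of multiplicative weights, each \<open>kn\<close>
  being replaced by \<open>n + 2\<close>.\<close>

lemma steps_le:
  defines "c1 \<equiv> com_size setup_prog" and "c2 \<equiv> com_size phase_prog" and "c3 \<equiv> com_size output_prog"
  assumes lg: "1 \<le> lg" and L: "1 \<le> L" and el: "real el \<le> 3 * lg" and J: "real J \<le> 4 * lg * L"
    and kn: "kn \<le> n"
  shows "real (step_bound n kn el J) \<le> (2 * c1 + c3 + 1 + 4 * (2 * c2 * 19201 + 1)) * (real n + 2) ^ 10 * (lg\<^sup>2 * L)"
proof -
  define W where "W = real n + 2"
  have W: "1 \<le> W" "real (n + 2) = W" "real kn \<le> W" "real (kn + 2) \<le> W" using kn by (auto simp: W_def)
  define Y where "Y = W ^ 10 * (lg\<^sup>2 * L)"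
  have lgL: "1 * 1 \<le> lg\<^sup>2 * L" using lg L by (intro mult_mono one_le_power) auto
  have pow: "W ^ i \<le> Y" if "i \<le> 10" for i
  proof -
    have "W ^ i * 1 \<le> W ^ 10 * (lg\<^sup>2 * L)"
      using that W lgL by (intro mult_mono power_increasing) auto
    then show ?thesis by (simp add: Y_def)
  qed
  have T: "real (mw_rounds kn el + 1) \<le> 19201 * (W ^ 5 * lg)"
    by (rule rounds_le) (use lg el W in auto)
  define E where "E = real (kn + 2) * real (mw_rounds kn el + 1)"
  have "E \<le> W * (19201 * (W ^ 5 * lg))"
    unfolding E_def using W T lg by (intro mult_mono) auto
  then have "real c2 * W ^ 4 * E \<le> real c2 * W ^ 4 * (W * (19201 * (W ^ 5 * lg)))"
    using W by (intro mult_left_mono) auto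
  also have "\<dots> = real c2 * 19201 * (W ^ 10 * lg)" by (simp add: eval_nat_numeral)
  finally have a: "2 * real c2 * W ^ 4 * E \<le> 2 * real c2 * 19201 * (W ^ 10 * lg)"
    by linarith
  have "1 * 1 \<le> W ^ 10 * lg" using W lg by (intro mult_mono one_le_power) auto
  then have "2 * real c2 * W ^ 4 * E + 1
      \<le> (2 * real c2 * 19201 + 1) * (W ^ 10 * lg)" using a by (simp only: distrib_right)
  moreover have "0 \<le> 2 * real c2 * W ^ 4 * E + 1"
    using W by (auto simp: E_def intro!: add_nonneg_nonneg mult_nonneg_nonneg)
  ultimately have "real J * (2 * real c2 * W ^ 4 * E + 1)
      \<le> (4 * lg * L) * ((2 * real c2 * 19201 + 1) * (W ^ 10 * lg))"
    using J W lg L by (intro mult_mono) auto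
  also have "\<dots> = 4 * (2 * real c2 * 19201 + 1) * Y" by (simp add: Y_def power2_eq_square mult_ac)
  finally have loop: "real J * (2 * real c2 * W ^ 4 * E + 1)
      \<le> 4 * (2 * real c2 * 19201 + 1) * Y" .
  have "2 * real c1 * W ^ 2 \<le> 2 * real c1 * Y" "real c3 * W ^ 1 \<le> real c3 * Y" "W ^ 0 \<le> Y"
    by (intro mult_left_mono pow; simp)+
  then have "2 * real c1 * W ^ 2 + (1 + real J * (2 * real c2 * W ^ 4 * E + 1) + real c3 * W)
      \<le> 2 * real c1 * Y + (Y + 4 * (2 * real c2 * 19201 + 1) * Y + real c3 * Y)"
    using loop by (simp only: power_0 power_one_right)
  also have "\<dots> = (2 * real c1 + real c3 + 1 + 4 * (2 * real c2 * 19201 + 1)) * Y" by (simp only: distrib_right)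
  finally show ?thesis
    unfolding step_bound_def c1_def[symmetric] c2_def[symmetric] c3_def[symmetric] Y_def E_def W_def by (simp only: of_nat_add of_nat_mult of_nat_power of_nat_1 of_nat_numeral mult.assoc)
qed

theorem theorem1p1:
  shows "\<exists>(P :: com) (C1 :: real) (c1 :: nat) (C2 :: real) (c2 :: nat) (p :: real poly) (q :: real poly).
    \<forall>(n :: nat) (k :: nat) (\<epsilon> :: real) (EO :: real) (f :: nat set \<Rightarrow> real).
      k > 0 \<longrightarrow> \<epsilon> > 0 \<longrightarrow> EO > 0 \<longrightarrow>
      submodular_on {..<n} f \<longrightarrow> f {} = 0 \<longrightarrow> (\<exists>S. sparse_minimizer {..<n} f k S) \<longrightarrow>
      (\<exists>t steps qs.
         exec n f P (initial_state n k \<epsilon>) t steps qs \<and>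
         approx_minimizer {..<n} f \<epsilon> (output_set n t) \<and>
         (\<forall>m \<in> set qs. real m \<le> poly q (real n + log_ratio {..<n} f \<epsilon>)) \<and>
         real (parallel_depth qs) \<le> soft_O C1 c1 n (real k ^ 7 * log_ratio {..<n} f \<epsilon>) \<and>
         runtime EO steps qs \<le>
           soft_O C2 c2 n (real n ^ 2 * real k ^ 7 * log_ratio {..<n} f \<epsilon> * EO
                           + poly p (real n) * log_ratio {..<n} f \<epsilon>))"
proof -
  define A where "A = real (2 * com_size setup_prog + com_size output_prog + 1 + 4 * (2 * com_size phase_prog * 19201 + 1))"
  define p where "p = smult A ([:2, 1:] ^ 10)"
  define q :: "real poly" where "q = [:0, 2, 2:]"
  have p: "poly p (real n) = A * (real n + 2) ^ 10" for n
    by (simp add: p_def poly_power add.commute)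
  have A: "0 \<le> A" by (simp add: A_def)
  show ?thesis
  \<comment> \<open>Both exponents are 2, one logarithm from \<open>el\<close> and one from the
    number of phases. The constant 614500 is \<open>4 * 153625\<close>, because a round has at most
    \<open>2 * n * (n + 1) \<le> 4 * n^2\<close> queries.\<close>
  proof (rule exI[of _ main_prog], rule exI[of _ 153625], rule exI[of _ 2], rule exI[of _ 614500],
      rule exI[of _ 2], rule exI[of _ p], rule exI[of _ q], intro allI impI)
    fix n k :: nat and \<epsilon> EO :: real and f :: "nat set \<Rightarrow> real"
    assume k: "0 < k" and eps: "0 < \<epsilon>" and EO: "0 < EO" and sub: "submodular_on {..<n} f" and f0: "f {} = 0"
      and "\<exists>S. sparse_minimizer {..<n} f k S"
    then obtain S where S: "sparse_minimizer {..<n} f k S" by blast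
    define lg L where "lg = log 2 (real n + 2)" and "L = log_ratio {..<n} f \<epsilon>"
    have lg: "1 \<le> lg" unfolding lg_def by (subst one_le_log_cancel_iff) auto
    have L: "1 \<le> L" by (simp add: L_def log_ratio_def)
    let ?kn = "min k n"
    obtain J el where J: "real J \<le> 4 * lg * L" "n = 0 \<longrightarrow> J = 0" and el: "real el \<le> lg + 2" "1 \<le> el"
      and run: "query_model.runs n f main_prog (initial_state n k \<epsilon>)
        (step_bound n ?kn el J)
        (depth_bound ?kn el J)
        (\<lambda>t. approx_minimizer {..<n} f \<epsilon> (output_set n t))"
      by (rule main_prog[OF sub f0 k eps S, folded lg_def L_def])
    obtain t steps qs where ex: "exec n f main_prog (initial_state n k \<epsilon>) t steps qs"
      and steps: "steps \<le> step_bound n ?kn el J"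
      and len: "length qs \<le> depth_bound ?kn el J"
      and qs: "\<forall>m\<in>set qs. m \<le> 2 * n * (n + 1)"
      and out: "approx_minimizer {..<n} f \<epsilon> (output_set n t)"
      using run unfolding query_model.runs_def by auto
    have el3: "real el \<le> 3 * lg" using el lg by simp
    have "real (length qs) \<le> real (depth_bound ?kn el J)"
      using len by (simp only: of_nat_le_iff)
    also have "\<dots> \<le> 153625 * (lg\<^sup>2 * (real k ^ 7 * L))"
      by (rule depth_le[OF lg L el3 J(1)]) (use k J(2) in auto)
    finally have depth: "real (length qs) \<le> 153625 * (lg\<^sup>2 * (real k ^ 7 * L))" .
    have "real steps \<le> real (step_bound n ?kn el J)"
      using steps by (simp only: of_nat_le_iff)
    also have "\<dots> \<le> A * (real n + 2) ^ 10 * (lg\<^sup>2 * L)"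
      using steps_le[OF lg L el3 J(1), of ?kn n]
      by (simp add: A_def)
    finally have steps': "real steps \<le> lg\<^sup>2 * (poly p (real n) * L)" by (simp add: p mult_ac)
    have "sum_list qs \<le> length qs * (2 * n * (n + 1))"
      using qs by (induction qs) auto
    also have "\<dots> \<le> length qs * (4 * n\<^sup>2)"
      by (intro mult_left_mono) (cases n, auto simp: power2_eq_square)
    finally have "real (sum_list qs) \<le> real (length qs * (4 * n\<^sup>2))" by (simp only: of_nat_le_iff)
    also have "\<dots> = real (length qs) * (4 * (real n)\<^sup>2)" by simp
    also have "\<dots> \<le> 153625 * (lg\<^sup>2 * (real k ^ 7 * L)) * (4 * (real n)\<^sup>2)"
      by (rule mult_right_mono[OF depth]) simp
    finally have "EO * real (sum_list qs) \<le> EO * (153625 * (lg\<^sup>2 * (real k ^ 7 * L)) * (4 * (real n)\<^sup>2))"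
      using EO by (intro mult_left_mono) auto
    moreover have "1 * (lg\<^sup>2 * (poly p (real n) * L)) \<le> 614500 * (lg\<^sup>2 * (poly p (real n) * L))"
      using A L by (intro mult_right_mono) (auto simp: p)
    ultimately have run: "runtime EO steps qs \<le>
        soft_O 614500 2 n (real n ^ 2 * real k ^ 7 * L * EO + poly p (real n) * L)"
      using steps' unfolding runtime_def soft_O_def lg_def[symmetric] by (simp add: distrib_left mult_ac)
    have "real m \<le> poly q (real n + L)" if "m \<in> set qs" for m
    proof -
      have "real m \<le> real (2 * n * (n + 1))" using qs that by (simp only: of_nat_le_iff)
      also have "\<dots> = 2 * (real n * (real n + 1))" by (simp add: algebra_simps)
      also have "\<dots> \<le> 2 * ((real n + L) * ((real n + L) + 1))"
        using L by (intro mult_left_mono mult_mono) auto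
      also have "\<dots> = poly q (real n + L)" by (simp add: q_def algebra_simps)
      finally show ?thesis .
    qed
    moreover have "real (parallel_depth qs) \<le> soft_O 153625 2 n (real k ^ 7 * L)"
      using depth by (simp add: parallel_depth_def soft_O_def lg_def mult.assoc)
    ultimately show "\<exists>t steps qs. exec n f main_prog (initial_state n k \<epsilon>) t steps qs \<and>
         approx_minimizer {..<n} f \<epsilon> (output_set n t) \<and>
         (\<forall>m \<in> set qs. real m \<le> poly q (real n + log_ratio {..<n} f \<epsilon>)) \<and>
         real (parallel_depth qs) \<le> soft_O 153625 2 n (real k ^ 7 * log_ratio {..<n} f \<epsilon>) \<and>
         runtime EO steps qs \<le>
           soft_O 614500 2 n (real n ^ 2 * real k ^ 7 * log_ratio {..<n} f \<epsilon> * EO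
                           + poly p (real n) * log_ratio {..<n} f \<epsilon>)"
      using ex out run unfolding L_def by blast
  qed
qed

end
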